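(* Assume $f\in C^1$ with bounded derivative, and let $f=f^++f^-$ be a flux splitting with $(f^+)'(u)\ge0$ and $(f^-)'(u)\le0$ (for instance one obtained via a Lax--Friedrichs decomposition), chosen with $\alpha\ge\max_u|f'(u)|$. Under the CFL condition $\nu:=\alpha\,\Delta t/\Delta x\le1$, the numerical flux $F(q_L,q_R)=\phi^+(q_L)+\phi^-(q_R)$, where $\phi^\pm(q)=\mathrm{round}\bigl(f^\pm(\delta q)\frac{\Delta t}{\Delta x}\delta^{-1}\bigr)$ for $q\in\mathbb Z$, is monotone and consistent. Consequently, the reconstructed solutions $u_i^n=\delta q_i^n$ of the scheme $$q_i^{n+1}=q_i^n-\bigl(F(q_i^n,q_{i+1}^n)-F(q_{i-1}^n,q_i^n)\bigr)$$ converge (along subsequences as $\delta,\Delta x,\Delta t\to0$ with fixed $\nu$ and $\delta/\Delta x\to0$) in $L^1_{\mathrm{loc}}$ to the entropy solution of $\partial_tu+\partial_xf(u)=0$.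
   Context: Setting: a uniform one-dimensional grid with cell centres $x_i=i\Delta x$ and times $t^n=n\Delta t$; quantisation resolution $\delta>0$; integer states $q_i^n\in\mathbb Z$, related to cell-average approximations $u_i^n$ of the continuum field by the quantisation convention $q_i^n=\mathrm{round}(u_i^n/\delta)$, with reconstruction $u_i^n=\delta q_i^n$. $\mathrm{round}:\mathbb R\to\mathbb Z$ is rounding to the nearest integer (nondecreasing, with $|\mathrm{round}(x)-x|\le\tfrac12$). "Monotone" flux means that $F$ is nondecreasing in $q_L$ and nonincreasing in $q_R$. "Consistent" means: with $\mathcal F(u_L,u_R):=f^+(u_L)+f^-(u_R)$ (so $\mathcal F(u,u)=f(u)$), the reconstructed update satisfies $\frac{u_i^{n+1}-u_i^n}{\Delta t}=-\frac{\mathcal F(u_i^n,u_{i+1}^n)-\mathcal F(u_{i-1}^n,u_i^n)}{\Delta x}+\mathcal O(\delta/\Delta x)$ for fixed $\nu$, so that the residual vanishes as $\delta/\Delta x\to0$.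
   Formalization: Convergence is proved under the added condition (f^+)' - (f^-)' <= alpha (met by Lax-Friedrichs); without it, it fails, e.g. for f=0, f^±(u)=±u, alpha=nu=1. Initial data are quantised cell averages of any bounded u_0; alpha and nu are taken positive. *)

theory Defs
  imports "HOL-Analysis.Analysis"
begin

text \<open>Only these two properties of rounding to the nearest integer are fixed;
  the treatment of ties is left open. The library's \<^const>\<open>round\<close> is one instance.\<close>

definition nearest_rounding :: "(real \<Rightarrow> int) \<Rightarrow> bool" where
  "nearest_rounding rnd \<longleftrightarrow> mono rnd \<and> (\<forall>x. \<bar>of_int (rnd x) - x\<bar> \<le> 1 / 2)"

definition quantised_flux ::
    "(real \<Rightarrow> int) \<Rightarrow> (real \<Rightarrow> real) \<Rightarrow> real \<Rightarrow> real \<Rightarrow> real \<Rightarrow> int \<Rightarrow> int" where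
  "quantised_flux rnd g \<delta> dx dt q = rnd (g (\<delta> * of_int q) * (dt / dx) * inverse \<delta>)"

definition num_flux ::
    "(real \<Rightarrow> int) \<Rightarrow> (real \<Rightarrow> real) \<Rightarrow> (real \<Rightarrow> real) \<Rightarrow> real \<Rightarrow> real \<Rightarrow> real \<Rightarrow> int \<Rightarrow> int \<Rightarrow> int" where
  "num_flux rnd fp fm \<delta> dx dt qL qR =
     quantised_flux rnd fp \<delta> dx dt qL + quantised_flux rnd fm \<delta> dx dt qR"

definition monotone_flux :: "(int \<Rightarrow> int \<Rightarrow> int) \<Rightarrow> bool" where
  "monotone_flux F \<longleftrightarrow> (\<forall>qR. mono (\<lambda>qL. F qL qR)) \<and> (\<forall>qL. antimono (\<lambda>qR. F qL qR))"

primrec scheme :: "(int \<Rightarrow> int \<Rightarrow> int) \<Rightarrow> (int \<Rightarrow> int) \<Rightarrow> nat \<Rightarrow> int \<Rightarrow> int" where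
  "scheme F q0 0 = q0"
| "scheme F q0 (Suc n) =
     (\<lambda>i. scheme F q0 n i
        - (F (scheme F q0 n i) (scheme F q0 n (i + 1))
         - F (scheme F q0 n (i - 1)) (scheme F q0 n i)))"

definition admissible_grid :: "real \<Rightarrow> real \<Rightarrow> real \<Rightarrow> real \<Rightarrow> real \<Rightarrow> bool" where
  "admissible_grid \<alpha> \<nu> \<delta> dx dt \<longleftrightarrow> 0 < \<delta> \<and> 0 < dx \<and> 0 < dt \<and> \<alpha> * dt / dx = \<nu>"

definition residual ::
    "(real \<Rightarrow> real) \<Rightarrow> (real \<Rightarrow> real) \<Rightarrow> real \<Rightarrow> real \<Rightarrow> (nat \<Rightarrow> int \<Rightarrow> real) \<Rightarrow> nat \<Rightarrow> int \<Rightarrow> real" where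
  "residual fp fm dx dt u n i =
     (u (Suc n) i - u n i) / dt
     + ((fp (u n i) + fm (u n (i + 1))) - (fp (u n (i - 1)) + fm (u n i))) / dx"

text \<open>The constant in the \<open>O(\<delta> / dx)\<close> term may depend on the flux splitting, on \<open>\<alpha>\<close> and on
  the fixed \<open>\<nu>\<close>, but not on the grid, the discrete data, the time level or the cell.\<close>

definition consistent_flux ::
    "(real \<Rightarrow> int) \<Rightarrow> (real \<Rightarrow> real) \<Rightarrow> (real \<Rightarrow> real) \<Rightarrow> (real \<Rightarrow> real) \<Rightarrow> real \<Rightarrow> real \<Rightarrow> bool" where
  "consistent_flux rnd f fp fm \<alpha> \<nu> \<longleftrightarrow>
     (\<forall>u. fp u + fm u = f u) \<and>
     (\<exists>C. \<forall>\<delta> dx dt q0 n i. admissible_grid \<alpha> \<nu> \<delta> dx dt \<longrightarrow>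
        \<bar>residual fp fm dx dt
           (\<lambda>n i. \<delta> * of_int (scheme (num_flux rnd fp fm \<delta> dx dt) q0 n i)) n i\<bar>
        \<le> C * (\<delta> / dx))"

definition cell :: "real \<Rightarrow> int \<Rightarrow> real set" where
  "cell dx i = {(of_int i - 1 / 2) * dx ..< (of_int i + 1 / 2) * dx}"

definition cell_average :: "real \<Rightarrow> (real \<Rightarrow> real) \<Rightarrow> int \<Rightarrow> real" where
  "cell_average dx u0 i = (LINT x:cell dx i|lborel. u0 x) / dx"

definition quantised_data :: "(real \<Rightarrow> int) \<Rightarrow> (real \<Rightarrow> real) \<Rightarrow> real \<Rightarrow> real \<Rightarrow> int \<Rightarrow> int" where
  "quantised_data rnd u0 \<delta> dx i = rnd (cell_average dx u0 i / \<delta>)"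

text \<open>Points of space-time are pairs \<open>(x, t)\<close>. The reconstruction equals \<open>\<delta> q\<^sub>i\<^sup>n\<close> on
  \<open>cell dx i \<times> {n dt ..< (n + 1) dt}\<close>, since \<open>x \<in> cell dx i\<close> iff \<open>i = \<lfloor>x / dx + 1 / 2\<rfloor>\<close>.\<close>

definition reconstruction ::
    "(real \<Rightarrow> int) \<Rightarrow> (real \<Rightarrow> real) \<Rightarrow> (real \<Rightarrow> real) \<Rightarrow> (real \<Rightarrow> real) \<Rightarrow>
     real \<Rightarrow> real \<Rightarrow> real \<Rightarrow> real \<times> real \<Rightarrow> real" where
  "reconstruction rnd fp fm u0 \<delta> dx dt = (\<lambda>(x, t).
     \<delta> * of_int (scheme (num_flux rnd fp fm \<delta> dx dt) (quantised_data rnd u0 \<delta> dx)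
                   (nat \<lfloor>t / dt\<rfloor>) \<lfloor>x / dx + 1 / 2\<rfloor>))"

definition half_plane :: "(real \<times> real) set" where
  "half_plane = UNIV \<times> {0..}"

definition tendsto_L1_loc :: "(nat \<Rightarrow> real \<times> real \<Rightarrow> real) \<Rightarrow> (real \<times> real \<Rightarrow> real) \<Rightarrow> bool" where
  "tendsto_L1_loc w u \<longleftrightarrow>
     (\<forall>K. compact K \<and> K \<subseteq> half_plane \<longrightarrow>
        (\<lambda>k. \<integral>\<^sup>+z\<in>K. ennreal \<bar>w k z - u z\<bar> \<partial>lborel) \<longlonglongrightarrow> 0)"

definition L_infinity_on :: "'a::euclidean_space set \<Rightarrow> ('a \<Rightarrow> real) \<Rightarrow> bool" where
  "L_infinity_on S g \<longleftrightarrow>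
     g \<in> borel_measurable borel \<and> (\<exists>M. AE z in lborel. z \<in> S \<longrightarrow> \<bar>g z\<bar> \<le> M)"

text \<open>Nonnegative \<open>C\<^sup>1\<close> functions with compact support in the whole plane: they need not
  vanish at \<open>t = 0\<close>, which is how the initial data enter below.\<close>

definition test_function ::
    "(real \<times> real \<Rightarrow> real) \<Rightarrow> (real \<times> real \<Rightarrow> real) \<Rightarrow> (real \<times> real \<Rightarrow> real) \<Rightarrow> bool" where
  "test_function \<phi> \<phi>x \<phi>t \<longleftrightarrow>
     (\<forall>z. 0 \<le> \<phi> z) \<and>
     (\<forall>z. (\<phi> has_derivative (\<lambda>h. \<phi>x z * fst h + \<phi>t z * snd h)) (at z)) \<and>
     continuous_on UNIV \<phi>x \<and> continuous_on UNIV \<phi>t \<and>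
     (\<exists>K. compact K \<and> (\<forall>z. z \<notin> K \<longrightarrow> \<phi> z = 0))"

text \<open>Kruzkov's notion of a bounded entropy solution of the Cauchy problem
  \<open>u\<^sub>t + f(u)\<^sub>x = 0\<close>, \<open>u(x, 0) = u0(x)\<close>.\<close>

definition entropy_solution ::
    "(real \<Rightarrow> real) \<Rightarrow> (real \<Rightarrow> real) \<Rightarrow> (real \<times> real \<Rightarrow> real) \<Rightarrow> bool" where
  "entropy_solution f u0 u \<longleftrightarrow>
     L_infinity_on half_plane u \<and>
     (\<forall>k \<phi> \<phi>x \<phi>t. test_function \<phi> \<phi>x \<phi>t \<longrightarrow>
        0 \<le> (LINT z:half_plane|lborel.
                \<bar>u z - k\<bar> * \<phi>t z + sgn (u z - k) * (f (u z) - f k) * \<phi>x z)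
            + (LINT x|lborel. \<bar>u0 x - k\<bar> * \<phi> (x, 0)))"

end

theory Submission
  imports Defs
begin

text \<open>The quantised scheme is a conservative perturbation, of size at most \<open>2 * \<delta>\<close> per step, of the
  unquantised monotone scheme. Over a bounded time span the perturbations add up to
  \<open>O(\<delta> / dt) = O(\<delta> / dx)\<close>, so the reconstructions satisfy the Kruzkov inequalities (with the
  initial term) up to a defect that tends to zero uniformly over bounded, equicontinuous
  families of test functions.

  This alone gives convergence; neither \<open>BV\<close> bounds nor a compactness theorem are needed. Double
  the variables between two such sequences \<open>v\<close> and \<open>w\<close> with a kernel supported in \<open>t1 < t2\<close>: one
  initial term vanishes, the other is controlled by the inequality for \<open>w\<close> itself, taken at the
  levels \<open>k = u0 x\<close>, and by the \<open>L\<^sup>1\<close> continuity of \<open>u0\<close>, provided that the time scale of the kernel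
  is much smaller than its space scale. No regularity of \<open>v\<close> or \<open>w\<close> enters. Using the result for
  the pairs \<open>(v, w)\<close> and \<open>(w, w)\<close> gives \<open>v - w \<rightarrow> 0\<close> in \<open>L\<^sup>1\<close> locally. Applied to two subsequences of
  one sequence of reconstructions this is the Cauchy property, hence existence; applied to exact
  solutions, as constant sequences, it gives uniqueness and identifies the limit.\<close>

section \<open>Integrals of bounded functions, Lipschitz functions and cut-offs\<close>

text \<open>Monotonicity of the numerical flux does not make the quantised update monotone: between
  the same two integers the rounded fp-flux may rise and the rounded fm-flux fall, and then the
  update decreases in its middle argument. Hence monotonicity is used only for the unquantised
  update, where it comes from \<open>fp' u - fm' u \<le> \<alpha>\<close> together with
  \<open>\<nu> \<le> 1\<close>. A bound on |f'| alone would not give it, because large fp' and - fm'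
  can cancel in f'. The quantised scheme has no maximum principle either: its bound may grow by
  \<open>2 * \<delta>\<close> per step. On a fixed time span this growth is O(\<delta> / dt) and
  tends to 0, but nothing bounds the solution for all times at a fixed grid. This is why
  reconstructions are clamped, and why the scheme relation is exploited only up to the time where
  the test functions vanish. The time scale s of the kernel has to be small against its space scale
  because the flux term in the initial layer has size s times the supremum of |a'|, and the latter
  blows up as the space scale shrinks.\<close>

lemma integrable_bounded_support:
  fixes g :: "'a::euclidean_space \<Rightarrow> real"
  assumes "g \<in> borel_measurable borel" "\<And>z. \<bar>g z\<bar> \<le> C" "\<And>z. norm z > R \<Longrightarrow> g z = 0"
  shows "integrable lborel g"
proof (rule Bochner_Integration.integrable_bound)
  show "integrable lborel (\<lambda>z. C * indicator (cball (0::'a) R) z)"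
    by (intro integrable_mult_right integrable_real_indicator) (use emeasure_lborel_cball_finite[of "0::'a" R] in \<open>auto simp: less_top\<close>)
  show "AE z in lborel. norm (g z) \<le> norm (C * indicator (cball 0 R) z)"
    using assms(2,3) by (intro AE_I2) (auto simp: indicator_def abs_le_iff not_le intro: order_trans[OF _ abs_ge_self])
qed (use assms in auto)

lemma fubini_bounded_support:
  fixes g :: "'a::euclidean_space \<times> 'b::euclidean_space \<Rightarrow> real"
  assumes "g \<in> borel_measurable borel" "\<And>z. \<bar>g z\<bar> \<le> C" "\<And>z. norm z > R \<Longrightarrow> g z = 0"
  shows "(LBINT x. (LBINT y. g (x, y))) = (LBINT z. g z)"
    and "(LBINT y. (LBINT x. g (x, y))) = (LBINT z. g z)"
    and "integrable lborel (\<lambda>x. \<integral>y. g (x, y) \<partial>lborel)"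
    and "integrable lborel (\<lambda>y. \<integral>x. g (x, y) \<partial>lborel)"
proof -
  have i: "integrable (lborel \<Otimes>\<^sub>M lborel) (case_prod (\<lambda>x y. g (x, y)))"
    using integrable_bounded_support[OF assms] by (simp add: lborel_prod)
  show "(LBINT x. (LBINT y. g (x, y))) = (LBINT z. g z)"
    using lborel_pair.integral_fst[OF i] by (simp add: lborel_prod)
  show "(LBINT y. (LBINT x. g (x, y))) = (LBINT z. g z)"
    using lborel_pair.integral_snd[OF i] by (simp add: lborel_prod)
  show "integrable lborel (\<lambda>x. \<integral>y. g (x, y) \<partial>lborel)"
    using lborel_pair.integrable_fst[OF i] by simp
  show "integrable lborel (\<lambda>y. \<integral>x. g (x, y) \<partial>lborel)"
    using lborel_pair.integrable_snd[OF i] by simp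
qed

lemma lborel_integral_translate:
  fixes g :: "'a::euclidean_space \<Rightarrow> real"
  assumes "g \<in> borel_measurable borel"
  shows "(LBINT z. g (c + z)) = (LBINT z. g z)"
proof -
  have "(LBINT z. g z) = (\<integral>z. g z \<partial>(distr lborel borel ((+) c)))"
    by (simp add: lborel_distr_plus)
  also have "\<dots> = (LBINT z. g (c + z))"
    by (subst integral_distr) (use assms in auto)
  finally show ?thesis by simp
qed

section \<open>Bounded Lipschitz functions\<close>

text \<open>One number serves both as bound and as Lipschitz constant, so that sums, products and
  compositions are tracked by a single constant.\<close>

definition bounded_Lipschitz :: "real \<Rightarrow> ('a::metric_space \<Rightarrow> real) \<Rightarrow> bool" where
  "bounded_Lipschitz L g \<longleftrightarrow> (\<forall>z. \<bar>g z\<bar> \<le> L) \<and> (\<forall>z z'. \<bar>g z - g z'\<bar> \<le> L * dist z z')"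

lemma bounded_LipschitzD:
  assumes "bounded_Lipschitz L g"
  shows "\<bar>g z\<bar> \<le> L" "\<bar>g z - g z'\<bar> \<le> L * dist z z'" "0 \<le> L"
  using assms abs_ge_zero[of "g z"] by (auto simp: bounded_Lipschitz_def simp del: abs_ge_zero intro: order_trans)

lemma bounded_Lipschitz_mono: "bounded_Lipschitz L g \<Longrightarrow> L \<le> L' \<Longrightarrow> bounded_Lipschitz L' g"
  unfolding bounded_Lipschitz_def by (meson mult_right_mono order_trans zero_le_dist)

lemma bounded_Lipschitz_const: "bounded_Lipschitz \<bar>c\<bar> (\<lambda>z. c)"
  by (simp add: bounded_Lipschitz_def)

lemma bounded_Lipschitz_add:
  assumes "bounded_Lipschitz L g" "bounded_Lipschitz L' g'"
  shows "bounded_Lipschitz (L + L') (\<lambda>z. g z + g' z)"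
  unfolding bounded_Lipschitz_def
proof safe
  fix z z'
  show "\<bar>g z + g' z\<bar> \<le> L + L'"
    using bounded_LipschitzD(1)[OF assms(1), of z] bounded_LipschitzD(1)[OF assms(2), of z] by linarith
  show "\<bar>g z + g' z - (g z' + g' z')\<bar> \<le> (L + L') * dist z z'"
    using bounded_LipschitzD(2)[OF assms(1), of z z'] bounded_LipschitzD(2)[OF assms(2), of z z']
    unfolding ring_distribs by linarith
qed

lemma bounded_Lipschitz_mult:
  assumes "bounded_Lipschitz L g" "bounded_Lipschitz L' g'"
  shows "bounded_Lipschitz (2 * L * L') (\<lambda>z. g z * g' z)"
  unfolding bounded_Lipschitz_def
proof safe
  note a = bounded_LipschitzD[OF assms(1)] and b = bounded_LipschitzD[OF assms(2)]
  fix z z'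
  have "\<bar>g z * g' z\<bar> \<le> L * L'"
    unfolding abs_mult using a(1,3) b(1,3) by (intro mult_mono) auto
  also have "\<dots> \<le> 2 * L * L'" using a(3) b(3) by simp
  finally show "\<bar>g z * g' z\<bar> \<le> 2 * L * L'" .
  have "g z * g' z - g z' * g' z' = g z * (g' z - g' z') + (g z - g z') * g' z'"
    by (simp add: algebra_simps)
  also have "\<bar>\<dots>\<bar> \<le> \<bar>g z\<bar> * \<bar>g' z - g' z'\<bar> + \<bar>g z - g z'\<bar> * \<bar>g' z'\<bar>"
    by (metis abs_mult abs_triangle_ineq)
  also have "\<dots> \<le> L * (L' * dist z z') + L * dist z z' * L'"
    using a b by (intro add_mono mult_mono) auto
  finally show "\<bar>g z * g' z - g z' * g' z'\<bar> \<le> 2 * L * L' * dist z z'" by (simp add: algebra_simps)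
qed

text \<open>Composition multiplies the Lipschitz constant by C but leaves the supremum alone; with
  \<open>1 \<le> C\<close> the product \<open>L * C\<close> still bounds both.\<close>

lemma bounded_Lipschitz_compose:
  assumes "bounded_Lipschitz L g" "\<And>z z'. dist (l z) (l z') \<le> C * dist z z'" "1 \<le> C"
  shows "bounded_Lipschitz (L * C) (\<lambda>z. g (l z))"
  unfolding bounded_Lipschitz_def
proof safe
  note a = bounded_LipschitzD[OF assms(1)]
  fix z z'
  show "\<bar>g (l z)\<bar> \<le> L * C" using a(1)[of "l z"] a(3) assms(3) mult_left_mono[of 1 C L] by simp
  have "\<bar>g (l z) - g (l z')\<bar> \<le> L * dist (l z) (l z')" by (rule a(2))
  also have "\<dots> \<le> L * (C * dist z z')" using a(3) assms(2) by (intro mult_left_mono)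
  finally show "\<bar>g (l z) - g (l z')\<bar> \<le> L * C * dist z z'" by simp
qed

lemma bounded_Lipschitz_cmult:
  assumes "bounded_Lipschitz L g"
  shows "bounded_Lipschitz (2 * \<bar>c\<bar> * L) (\<lambda>z. c * g z)"
  using bounded_Lipschitz_mult[OF bounded_Lipschitz_const assms] .

lemma bounded_Lipschitz_continuous:
  assumes "bounded_Lipschitz L g"
  shows "continuous_on UNIV g"
proof (rule continuous_on_iff[THEN iffD2], safe)
  fix z and e :: real assume "0 < e"
  note a = bounded_LipschitzD[OF assms]
  show "\<exists>d>0. \<forall>z'\<in>UNIV. dist z' z < d \<longrightarrow> dist (g z') (g z) < e"
  proof (intro exI[of _ "e / (L + 1)"] conjI ballI impI)
    show "0 < e / (L + 1)" using a(3) \<open>0 < e\<close> by simp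
    fix z' assume "dist z' z < e / (L + 1)"
    then have "L * dist z' z \<le> L * (e / (L + 1))" using a(3) by (intro mult_left_mono) auto
    also have "\<dots> < e" using a(3) \<open>0 < e\<close> by (simp add: field_simps)
    finally show "dist (g z') (g z) < e" using a(2)[of z' z] by (simp add: dist_real_def)
  qed
qed

section \<open>Polynomial cut-off functions\<close>

text \<open>A cut-off equal to 1 for y \<le> 0, to \<open>(1 - y\<^sup>2)\<^sup>2\<close> on [0, 1]
  and to 0 beyond. It has a Lipschitz derivative, and both it and its derivative are explicit
  polynomials in between, so that the quantitative comparisons below reduce to elementary
  inequalities.\<close>

definition step :: "real \<Rightarrow> real" where
  "step y = (1 - (max 0 (min 1 y))\<^sup>2)\<^sup>2"

definition step' :: "real \<Rightarrow> real" where
  "step' y = - 4 * max 0 (min 1 y) * (1 - (max 0 (min 1 y))\<^sup>2)"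

text \<open>At the kink the difference quotient is \<open>max 0 h\<close>, which tends to 0.\<close>

lemma has_real_derivative_max_sq:
  "((\<lambda>y. (max 0 y)\<^sup>2) has_real_derivative 2 * max 0 y) (at (y::real))"
proof -
  consider "y > 0" | "y < 0" | "y = 0" by linarith
  then show ?thesis
  proof cases
    case 1
    have "((\<lambda>y. y\<^sup>2) has_real_derivative 2 * y) (at y)" by (auto intro!: derivative_eq_intros)
    then have "((\<lambda>y. (max 0 y)\<^sup>2) has_real_derivative 2 * y) (at y)"
      by (rule has_field_derivative_transform_within_open[where S = "{0<..}"]) (use 1 in auto)
    then show ?thesis using 1 by simp
  next
    case 2
    have "((\<lambda>y. 0) has_real_derivative 0) (at y)" by simp
    then have "((\<lambda>y. (max 0 y)\<^sup>2) has_real_derivative 0) (at y)"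
      by (rule has_field_derivative_transform_within_open[where S = "{..<0}"]) (use 2 in auto)
    then show ?thesis using 2 by simp
  next
    case 3
    have "(\<lambda>h::real. max 0 h) \<midarrow>0\<rightarrow> max 0 0" by (intro tendsto_intros)
    then have "(\<lambda>h::real. ((max 0 (0 + h))\<^sup>2 - (max 0 0)\<^sup>2) / h) \<midarrow>0\<rightarrow> max 0 0"
      by (rule Lim_transform_eventually)
        (auto simp: eventually_at_filter max_def power2_eq_square)
    then show ?thesis using 3 by (simp add: DERIV_def)
  qed
qed

text \<open>Two nested squared positive parts: in this form the chain rule gives the derivative at
  once, without gluing polynomials at 0 and 1.\<close>

lemma step_alt: "step y = (max 0 (1 - (max 0 y)\<^sup>2))\<^sup>2"
proof (cases "y \<le> 1")
  case True
  then have "(max 0 y)\<^sup>2 \<le> 1" using power_mono[of "max 0 y" 1 2] by simp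
  then show ?thesis using True by (simp add: step_def)
next
  case False
  then have "1 < y\<^sup>2" by (simp add: one_less_power)
  then show ?thesis using False by (simp add: step_def)
qed

lemma has_real_derivative_step: "(step has_real_derivative step' y) (at y)"
proof -
  have *: "((\<lambda>y. 1 - (max 0 y)\<^sup>2) has_real_derivative - (2 * max 0 y)) (at y)"
    using DERIV_diff[OF DERIV_const[of 1] has_real_derivative_max_sq[of y]] by simp
  have "((\<lambda>y. (max 0 (1 - (max 0 y)\<^sup>2))\<^sup>2) has_real_derivative
      2 * max 0 (1 - (max 0 y)\<^sup>2) * - (2 * max 0 y)) (at y)"
    by (rule DERIV_chain2[OF has_real_derivative_max_sq *])
  moreover have "2 * max 0 (1 - (max 0 y)\<^sup>2) * - (2 * max 0 y) = step' y"
  proof (cases "y \<le> 1")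
    case True
    then have "(max 0 y)\<^sup>2 \<le> 1" using power_mono[of "max 0 y" 1 2] by simp
    then show ?thesis using True by (simp add: step'_def)
  next
    case False
    then have "1 < y\<^sup>2" by (simp add: one_less_power)
    then show ?thesis using False by (simp add: step'_def)
  qed
  ultimately show ?thesis by (simp add: step_alt[abs_def])
qed

lemma bounded_Lipschitz_clamp: "bounded_Lipschitz 1 (\<lambda>y::real. max 0 (min 1 y))"
  by (auto simp: bounded_Lipschitz_def dist_real_def max_def min_def)

lemma bounded_Lipschitz_step: "\<exists>L. bounded_Lipschitz L step"
proof -
  let ?c = "\<lambda>y::real. max 0 (min 1 y)"
  note d = bounded_Lipschitz_add[OF bounded_Lipschitz_const[of 1] bounded_Lipschitz_mult[OF bounded_Lipschitz_const[of "-1"]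
      bounded_Lipschitz_mult[OF bounded_Lipschitz_clamp bounded_Lipschitz_clamp]]]
  have "step = (\<lambda>y. (1 + (-1) * (?c y * ?c y)) * (1 + (-1) * (?c y * ?c y)))"
    by (auto simp: step_def power2_eq_square)
  then show ?thesis
    using bounded_Lipschitz_mult[OF d d] by auto
qed

lemma bounded_Lipschitz_step': "\<exists>L. bounded_Lipschitz L step'"
proof -
  let ?c = "\<lambda>y::real. max 0 (min 1 y)"
  note d = bounded_Lipschitz_add[OF bounded_Lipschitz_const[of 1] bounded_Lipschitz_mult[OF bounded_Lipschitz_const[of "-1"]
      bounded_Lipschitz_mult[OF bounded_Lipschitz_clamp bounded_Lipschitz_clamp]]]
  have "step' = (\<lambda>y. (- 4) * ?c y * (1 + (-1) * (?c y * ?c y)))"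
    by (auto simp: step'_def power2_eq_square)
  then show ?thesis
    using bounded_Lipschitz_mult[OF bounded_Lipschitz_mult[OF bounded_Lipschitz_const[of "-4"] bounded_Lipschitz_clamp] d] by auto
qed

lemma step_bounds: "0 \<le> step y" "step y \<le> 1" "step' y \<le> 0" "\<bar>step' y\<bar> \<le> 4"
proof -
  define c where "c = max 0 (min 1 y)"
  have c: "0 \<le> c" "c \<le> 1" by (auto simp: c_def)
  have c2: "0 \<le> c\<^sup>2" "c\<^sup>2 \<le> 1" using c power_mono[of c 1 2] by auto
  have e: "step y = (1 - c\<^sup>2)\<^sup>2" "step' y = - (4 * (c * (1 - c\<^sup>2)))" by (simp_all add: step_def step'_def c_def)
  have "c * (1 - c\<^sup>2) \<le> 1 * 1" using c c2 by (intro mult_mono) auto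
  moreover have "0 \<le> c * (1 - c\<^sup>2)" using c c2 by simp
  moreover have "(1 - c\<^sup>2)\<^sup>2 \<le> 1\<^sup>2" using c2 by (intro power_mono) auto
  ultimately show "0 \<le> step y" "step y \<le> 1" "step' y \<le> 0" "\<bar>step' y\<bar> \<le> 4" unfolding e by auto
qed

lemma step_simps [simp]: "y \<le> 0 \<Longrightarrow> step y = 1" "1 \<le> y \<Longrightarrow> step y = 0" "y \<le> 0 \<Longrightarrow> step' y = 0" "1 \<le> y \<Longrightarrow> step' y = 0"
  by (auto simp: step_def step'_def)

text \<open>One of the two factors is always 1, so this is \<open>step \<bar>y\<bar>\<close>; the
  product form avoids differentiating the absolute value at 0.\<close>

definition bump :: "real \<Rightarrow> real" where
  "bump y = step y * step (- y)"

definition bump' :: "real \<Rightarrow> real" where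
  "bump' y = step' y * step (- y) - step y * step' (- y)"

lemma has_real_derivative_bump: "(bump has_real_derivative bump' y) (at y)"
proof -
  have "((\<lambda>y. step (- y)) has_real_derivative step' (- y) * (- 1)) (at y)"
    by (rule DERIV_chain2[OF has_real_derivative_step]) (auto intro!: derivative_eq_intros)
  from DERIV_mult[OF has_real_derivative_step this] show ?thesis
    by (simp add: bump_def[abs_def] bump'_def mult.commute)
qed

lemma bump_bounds: "0 \<le> bump y" "bump y \<le> 1" "\<bar>bump' y\<bar> \<le> 8"
proof -
  have m: "\<bar>a * b\<bar> \<le> 4" if "\<bar>a\<bar> \<le> 4" "\<bar>b\<bar> \<le> 1" for a b :: real
    using mult_mono[OF that] by (simp add: abs_mult)
  show "0 \<le> bump y" "bump y \<le> 1" using step_bounds(1,2) mult_mono[of "step y" 1 "step (-y)" 1]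
    by (auto simp: bump_def)
  have "\<bar>step' y * step (- y)\<bar> \<le> 4" "\<bar>step' (- y) * step y\<bar> \<le> 4"
    using step_bounds by (auto intro!: m simp: abs_of_nonneg)
  then show "\<bar>bump' y\<bar> \<le> 8" unfolding bump'_def by (simp add: mult.commute)
qed

lemma bump_nonneg_arg: "0 \<le> y \<Longrightarrow> bump y = step y" "0 \<le> y \<Longrightarrow> bump' y = step' y"
  by (auto simp: bump_def bump'_def)

lemma bump_zero: "1 \<le> \<bar>y\<bar> \<Longrightarrow> bump y = 0" "1 \<le> \<bar>y\<bar> \<Longrightarrow> bump' y = 0"
  by (auto simp: bump_def bump'_def abs_if split: if_splits)

lemma bounded_Lipschitz_uminus_arg:
  fixes g :: "real \<Rightarrow> real"
  shows "bounded_Lipschitz L g \<Longrightarrow> bounded_Lipschitz L (\<lambda>y. g (- y))"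
  using bounded_Lipschitz_compose[of L g uminus 1] by (simp add: dist_real_def abs_minus_commute)

lemma bounded_Lipschitz_bump: "\<exists>L. bounded_Lipschitz L bump" "\<exists>L. bounded_Lipschitz L bump'"
proof -
  obtain L L' where L: "bounded_Lipschitz L step" "bounded_Lipschitz L' step'"
    using bounded_Lipschitz_step bounded_Lipschitz_step' by blast
  note R = L(1)[THEN bounded_Lipschitz_uminus_arg] L(2)[THEN bounded_Lipschitz_uminus_arg]
  show "\<exists>L. bounded_Lipschitz L bump"
    using bounded_Lipschitz_mult[OF L(1) R(1)] by (auto simp: bump_def[abs_def])
  have "bump' = (\<lambda>y. step' y * step (- y) + (- 1) * (step y * step' (- y)))"
    by (auto simp: bump'_def)
  then show "\<exists>L. bounded_Lipschitz L bump'"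
    using bounded_Lipschitz_add[OF bounded_Lipschitz_mult[OF L(2) R(1)]
        bounded_Lipschitz_mult[OF bounded_Lipschitz_const bounded_Lipschitz_mult[OF L(1) R(2)], of "-1"]] by auto
qed

lemma bump_measurable [measurable]: "bump \<in> borel_measurable borel" "bump' \<in> borel_measurable borel"
  "step \<in> borel_measurable borel" "step' \<in> borel_measurable borel"
  using bounded_Lipschitz_bump bounded_Lipschitz_step bounded_Lipschitz_step'
  by (blast intro: borel_measurable_continuous_onI bounded_Lipschitz_continuous)+

definition bump_mass :: real where
  "bump_mass = (LBINT y. bump y)"

lemma integrable_bump: "integrable lborel bump"
  by (rule integrable_bounded_support[where C = 1 and R = 1])
    (auto simp: bump_bounds bump_zero abs_of_nonneg)

lemma bump_mass_pos: "0 < bump_mass"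
proof -
  \<comment> \<open>9/16 is the value of the bump at 1/2, its minimum on [-1/2, 1/2].\<close>
  have "(LBINT y. (9 / 16) * indicator {-1/2..1/2::real} y) \<le> bump_mass"
    unfolding bump_mass_def
  proof (rule Bochner_Integration.integral_mono[OF _ integrable_bump])
    show "integrable lborel (\<lambda>y. (9 / 16) * indicator {- 1 / 2..1 / 2::real} y :: real)"
      by (intro integrable_mult_right integrable_real_indicator) auto
    fix y :: real
    have "9 / 16 \<le> step z" if "z \<le> 1 / 2" for z
    proof -
      have "(max 0 (min 1 z))\<^sup>2 \<le> (1 / 2)\<^sup>2" using that by (intro power_mono) auto
      then have "3 / 4 \<le> 1 - (max 0 (min 1 z))\<^sup>2" by (simp add: power2_eq_square)
      from power_mono[OF this, of 2] show ?thesis by (simp add: step_def power2_eq_square)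
    qed
    then have "9 / 16 \<le> bump y" if "\<bar>y\<bar> \<le> 1 / 2"
      using that by (cases "0 \<le> y") (auto simp: bump_def)
    then show "(9 / 16) * indicator {- 1 / 2..1 / 2} y \<le> bump y"
      using bump_bounds(1)[of y] by (auto simp: indicator_def)
  qed
  then show ?thesis by simp
qed

section \<open>Doubling of variables\<close>

text \<open>The bound is hidden behind an existential quantifier, so that the rules
  \<open>bdd\<close> can decompose a long integrand along its syntax without computing a
  constant.\<close>

definition bounded_fun :: "('a \<Rightarrow> real) \<Rightarrow> bool" where
  "bounded_fun g \<longleftrightarrow> (\<exists>C. \<forall>z. \<bar>g z\<bar> \<le> C)"

lemma bounded_funI: "(\<And>z. \<bar>g z\<bar> \<le> C) \<Longrightarrow> bounded_fun g"
  by (auto simp: bounded_fun_def)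

named_theorems bdd

lemma bounded_fun_intros [bdd]:
  "bounded_fun (\<lambda>z. c)"
  "bounded_fun (\<lambda>z. indicator S (l z))"
  "bounded_fun g1 \<Longrightarrow> bounded_fun (\<lambda>z. - g1 z)"
  "bounded_fun g1 \<Longrightarrow> bounded_fun (\<lambda>z. \<bar>g1 z\<bar>)"
  "bounded_fun g1 \<Longrightarrow> bounded_fun g2 \<Longrightarrow> bounded_fun (\<lambda>z. g1 z + g2 z)"
  "bounded_fun g1 \<Longrightarrow> bounded_fun g2 \<Longrightarrow> bounded_fun (\<lambda>z. g1 z - g2 z)"
  "bounded_fun g1 \<Longrightarrow> bounded_fun g2 \<Longrightarrow> bounded_fun (\<lambda>z. g1 z * g2 z)"
proof -
  show "bounded_fun (\<lambda>z. c)" "bounded_fun (\<lambda>z. indicator S (l z))"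
    "bounded_fun g1 \<Longrightarrow> bounded_fun (\<lambda>z. - g1 z)" "bounded_fun g1 \<Longrightarrow> bounded_fun (\<lambda>z. \<bar>g1 z\<bar>)"
    by (auto simp: bounded_fun_def indicator_def intro: exI[of _ 1])
next
  assume "bounded_fun g1" "bounded_fun g2"
  then obtain C1 C2 where C: "\<And>z. \<bar>g1 z\<bar> \<le> C1" "\<And>z. \<bar>g2 z\<bar> \<le> C2" by (auto simp: bounded_fun_def)
  have bound: "\<bar>g1 z + g2 z\<bar> \<le> C1 + C2" "\<bar>g1 z - g2 z\<bar> \<le> C1 + C2" for z
    using C(1)[of z] C(2)[of z] by linarith+
  show "bounded_fun (\<lambda>z. g1 z + g2 z)"
    by (rule bounded_funI[of _ "C1 + C2"]) (use C in \<open>simp add: bound\<close>)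
  show "bounded_fun (\<lambda>z. g1 z - g2 z)"
    by (rule bounded_funI[of _ "C1 + C2"]) (use C in \<open>simp add: bound\<close>)
  show "bounded_fun (\<lambda>z. g1 z * g2 z)"
    by (rule bounded_funI[of _ "C1 * C2"]) (use C mult_mono in \<open>fastforce simp: abs_mult\<close>)
qed

lemma bounded_fun_compose: "bounded_fun g \<Longrightarrow> bounded_fun (\<lambda>z. g (l z))"
  by (auto simp: bounded_fun_def)

lemma bounded_fun_bounded_Lipschitz: "bounded_Lipschitz L g \<Longrightarrow> bounded_fun g"
  by (auto simp: bounded_Lipschitz_def bounded_fun_def)

lemma integrable_bounded_fun_support:
  fixes g :: "'a::euclidean_space \<Rightarrow> real"
  assumes "g \<in> borel_measurable borel" "bounded_fun g" "\<And>z. norm z > R \<Longrightarrow> g z = 0"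
  shows "integrable lborel g"
  using assms integrable_bounded_support by (metis bounded_fun_def)

lemma fubini_bounded_fun_support:
  fixes g :: "'a::euclidean_space \<times> 'b::euclidean_space \<Rightarrow> real"
  assumes "g \<in> borel_measurable borel" "bounded_fun g" "\<And>z. norm z > R \<Longrightarrow> g z = 0"
  shows "(LBINT x. (LBINT y. g (x, y))) = (LBINT z. g z)"
    and "(LBINT y. (LBINT x. g (x, y))) = (LBINT z. g z)"
    and "integrable lborel (\<lambda>x. \<integral>y. g (x, y) \<partial>lborel)"
    and "integrable lborel (\<lambda>y. \<integral>x. g (x, y) \<partial>lborel)"
proof -
  obtain C where "\<And>z. \<bar>g z\<bar> \<le> C" using assms(2) by (auto simp: bounded_fun_def)
  from fubini_bounded_support[OF assms(1) this assms(3)]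
  show "(LBINT x. (LBINT y. g (x, y))) = (LBINT z. g z)"
    and "(LBINT y. (LBINT x. g (x, y))) = (LBINT z. g z)"
    and "integrable lborel (\<lambda>x. \<integral>y. g (x, y) \<partial>lborel)"
    and "integrable lborel (\<lambda>y. \<integral>x. g (x, y) \<partial>lborel)" by blast+
qed

lemma integral_mono_bounded_support:
  fixes g g' :: "'a::euclidean_space \<Rightarrow> real"
  assumes "g \<in> borel_measurable borel" "bounded_fun g" "\<And>z. norm z > R \<Longrightarrow> g z = 0"
    "g' \<in> borel_measurable borel" "bounded_fun g'" "\<And>z. norm z > R' \<Longrightarrow> g' z = 0"
    "\<And>z. g z \<le> g' z"
  shows "(LBINT z. g z) \<le> (LBINT z. g' z)"
  using assms by (intro Bochner_Integration.integral_mono integrable_bounded_fun_support) auto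

lemma borel_measurable_fst_snd [measurable]:
  "(\<lambda>z. fst z) \<in> borel_measurable (borel :: ('a::euclidean_space \<times> 'b::euclidean_space) measure)"
  "(\<lambda>z. snd z) \<in> borel_measurable (borel :: ('a::euclidean_space \<times> 'b::euclidean_space) measure)"
  by (intro borel_measurable_continuous_onI continuous_intros)+

abbreviation half :: "real \<times> real \<Rightarrow> real" where
  "half \<equiv> indicator half_plane"

lemma half_plane_measurable [measurable]: "half_plane \<in> sets borel"
proof -
  have "closed half_plane" unfolding half_plane_def by (intro closed_Times) auto
  then show ?thesis by (rule borel_closed)
qed

lemma half_cases: "half z = (if 0 \<le> snd z then 1 else 0)"
  by (cases z) (auto simp: half_plane_def indicator_def)

section \<open>Entropy functional and families of test functions\<close>

text \<open>The left-hand side of Kruzkov's inequality, isolated so that inequalities up to a defect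
  \<open>- e\<close> can be stated.\<close>

definition entropy_functional ::
  "(real \<Rightarrow> real) \<Rightarrow> (real \<Rightarrow> real) \<Rightarrow> (real \<times> real \<Rightarrow> real) \<Rightarrow> real \<Rightarrow> (real \<times> real \<Rightarrow> real) \<Rightarrow>
   (real \<times> real \<Rightarrow> real) \<Rightarrow> (real \<times> real \<Rightarrow> real) \<Rightarrow> real" where
  "entropy_functional f u0 v k \<phi> \<phi>x \<phi>t =
     (LINT z:half_plane|lborel. \<bar>v z - k\<bar> * \<phi>t z + sgn (v z - k) * (f (v z) - f k) * \<phi>x z)
     + (LINT x|lborel. \<bar>u0 x - k\<bar> * \<phi> (x, 0))"

text \<open>In the doubling of variables the test function in one variable depends on the other as a
  parameter, and the inequality is then integrated over that parameter; this calls for a defect that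
  is uniform over the whole family. A common modulus of continuity for the gradients, instead of a
  Lipschitz constant, lets a single \<open>test_function\<close> with merely continuous gradient
  form a tame family too.\<close>

definition tame_family ::
  "((real \<times> real \<Rightarrow> real) \<times> (real \<times> real \<Rightarrow> real) \<times> (real \<times> real \<Rightarrow> real)) set \<Rightarrow> bool" where
  "tame_family \<Phi> \<longleftrightarrow> (\<exists>R L.
     (\<forall>(\<phi>, \<phi>x, \<phi>t) \<in> \<Phi>. \<forall>z.
        0 \<le> \<phi> z \<and> \<bar>\<phi> z\<bar> \<le> L \<and> \<bar>\<phi>x z\<bar> \<le> L \<and> \<bar>\<phi>t z\<bar> \<le> L \<and>
        (\<phi> has_derivative (\<lambda>h. \<phi>x z * fst h + \<phi>t z * snd h)) (at z) \<and>
        (norm z > R \<longrightarrow> \<phi> z = 0 \<and> \<phi>x z = 0 \<and> \<phi>t z = 0))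
     \<and> (\<forall>d>0. \<exists>r>0. \<forall>(\<phi>, \<phi>x, \<phi>t) \<in> \<Phi>. \<forall>z z'. dist z z' < r \<longrightarrow>
          \<bar>\<phi>x z - \<phi>x z'\<bar> \<le> d \<and> \<bar>\<phi>t z - \<phi>t z'\<bar> \<le> d))"

lemma tame_familyI:
  assumes "\<And>\<phi> \<phi>x \<phi>t z. (\<phi>, \<phi>x, \<phi>t) \<in> \<Phi> \<Longrightarrow>
        0 \<le> \<phi> z \<and> \<bar>\<phi> z\<bar> \<le> L \<and>
        (\<phi> has_derivative (\<lambda>h. \<phi>x z * fst h + \<phi>t z * snd h)) (at z) \<and>
        (norm z > R \<longrightarrow> \<phi> z = 0 \<and> \<phi>x z = 0 \<and> \<phi>t z = 0)"
    and "\<And>\<phi> \<phi>x \<phi>t. (\<phi>, \<phi>x, \<phi>t) \<in> \<Phi> \<Longrightarrow> bounded_Lipschitz L \<phi>x \<and> bounded_Lipschitz L \<phi>t"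
  shows "tame_family \<Phi>"
  unfolding tame_family_def
proof (intro exI conjI)
  show "\<forall>(\<phi>, \<phi>x, \<phi>t) \<in> \<Phi>. \<forall>z.
        0 \<le> \<phi> z \<and> \<bar>\<phi> z\<bar> \<le> L \<and> \<bar>\<phi>x z\<bar> \<le> L \<and> \<bar>\<phi>t z\<bar> \<le> L \<and>
        (\<phi> has_derivative (\<lambda>h. \<phi>x z * fst h + \<phi>t z * snd h)) (at z) \<and>
        (norm z > R \<longrightarrow> \<phi> z = 0 \<and> \<phi>x z = 0 \<and> \<phi>t z = 0)"
    using assms(1) assms(2)[THEN conjunct1, THEN bounded_LipschitzD(1)] assms(2)[THEN conjunct2, THEN bounded_LipschitzD(1)]
    by blast
  show "\<forall>d>0. \<exists>r>0. \<forall>(\<phi>, \<phi>x, \<phi>t) \<in> \<Phi>. \<forall>z z'. dist z z' < r \<longrightarrow>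
          \<bar>\<phi>x z - \<phi>x z'\<bar> \<le> d \<and> \<bar>\<phi>t z - \<phi>t z'\<bar> \<le> d"
  proof safe
    fix d :: real assume "0 < d"
    show "\<exists>r>0. \<forall>(\<phi>, \<phi>x, \<phi>t) \<in> \<Phi>. \<forall>z z'. dist z z' < r \<longrightarrow>
          \<bar>\<phi>x z - \<phi>x z'\<bar> \<le> d \<and> \<bar>\<phi>t z - \<phi>t z'\<bar> \<le> d"
    proof (intro exI[of _ "d / (\<bar>L\<bar> + 1)"] conjI, safe)
      show "0 < d / (\<bar>L\<bar> + 1)" using \<open>0 < d\<close> by simp
      fix \<phi> \<phi>x \<phi>t and a b a' b' :: real
      assume \<Phi>: "(\<phi>, \<phi>x, \<phi>t) \<in> \<Phi>" and D: "dist (a, b) (a', b') < d / (\<bar>L\<bar> + 1)"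
      have "L * dist (a, b) (a', b') \<le> (\<bar>L\<bar> + 1) * (d / (\<bar>L\<bar> + 1))"
        using D by (intro mult_mono) auto
      also have "\<dots> = d" by (simp add: field_simps)
      finally have *: "L * dist (a, b) (a', b') \<le> d" .
      show "\<bar>\<phi>x (a, b) - \<phi>x (a', b')\<bar> \<le> d" "\<bar>\<phi>t (a, b) - \<phi>t (a', b')\<bar> \<le> d"
        using assms(2)[OF \<Phi>] * by (metis bounded_LipschitzD(2) order_trans)+
    qed
  qed
qed

locale lipschitz_flux =
  fixes f :: "real \<Rightarrow> real" and \<alpha> :: real
  assumes flux_Lipschitz: "\<bar>f a - f b\<bar> \<le> \<alpha> * \<bar>a - b\<bar>"
    and alpha_pos: "0 < \<alpha>"
begin

lemma continuous_flux: "continuous_on UNIV f"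
proof -
  have "\<alpha>-lipschitz_on UNIV f"
    using flux_Lipschitz alpha_pos by (auto simp: lipschitz_on_def dist_real_def)
  then show ?thesis by (rule lipschitz_on_continuous_on)
qed

lemma flux_measurable [measurable]: "f \<in> borel_measurable borel"
  by (rule borel_measurable_continuous_onI[OF continuous_flux])

definition kruzkov :: "real \<Rightarrow> real \<Rightarrow> real" where
  "kruzkov a b = sgn (a - b) * (f a - f b)"

lemma kruzkov_bound: "\<bar>kruzkov a b\<bar> \<le> \<alpha> * \<bar>a - b\<bar>"
  using flux_Lipschitz[of a b] by (auto simp: kruzkov_def sgn_if)

lemma kruzkov_commute: "kruzkov a b = kruzkov b a"
  by (auto simp: kruzkov_def sgn_if)

lemma kruzkov_measurable [measurable (raw)]:
  assumes [measurable]: "g \<in> borel_measurable N" "g' \<in> borel_measurable N"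
  shows "(\<lambda>z. kruzkov (g z) (g' z)) \<in> borel_measurable N"
  unfolding kruzkov_def by measurable

lemma bounded_fun_kruzkov [bdd]:
  assumes "bounded_fun g1" "bounded_fun g2"
  shows "bounded_fun (\<lambda>z. kruzkov (g1 z) (g2 z))"
proof -
  have "bounded_fun (\<lambda>z. \<alpha> * \<bar>g1 z - g2 z\<bar>)" by (intro bdd assms)
  then show ?thesis unfolding bounded_fun_def using kruzkov_bound by (meson abs_ge_self order_trans)
qed

lemma entropy_functional_alt:
  "entropy_functional f u0 v k \<phi> \<phi>x \<phi>t =
     (LBINT z. half z * (\<bar>v z - k\<bar> * \<phi>t z + kruzkov (v z) k * \<phi>x z))
     + (LBINT x. (\<bar>u0 x - k\<bar> * \<phi> (x, 0)))"
  by (simp add: entropy_functional_def set_lebesgue_integral_def kruzkov_def)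

text \<open>The inequality for \<open>v\<close> at level \<open>w z2\<close> is integrated over z2
  and added to the one for \<open>w\<close> at level \<open>v z1\<close>, weighted by
  \<open>\<psi> z1\<close> and integrated over z1. The derivatives of \<omega> enter with opposite
  signs and cancel, because the Kruzkov flux is symmetric in its two arguments. What remains carries
  only derivatives of \<psi>, and there the flux is bounded by \<alpha> times the difference of
  \<open>v\<close> and \<open>w\<close>.\<close>

lemma doubling_of_variables:
  fixes v w \<psi> \<psi>x \<psi>t \<omega> \<omega>x \<omega>t :: "real \<times> real \<Rightarrow> real" and u0 :: "real \<Rightarrow> real"
  assumes meas [measurable]: "v \<in> borel_measurable borel" "w \<in> borel_measurable borel" "u0 \<in> borel_measurable borel"
      "\<psi> \<in> borel_measurable borel" "\<psi>x \<in> borel_measurable borel" "\<psi>t \<in> borel_measurable borel"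
      "\<omega> \<in> borel_measurable borel" "\<omega>x \<in> borel_measurable borel" "\<omega>t \<in> borel_measurable borel"
    and bd: "bounded_fun v" "bounded_fun w" "bounded_fun u0" "bounded_fun \<psi>" "bounded_fun \<psi>x" "bounded_fun \<psi>t"
      "bounded_fun \<omega>" "bounded_fun \<omega>x" "bounded_fun \<omega>t"
    and \<psi>: "\<And>z. 0 \<le> \<psi> z" "\<And>z. \<psi> z \<le> 1" "\<And>z. norm z > R \<Longrightarrow> \<psi> z = 0 \<and> \<psi>x z = 0 \<and> \<psi>t z = 0"
    and \<omega>: "\<And>z. 0 \<le> \<omega> z" "\<And>z. norm z > 1 \<Longrightarrow> \<omega> z = 0 \<and> \<omega>x z = 0 \<and> \<omega>t z = 0"
      "\<And>z. snd z \<ge> 0 \<Longrightarrow> \<omega> z = 0"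
    and e: "0 \<le> e"
    and ev: "\<And>z2. - e \<le> entropy_functional f u0 v (w z2) (\<lambda>z1. \<psi> z1 * \<omega> (z1 - z2))
        (\<lambda>z1. \<psi>x z1 * \<omega> (z1 - z2) + \<psi> z1 * \<omega>x (z1 - z2))
        (\<lambda>z1. \<psi>t z1 * \<omega> (z1 - z2) + \<psi> z1 * \<omega>t (z1 - z2))"
    and ew: "\<And>z1. norm z1 \<le> R \<Longrightarrow> - e \<le> entropy_functional f u0 w (v z1) (\<lambda>z2. \<omega> (z1 - z2))
        (\<lambda>z2. - \<omega>x (z1 - z2)) (\<lambda>z2. - \<omega>t (z1 - z2))"
  shows "(LBINT z1. (LBINT z2. (half z1 * half z2 * \<bar>v z1 - w z2\<bar> * - (\<psi>t z1 + \<alpha> * \<bar>\<psi>x z1\<bar>) * \<omega> (z1 - z2))))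
     \<le> (LBINT z2. (LBINT x. (half z2 * \<bar>u0 x - w z2\<bar> * \<psi> (x, 0) * \<omega> ((x, 0) - z2))))
       + 2 * e * measure lborel (cball (0::real \<times> real) (R + 1))"
proof -
  define B :: "real \<times> real \<Rightarrow> real" where "B = indicator (cball 0 (R + 1))"
  define A where "A = measure lborel (cball (0::real \<times> real) (R + 1))"
  have B: "integrable lborel B" "(LBINT z. B z) = A"
    using emeasure_lborel_cball_finite[of "0::real\<times>real" "R+1"]
    by (auto simp: B_def A_def intro!: integrable_real_indicator)
  define G1 where "G1 = (\<lambda>(z1, z2). half z1 * half z2 *
     (\<bar>v z1 - w z2\<bar> * (\<psi>t z1 * \<omega> (z1 - z2) + \<psi> z1 * \<omega>t (z1 - z2))
       + kruzkov (v z1) (w z2) * (\<psi>x z1 * \<omega> (z1 - z2) + \<psi> z1 * \<omega>x (z1 - z2))))"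
  define G2 where "G2 = (\<lambda>(z1, z2). half z1 * half z2 * \<psi> z1 *
     (\<bar>w z2 - v z1\<bar> * - \<omega>t (z1 - z2) + kruzkov (w z2) (v z1) * - \<omega>x (z1 - z2)))"
  define G0 where "G0 = (\<lambda>(x, z2). half z2 * \<bar>u0 x - w z2\<bar> * \<psi> (x, 0) * \<omega> ((x, 0) - z2))"
  define G where "G = (\<lambda>(z1, z2). half z1 * half z2 * \<bar>v z1 - w z2\<bar> * - (\<psi>t z1 + \<alpha> * \<bar>\<psi>x z1\<bar>) * \<omega> (z1 - z2))"
  have m: "G1 \<in> borel_measurable borel" "G2 \<in> borel_measurable borel" "G \<in> borel_measurable borel"
    and m0: "G0 \<in> borel_measurable borel"
    unfolding G1_def G2_def G0_def G_def case_prod_beta by measurable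
  have b: "bounded_fun G1" "bounded_fun G2" "bounded_fun G0" "bounded_fun G"
    unfolding G1_def G2_def G0_def G_def case_prod_beta by (intro bdd bd[THEN bounded_fun_compose])+
  have far: "\<omega> (z1 - z2) = 0 \<and> \<omega>x (z1 - z2) = 0 \<and> \<omega>t (z1 - z2) = 0" if "norm z1 \<le> R" "norm z2 > R + 1" for z1 z2
    using \<omega>(2)[of "z1 - z2"] norm_triangle_ineq4[of z1 "z1 - z2"] that by auto
  have zero: "G1 (z1, z2) = 0 \<and> G2 (z1, z2) = 0 \<and> G (z1, z2) = 0" if "norm z2 > R + 1 \<or> norm z1 > R" for z1 z2
    using that far[of z1 z2] \<psi>(3)[of z1] by (cases "norm z1 > R") (auto simp: G1_def G2_def G_def)
  have zero0: "G0 (x, z2) = 0" if "norm z2 > R + 1 \<or> norm x > R" for x z2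
    using that far[of "(x, 0)" z2] \<psi>(3)[of "(x, 0)"] by (cases "norm x > R") (auto simp: G0_def norm_Pair)
  have s: "G1 z = 0" "G2 z = 0" "G z = 0" if "norm z > 2 * R + 1" for z
    using that zero[of "snd z" "fst z"] norm_Pair_le[of "fst z" "snd z"] by fastforce+
  have s0: "G0 z = 0" if "norm z > 2 * R + 1" for z
    using that zero0[of "snd z" "fst z"] norm_Pair_le[of "fst z" "snd z"] by fastforce
  note F1 = fubini_bounded_fun_support[OF m(1) b(1) s(1)]
  note F2 = fubini_bounded_fun_support[OF m(2) b(2) s(2)]
  note F = fubini_bounded_fun_support[OF m(3) b(4) s(3)]
  note F0 = fubini_bounded_fun_support[OF m0 b(3) s0]
  \<comment> \<open>Outside the ball of radius R + 1 the integrands vanish, so the defect is charged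
    only on that ball; this makes it integrable and produces the factor A.\<close>
  have "(LBINT z2. (- e * B z2)) \<le> (LBINT z2. ((LBINT z1. G1 (z1, z2)) + (LBINT x. G0 (x, z2))))"
  proof (rule Bochner_Integration.integral_mono)
    show "integrable lborel (\<lambda>z2. - e * B z2)" using B by simp
    show "integrable lborel (\<lambda>z2. (LBINT z1. G1 (z1, z2)) + (LBINT x. G0 (x, z2)))"
      using F1(4) F0(4) by simp
    fix z2 :: "real \<times> real"
    show "- e * B z2 \<le> (LBINT z1. G1 (z1, z2)) + (LBINT x. G0 (x, z2))"
    proof (cases "norm z2 > R + 1 \<or> half z2 = 0")
      case True
      have "G1 (z1, z2) = 0 \<and> G0 (x, z2) = 0" for z1 x
        using True
      proof
        assume "norm z2 > R + 1" then show ?thesis using zero zero0 by blast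
      qed (simp add: G1_def G0_def)
      moreover have "- e * B z2 \<le> 0" using e by (simp add: B_def)
      ultimately show ?thesis by simp
    next
      case False
      then have "B z2 = 1" "half z2 = 1" by (auto simp: B_def indicator_def)
      then show ?thesis using ev[of z2] by (simp add: entropy_functional_alt G1_def G0_def mult_ac)
    qed
  qed
  also have "\<dots> = (LBINT z. G1 z) + (LBINT z. G0 z)"
    by (rule trans[OF Bochner_Integration.integral_add[OF F1(4) F0(4)] arg_cong2[where f = "(+)", OF F1(2) F0(2)]])
  finally have I1: "- e * A \<le> (LBINT z. G1 z) + (LBINT z. G0 z)" using B by simp
  have "(LBINT z1. (- e * B z1)) \<le> (LBINT z1. (LBINT z2. G2 (z1, z2)))"
  proof (rule Bochner_Integration.integral_mono)
    show "integrable lborel (\<lambda>z1. - e * B z1)" using B by simp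
    show "integrable lborel (\<lambda>z1. (LBINT z2. G2 (z1, z2)))" by (rule F2(3))
    fix z1 :: "real \<times> real"
    show "- e * B z1 \<le> (LBINT z2. G2 (z1, z2))"
    proof (cases "norm z1 > R \<or> half z1 = 0")
      case True
      have "G2 (z1, z2) = 0" for z2
        using True
      proof
        assume "norm z1 > R" then show ?thesis using zero by blast
      qed (simp add: G2_def)
      moreover have "- e * B z1 \<le> 0" using e by (simp add: B_def)
      ultimately show ?thesis by simp
    next
      case False
      then have h: "half z1 = 1" and z1: "norm z1 \<le> R" and "B z1 = 1" by (auto simp: indicator_def B_def)
      \<comment> \<open>Relative to a point of the initial line, z1 has nonnegative time, where
        \<omega> vanishes: the initial term of \<open>w\<close> drops out.\<close>
      have "\<omega> (z1 - (x, 0)) = 0" for x using h \<omega>(3)[of "z1 - (x, 0)"] by (auto simp: half_cases split: if_splits)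
      then have "- e \<le> (LBINT z2. half z2 * (\<bar>w z2 - v z1\<bar> * - \<omega>t (z1 - z2) + kruzkov (w z2) (v z1) * - \<omega>x (z1 - z2)))"
        using ew[OF z1] by (simp add: entropy_functional_alt)
      \<comment> \<open>The cut-off depends on z1 alone, so for the inequality in z2 it is a
        nonnegative constant factor.\<close>
      then have "\<psi> z1 * - e \<le> \<psi> z1 * (LBINT z2. half z2 * (\<bar>w z2 - v z1\<bar> * - \<omega>t (z1 - z2) + kruzkov (w z2) (v z1) * - \<omega>x (z1 - z2)))"
        using \<psi>(1) by (rule mult_left_mono)
      also have "\<dots> = (LBINT z2. G2 (z1, z2))"
        unfolding integral_mult_right_zero[symmetric] by (simp add: G2_def h mult_ac)
      finally have "\<psi> z1 * - e \<le> (LBINT z2. G2 (z1, z2))" .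
      moreover have "\<psi> z1 * e \<le> 1 * e" using \<psi>(2) e by (rule mult_right_mono)
      ultimately show ?thesis using \<open>B z1 = 1\<close> by simp
    qed
  qed
  also have "\<dots> = (LBINT z. G2 z)" by (rule F2(1))
  finally have I2: "- e * A \<le> (LBINT z. G2 z)" using B by simp
  have "(LBINT z. G z) \<le> (LBINT z. (- G1 z - G2 z))"
  proof (rule integral_mono_bounded_support[OF m(3) b(4) s(3) _ _ , where R' = "2 * R + 1"])
    show "(\<lambda>z. - G1 z - G2 z) \<in> borel_measurable borel" using m by simp
    show "bounded_fun (\<lambda>z. - G1 z - G2 z)" by (intro bdd b)
    fix z
    show "norm z > 2 * R + 1 \<Longrightarrow> - G1 z - G2 z = 0" using s by simp
    obtain z1 z2 where z: "z = (z1, z2)" by (cases z)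
    have "- (kruzkov (v z1) (w z2) * \<psi>x z1) \<ge> - (\<alpha> * \<bar>v z1 - w z2\<bar> * \<bar>\<psi>x z1\<bar>)"
      using kruzkov_bound[of "v z1" "w z2"] abs_ge_self[of "kruzkov (v z1) (w z2) * \<psi>x z1"]
        mult_right_mono[OF kruzkov_bound[of "v z1" "w z2"], of "\<bar>\<psi>x z1\<bar>"] by (simp add: abs_mult)
    then have k: "\<bar>v z1 - w z2\<bar> * - (\<psi>t z1 + \<alpha> * \<bar>\<psi>x z1\<bar>) \<le> - (\<bar>v z1 - w z2\<bar> * \<psi>t z1 + kruzkov (v z1) (w z2) * \<psi>x z1)"
      by (simp add: algebra_simps)
    have "G z = half z1 * half z2 * \<omega> (z1 - z2) * (\<bar>v z1 - w z2\<bar> * - (\<psi>t z1 + \<alpha> * \<bar>\<psi>x z1\<bar>))"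
      by (simp add: G_def z)
    also have "\<dots> \<le> half z1 * half z2 * \<omega> (z1 - z2) * - (\<bar>v z1 - w z2\<bar> * \<psi>t z1 + kruzkov (v z1) (w z2) * \<psi>x z1)"
      using \<omega>(1) by (intro mult_left_mono[OF k]) auto
    also have "\<dots> = - G1 z - G2 z"
      unfolding z G1_def G2_def prod.case kruzkov_commute[of "w z2"] abs_minus_commute[of "w z2"]
      by (simp add: algebra_simps)
    finally show "G z \<le> - G1 z - G2 z" .
  qed (use s in auto)
  also have "\<dots> = - (LBINT z. G1 z) - (LBINT z. G2 z)"
    using integrable_bounded_fun_support[OF m(1) b(1) s(1)] integrable_bounded_fun_support[OF m(2) b(2) s(2)] by simp
  finally have "(LBINT z. G z) \<le> (LBINT z. G0 z) + 2 * e * A" using I1 I2 by simp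
  moreover have "(LBINT z. G z) = (LBINT z1. (LBINT z2. (half z1 * half z2 * \<bar>v z1 - w z2\<bar> * - (\<psi>t z1 + \<alpha> * \<bar>\<psi>x z1\<bar>) * \<omega> (z1 - z2))))"
    using F(1) unfolding G_def prod.case by (rule sym)
  moreover have "(LBINT z. G0 z) = (LBINT z2. (LBINT x. (half z2 * \<bar>u0 x - w z2\<bar> * \<psi> (x, 0) * \<omega> ((x, 0) - z2))))"
    using F0(2) unfolding G0_def prod.case by (rule sym)
  ultimately show ?thesis by (simp add: A_def)
qed

end

section \<open>Averaging kernels and the initial layer\<close>

text \<open>A measurable function is an almost everywhere limit of continuous ones. Truncating these
  to [-M, M] keeps the limit and supplies the dominating function.\<close>

lemma L1_approx_continuous:
  fixes u0 :: "real \<Rightarrow> real"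
  assumes [measurable]: "u0 \<in> borel_measurable borel" and M: "\<And>x. \<bar>u0 x\<bar> \<le> M" and "0 < e"
  shows "\<exists>g. continuous_on UNIV g \<and> (\<forall>x. \<bar>g x\<bar> \<le> M) \<and> (LBINT x. (indicator {-X..X} x * \<bar>u0 x - g x\<bar>)) \<le> e"
proof -
  have M0: "0 \<le> M" using M[of 0] by linarith
  have "u0 \<in> borel_measurable lebesgue" using assms(1) by (simp add: measurable_completion)
  then have "u0 measurable_on UNIV" by (intro lebesgue_measurable_imp_measurable_on) auto
  then obtain N g where N: "negligible N" and g: "\<And>n. continuous_on UNIV (g n)"
    and lim: "\<And>x. x \<notin> N \<Longrightarrow> (\<lambda>n. g n x) \<longlonglongrightarrow> u0 x"
    by (auto simp: measurable_on_def)
  define h where "h n x = max (- M) (min M (g n x))" for n x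
  have h: "continuous_on UNIV (h n)" for n
    unfolding h_def by (intro continuous_intros g)
  have [measurable]: "h n \<in> borel_measurable borel" for n by (rule borel_measurable_continuous_onI[OF h])
  have hM: "\<bar>h n x\<bar> \<le> M" for n x using M0 by (auto simp: h_def)
  have lim': "(\<lambda>n. h n x) \<longlonglongrightarrow> u0 x" if "x \<notin> N" for x
  proof -
    have "(\<lambda>n. h n x) \<longlonglongrightarrow> max (- M) (min M (u0 x))"
      unfolding h_def by (intro tendsto_intros lim that)
    then show ?thesis using M[of x] by (simp add: abs_le_iff)
  qed
  have "AE x in lebesgue. x \<notin> N" using N by (simp add: negligible_iff_null_sets AE_not_in)
  then have ae: "AE x in lborel. x \<notin> N" by (simp add: AE_completion_iff)
  have "(\<lambda>n. \<integral>x. indicator {-X..X} x * \<bar>u0 x - h n x\<bar> \<partial>lborel) \<longlonglongrightarrow> (\<integral>x. 0 \<partial>(lborel :: real measure))"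
  proof (rule integral_dominated_convergence[where w = "\<lambda>x. indicator {-X..X} x * (2 * M)"])
    show "integrable lborel (\<lambda>x. indicator {- X..X} x * (2 * M))"
      by (intro integrable_mult_left integrable_real_indicator) (auto simp: emeasure_lborel_Icc_eq)
    show "AE x in lborel. (\<lambda>n. indicator {- X..X} x * \<bar>u0 x - h n x\<bar>) \<longlonglongrightarrow> 0"
      using ae
    proof eventually_elim
      case (elim x)
      have "(\<lambda>n. indicator {- X..X} x * \<bar>u0 x - h n x\<bar>) \<longlonglongrightarrow> indicator {- X..X} x * \<bar>u0 x - u0 x\<bar>"
        by (intro tendsto_intros lim' elim)
      then show ?case by simp
    qed
    show "AE x in lborel. norm (indicator {- X..X} x * \<bar>u0 x - h n x\<bar>) \<le> indicator {- X..X} x * (2 * M)" for n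
    proof (rule AE_I2)
      fix x
      have "\<bar>u0 x - h n x\<bar> \<le> 2 * M" using M[of x] hM[of n x] by linarith
      then show "norm (indicator {- X..X} x * \<bar>u0 x - h n x\<bar>) \<le> indicator {- X..X} x * (2 * M)"
        by (auto simp: indicator_def)
    qed
  qed auto
  then have "(\<lambda>n. \<integral>x. indicator {-X..X} x * \<bar>u0 x - h n x\<bar> \<partial>lborel) \<longlonglongrightarrow> 0" by simp
  then have "\<forall>\<^sub>F n in sequentially. (LBINT x. (indicator {-X..X} x * \<bar>u0 x - h n x\<bar>)) < e"
    using \<open>0 < e\<close> by (rule order_tendstoD(2))
  then obtain n where "(LBINT x. (indicator {-X..X} x * \<bar>u0 x - h n x\<bar>)) < e"
    by (auto simp: eventually_sequentially)
  then show ?thesis using h hM by (intro exI[of _ "h n"]) auto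
qed

text \<open>The kernels of interest are mollifiers and averaging over the cells of a grid.\<close>

lemma L1_kernel_approx:
  fixes u0 :: "real \<Rightarrow> real"
  assumes [measurable]: "u0 \<in> borel_measurable borel" and M: "\<And>x. \<bar>u0 x\<bar> \<le> M" and "0 < e" "0 \<le> X"
  shows "\<exists>r>0. \<forall>K. K \<in> borel_measurable borel \<and> bounded_fun K \<and> (\<forall>z. 0 \<le> K z) \<and>
      (\<forall>x y. r < \<bar>x - y\<bar> \<longrightarrow> K (x, y) = 0) \<and> (\<forall>x. (LBINT y. K (x, y)) \<le> 1) \<and> (\<forall>y. (LBINT x. K (x, y)) \<le> 1)
      \<longrightarrow> (LBINT x. indicator {-X..X} x * (LBINT y. (\<bar>u0 y - u0 x\<bar> * K (x, y)))) \<le> e"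
proof -
  have M0: "0 \<le> M" using M[of 0] by linarith
  \<comment> \<open>Of the error e, a quarter each goes to the difference of u0 and g at y and at x,
    and one half to the oscillation of g. The interval is enlarged by 1 because a kernel of width r
    \<le> 1 can reach that far.\<close>
  obtain g where g: "continuous_on UNIV g" "\<And>x. \<bar>g x\<bar> \<le> M"
    and gi: "(LBINT x. (indicator {-(X+1)..X+1} x * \<bar>u0 x - g x\<bar>)) \<le> e / 4"
    using L1_approx_continuous[OF assms(1) M, of "e / 4" "X + 1"] \<open>0 < e\<close> by auto
  have [measurable]: "g \<in> borel_measurable borel" by (rule borel_measurable_continuous_onI[OF g(1)])
  define \<eta> where "\<eta> = e / (4 * (X + 1))"
  have \<eta>: "0 < \<eta>" "2 * X * \<eta> \<le> e / 2" using \<open>0 < e\<close> \<open>0 \<le> X\<close> by (auto simp: \<eta>_def field_simps)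
  have "uniformly_continuous_on {-(X+1)..X+1} g"
    by (intro compact_uniformly_continuous continuous_on_subset[OF g(1)]) auto
  then obtain r0 where r0: "0 < r0" "\<And>x y. x \<in> {-(X+1)..X+1} \<Longrightarrow> y \<in> {-(X+1)..X+1} \<Longrightarrow> dist y x < r0 \<Longrightarrow> dist (g y) (g x) < \<eta>"
    using \<eta>(1) unfolding uniformly_continuous_on_def by metis
  define r where "r = min 1 (r0 / 2)"
  define D where "D x = indicator {-(X+1)..X+1} x * \<bar>u0 x - g x\<bar>" for x
  have [measurable]: "D \<in> borel_measurable borel" unfolding D_def by measurable
  have D0: "0 \<le> D x" for x by (simp add: D_def)
  have "bounded_fun u0" "bounded_fun g" using M g(2) by (auto intro: bounded_funI)
  note b = this[THEN bounded_fun_compose]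
  have bD: "bounded_fun D" unfolding D_def by (intro bdd b)
  have Ds: "D x = 0" if "norm x > X + 1" for x using that by (auto simp: D_def indicator_def)
  have D: "integrable lborel D" by (rule integrable_bounded_fun_support[OF _ bD Ds]) simp
  have Di: "(LBINT x. D x) \<le> e / 4" using gi by (simp add: D_def[abs_def])
  show ?thesis
  proof (rule exI[of _ r], intro conjI allI impI)
    show "0 < r" using r0 by (simp add: r_def)
    fix K :: "real \<times> real \<Rightarrow> real"
    assume "K \<in> borel_measurable borel \<and> bounded_fun K \<and> (\<forall>z. 0 \<le> K z) \<and>
      (\<forall>x y. r < \<bar>x - y\<bar> \<longrightarrow> K (x, y) = 0) \<and> (\<forall>x. (LBINT y. K (x, y)) \<le> 1) \<and> (\<forall>y. (LBINT x. K (x, y)) \<le> 1)"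
    then have [measurable]: "K \<in> borel_measurable borel" and bK: "bounded_fun K" and K0: "\<And>z. 0 \<le> K z"
      and Kr: "\<And>x y. r < \<bar>x - y\<bar> \<Longrightarrow> K (x, y) = 0"
      and Ky: "\<And>x. (LBINT y. K (x, y)) \<le> 1" and Kx: "\<And>y. (LBINT x. K (x, y)) \<le> 1"
      by auto
    have r1: "r \<le> 1" "r < r0" using r0(1) by (auto simp: r_def)
    define I where "I = (indicator {-X..X} :: real \<Rightarrow> real)"
    define P where "P = (\<lambda>z. I (fst z) * \<bar>u0 (snd z) - u0 (fst z)\<bar> * K z)"
    \<comment> \<open>Q1 carries the approximation error at y, Q2 the one at x and the oscillation
      of g. Q1 is integrated first in x and Q2 first in y, so each of the two marginal bounds on the
      kernel is used once.\<close>
    define Q1 where "Q1 = (\<lambda>z. D (snd z) * (I (fst z) * K z))"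
    define Q2 where "Q2 = (\<lambda>z. (I (fst z) * (\<eta> + D (fst z))) * K z)"
    have [measurable]: "I \<in> borel_measurable borel" by (simp add: I_def)
    have m: "P \<in> borel_measurable borel" "Q1 \<in> borel_measurable borel" "Q2 \<in> borel_measurable borel"
      unfolding P_def Q1_def Q2_def by measurable
    have bdd': "bounded_fun P" "bounded_fun Q1" "bounded_fun Q2"
      unfolding P_def Q1_def Q2_def I_def
      by (intro bdd b bK[THEN bounded_fun_compose, of "\<lambda>z. z"] bD[THEN bounded_fun_compose])+
    have s: "P z = 0" "Q1 z = 0" "Q2 z = 0" if "norm z > 2 * X + 1" for z
    proof -
      obtain x y where z: "z = (x, y)" by (cases z)
      have "\<bar>x\<bar> + \<bar>y\<bar> > 2 * X + 1" using that norm_Pair_le[of x y] by (simp add: z)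
      then have "\<bar>x\<bar> > X \<or> \<bar>x - y\<bar> > r" using r1 by linarith
      then have "I x = 0 \<or> K z = 0" using Kr by (auto simp: I_def z indicator_def)
      then show "P z = 0" "Q1 z = 0" "Q2 z = 0" by (auto simp: P_def Q1_def Q2_def z)
    qed
    note FP = fubini_bounded_fun_support[OF m(1) bdd'(1) s(1)]
    note F1 = fubini_bounded_fun_support[OF m(2) bdd'(2) s(2)]
    note F2 = fubini_bounded_fun_support[OF m(3) bdd'(3) s(3)]
    have "(LBINT x. I x * (LBINT y. (\<bar>u0 y - u0 x\<bar> * K (x, y)))) = (LBINT x. (LBINT y. P (x, y)))"
      by (simp add: P_def mult.assoc)
    also have "\<dots> = (LBINT z. P z)" by (rule FP(1))
    also have "\<dots> \<le> (LBINT z. (Q1 z + Q2 z))"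
    proof (rule integral_mono_bounded_support[OF m(1) bdd'(1) s(1), where R' = "2 * X + 1"])
      show "(\<lambda>z. Q1 z + Q2 z) \<in> borel_measurable borel" using m by simp
      show "bounded_fun (\<lambda>z. Q1 z + Q2 z)" by (intro bdd bdd')
      fix z :: "real \<times> real"
      obtain x y where z: "z = (x, y)" by (cases z)
      show "P z \<le> Q1 z + Q2 z"
      proof (cases "I x = 0 \<or> K z = 0")
        case False
        then have x: "\<bar>x\<bar> \<le> X" and xy: "\<bar>x - y\<bar> \<le> r" using Kr[of x y]
          by (auto simp: I_def z indicator_def not_le[symmetric] split: if_splits)
        have "x \<in> {-(X+1)..X+1}" "y \<in> {-(X+1)..X+1}" "dist y x < r0"
          using x xy r1 by (auto simp: dist_real_def)
        then have "\<bar>g y - g x\<bar> \<le> \<eta>" "D x = \<bar>u0 x - g x\<bar>" "D y = \<bar>u0 y - g y\<bar>"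
          using r0(2)[of x y] by (auto simp: dist_real_def D_def)
        then have "\<bar>u0 y - u0 x\<bar> \<le> D y + (\<eta> + D x)" by linarith
        then have "(I x * K z) * \<bar>u0 y - u0 x\<bar> \<le> (I x * K z) * (D y + (\<eta> + D x))"
          using K0 by (intro mult_left_mono) (auto simp: I_def)
        then show ?thesis unfolding P_def Q1_def Q2_def z by (simp add: algebra_simps)
      qed (auto simp: P_def Q1_def Q2_def z)
    qed (use s in auto)
    also have "\<dots> = (LBINT z. Q1 z) + (LBINT z. Q2 z)"
      using integrable_bounded_fun_support[OF m(2) bdd'(2) s(2)] integrable_bounded_fun_support[OF m(3) bdd'(3) s(3)]
      by (rule Bochner_Integration.integral_add)
    also have "(LBINT z. Q1 z) \<le> e / 4"
    proof -
      have "(LBINT z. Q1 z) = (LBINT y. (LBINT x. Q1 (x, y)))" by (rule F1(2)[symmetric])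
      also have "\<dots> \<le> (LBINT y. D y)"
      proof (rule Bochner_Integration.integral_mono[OF F1(4) D])
        fix y
        have "(LBINT x. I x * K (x, y)) \<le> (LBINT x. K (x, y))"
        proof (rule integral_mono_bounded_support[where R = X and R' = "\<bar>y\<bar> + 1"])
          show "bounded_fun (\<lambda>x. I x * K (x, y))" "bounded_fun (\<lambda>x. K (x, y))"
            unfolding I_def by (intro bdd bK[THEN bounded_fun_compose])+
          show "K (x, y) = 0" if "\<bar>y\<bar> + 1 < norm x" for x
            using that r1 by (intro Kr) auto
        qed (use K0 in \<open>auto simp: I_def indicator_def\<close>)
        then have "(LBINT x. I x * K (x, y)) \<le> 1" using Kx[of y] by linarith
        from mult_left_mono[OF this D0] show "(LBINT x. Q1 (x, y)) \<le> D y" by (simp add: Q1_def)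
      qed
      finally show ?thesis using Di by linarith
    qed
    also have "(LBINT z. Q2 z) \<le> e / 2 + e / 4"
    proof -
      have i: "integrable lborel (\<lambda>x. \<eta> * I x)" unfolding I_def
        by (intro integrable_mult_right integrable_real_indicator) (auto simp: emeasure_lborel_Icc_eq)
      have "(LBINT z. Q2 z) = (LBINT x. (LBINT y. Q2 (x, y)))" by (rule F2(1)[symmetric])
      also have "\<dots> \<le> (LBINT x. (\<eta> * I x + D x))"
      proof (rule Bochner_Integration.integral_mono[OF F2(3)])
        show "integrable lborel (\<lambda>x. \<eta> * I x + D x)" using i D by simp
        fix x
        have "I x * (\<eta> + D x) * (LBINT y. K (x, y)) \<le> I x * (\<eta> + D x) * 1"
          using \<eta> D0[of x] by (intro mult_left_mono[OF Ky]) (auto simp: I_def)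
        also have "\<dots> \<le> \<eta> * I x + D x" using D0[of x] by (auto simp: I_def indicator_def)
        finally show "(LBINT y. Q2 (x, y)) \<le> \<eta> * I x + D x" by (simp add: Q2_def)
      qed
      also have "\<dots> = \<eta> * (2 * X) + (LBINT x. D x)"
        using i D \<open>0 \<le> X\<close> by (simp add: I_def)
      finally show ?thesis using Di \<eta>(2) by (simp add: mult_ac)
    qed
    finally show "(LBINT x. indicator {-X..X} x * (LBINT y. (\<bar>u0 y - u0 x\<bar> * K (x, y)))) \<le> e"
      by (simp add: I_def)
  qed
qed

context lipschitz_flux
begin

text \<open>At level \<open>u0 x\<close>, the test function a (x - y) \<theta> t yields three terms.
  The one with \<theta>' is minus a weighted mass of the distance between w and \<open>u0 x\<close>
  in the layer 0 \<le> t \<le> s, and this mass dominates the one with weight b. The flux term lives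
  on a box of area 2 s. The initial term is an oscillation of u0 at the space scale of a. Thus w is
  compared with u0 near t = 0 without any trace of w on the initial line.\<close>

lemma initial_layer:
  fixes w \<psi> :: "real \<times> real \<Rightarrow> real" and u0 a a' b \<theta> \<theta>' :: "real \<Rightarrow> real"
  assumes meas [measurable]: "w \<in> borel_measurable borel" "u0 \<in> borel_measurable borel" "\<psi> \<in> borel_measurable borel"
      "a \<in> borel_measurable borel" "a' \<in> borel_measurable borel" "b \<in> borel_measurable borel"
      "\<theta> \<in> borel_measurable borel" "\<theta>' \<in> borel_measurable borel"
    and M: "\<And>z. \<bar>w z\<bar> \<le> M" "\<And>x. \<bar>u0 x\<bar> \<le> M"
    and bd: "bounded_fun a" "bounded_fun b" "bounded_fun \<theta>'"
    and a: "\<And>x. 0 \<le> a x" "\<And>x. \<bar>x\<bar> > 1 \<Longrightarrow> a x = 0" "\<And>x. \<bar>a' x\<bar> \<le> A'" "\<And>x. \<bar>x\<bar> > 1 \<Longrightarrow> a' x = 0"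
    and \<theta>: "\<And>t. 0 \<le> \<theta> t" "\<And>t. \<theta> t \<le> 1" "\<And>t. 0 \<le> t \<Longrightarrow> \<theta>' t \<le> 0" "\<And>t. s < t \<Longrightarrow> \<theta> t = 0 \<and> \<theta>' t = 0"
    and b: "\<And>t. 0 \<le> t \<Longrightarrow> b (- t) \<le> C * - \<theta>' t" "\<And>t. 0 \<le> b t" "0 \<le> C"
    and \<psi>: "\<And>z. 0 \<le> \<psi> z" "\<And>z. \<psi> z \<le> 1" "\<And>z. norm z > X \<Longrightarrow> \<psi> z = 0"
    and pos: "0 < s" "0 \<le> e" "0 \<le> X"
    and ew: "\<And>x. \<bar>x\<bar> \<le> X \<Longrightarrow> - e \<le> entropy_functional f u0 w (u0 x) (\<lambda>z. a (x - fst z) * \<theta> (snd z))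
        (\<lambda>z. - a' (x - fst z) * \<theta> (snd z)) (\<lambda>z. a (x - fst z) * \<theta>' (snd z))"
  shows "(LBINT z2. (LBINT x. (half z2 * \<bar>u0 x - w z2\<bar> * \<psi> (x, 0) * (a (x - fst z2) * b (- snd z2)))))
     \<le> C * (2 * X * (e + \<alpha> * (2 * M) * A' * (2 * s))
        + (LBINT x. indicator {-X..X} x * (LBINT y. (\<bar>u0 y - u0 x\<bar> * a (x - y)))))"
proof -
  have bu: "bounded_fun w" "bounded_fun u0" "bounded_fun \<psi>"  "bounded_fun \<theta>" "bounded_fun a'"
    using M \<psi>(1,2) \<theta>(1,2) a(3) by (auto intro: bounded_funI[of _ M] bounded_funI[of _ 1] bounded_funI[of _ A'])
  note bdds = bdd bu[THEN bounded_fun_compose] bd[THEN bounded_fun_compose]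
  have M0: "0 \<le> M" and A0: "0 \<le> A'" using M(2)[of 0] a(3)[of 0] by linarith+
  define I where "I = (indicator {-X..X} :: real \<Rightarrow> real)"
  have [measurable]: "I \<in> borel_measurable borel" by (simp add: I_def)
  define N where "N x = (LBINT y. (\<bar>u0 y - u0 x\<bar> * a (x - y)))" for x
  define P where "P = (\<lambda>p. half (snd p) * \<bar>u0 (fst p) - w (snd p)\<bar> * \<psi> (fst p, 0) * (a (fst p - fst (snd p)) * b (- snd (snd p))))"
  define Q where "Q = (\<lambda>p. I (fst p) * (\<bar>u0 (snd p) - u0 (fst p)\<bar> * a (fst p - snd p)))"
  have m: "P \<in> borel_measurable borel" "Q \<in> borel_measurable borel"
    unfolding P_def Q_def by measurable
  have bb: "bounded_fun P" "bounded_fun Q" unfolding P_def Q_def I_def by (intro bdds)+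
  have b0: "b (- t) = 0" if "s < t" for t using b(1)[of t] b(2)[of "-t"] \<theta>(4)[OF that] that pos by simp
  have sP: "P p = 0" if "norm p > 2 * X + 1 + s" for p
  proof -
    obtain x y t where p: "p = (x, (y, t))" by (cases p) auto
    have "\<bar>x\<bar> + (\<bar>y\<bar> + \<bar>t\<bar>) > 2 * X + 1 + s"
      using that norm_Pair_le[of x "(y, t)"] norm_Pair_le[of y t] by (simp add: p)
    then consider "\<bar>x\<bar> > X" | "\<bar>x - y\<bar> > 1" | "t < 0" | "s < t" by linarith
    then show ?thesis
      by cases (use a(2) b0 \<psi>(3)[of "(x, 0)"] in \<open>auto simp: P_def p half_cases norm_Pair\<close>)
  qed
  have sQ: "Q p = 0" if "norm p > 2 * X + 1" for p
  proof -
    obtain x y where p: "p = (x, y)" by (cases p)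
    have "\<bar>x\<bar> + \<bar>y\<bar> > 2 * X + 1" using that norm_Pair_le[of x y] by (simp add: p)
    then consider "\<bar>x\<bar> > X" | "\<bar>x - y\<bar> > 1" by linarith
    then show ?thesis by cases (use a(2) in \<open>auto simp: Q_def I_def p indicator_def\<close>)
  qed
  note FP = fubini_bounded_fun_support[OF m(1) bb(1) sP]
  note FQ = fubini_bounded_fun_support[OF m(2) bb(2) sQ]
  have Qx: "(LBINT y. Q (x, y)) = I x * N x" for x
    by (simp add: Q_def N_def)
  \<comment> \<open>Bound for the flux term: a height of at most \<alpha> (2 M) A' over a box of
    width 2 and duration s.\<close>
  define c where "c = \<alpha> * (2 * M) * A' * (2 * s)"
  have key: "(LBINT z. (half z * \<bar>u0 x - w z\<bar> * a (x - fst z) * - \<theta>' (snd z))) \<le> e + c + N x" if "\<bar>x\<bar> \<le> X" for x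
  proof -
    define T1 where "T1 = (\<lambda>z. half z * (\<bar>w z - u0 x\<bar> * (a (x - fst z) * \<theta>' (snd z))))"
    define T2 where "T2 = (\<lambda>z. half z * (kruzkov (w z) (u0 x) * (- a' (x - fst z) * \<theta> (snd z))))"
    have mT: "T1 \<in> borel_measurable borel" "T2 \<in> borel_measurable borel"
      unfolding T1_def T2_def by measurable
    have bT: "bounded_fun T1" "bounded_fun T2"
      unfolding T1_def T2_def using bu(1)[THEN bounded_fun_compose, of "\<lambda>z. z"] by (intro bdds)+
    have sT: "T1 z = 0 \<and> T2 z = 0" if "z \<notin> cbox (x - 1, 0) (x + 1, s)" for z
    proof -
      obtain y t where z: "z = (y, t)" by (cases z)
      have "\<not> (x - 1 \<le> y \<and> y \<le> x + 1 \<and> 0 \<le> t \<and> t \<le> s)" using that by (simp add: z cbox_Pair_eq)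
      then consider "\<bar>x - y\<bar> > 1" | "t < 0" | "s < t" by linarith
      then show ?thesis by cases (use a(2,4) \<theta>(4) in \<open>auto simp: T1_def T2_def z half_cases\<close>)
    qed
    have "bounded (cbox (x - 1, 0) (x + 1, s))" by simp
    then obtain R where R: "\<And>z. z \<in> cbox (x - 1, 0) (x + 1, s) \<Longrightarrow> norm z \<le> R" by (auto simp: bounded_iff)
    have sT': "T1 z = 0" "T2 z = 0" if "norm z > R" for z using sT[of z] R[of z] that by force+
    note iT = integrable_bounded_fun_support[OF mT(1) bT(1) sT'(1)] integrable_bounded_fun_support[OF mT(2) bT(2) sT'(2)]
    define J where "J = (LBINT y. (\<bar>u0 y - u0 x\<bar> * (a (x - y) * \<theta> 0)))"
    have "- e \<le> (LBINT z. (T1 z + T2 z)) + J"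
      using ew[OF that] unfolding entropy_functional_alt T1_def T2_def J_def by (simp add: algebra_simps)
    also have "(LBINT z. (T1 z + T2 z)) = (LBINT z. T1 z) + (LBINT z. T2 z)"
      using iT by simp
    also have "J = N x * \<theta> 0" unfolding J_def N_def by (simp add: mult.assoc[symmetric])
    also have "\<dots> \<le> N x * 1"
      using \<theta>(1,2)[of 0] a(1) by (intro mult_left_mono) (auto simp: N_def intro!: Bochner_Integration.integral_nonneg)
    also have "(LBINT z. T2 z) \<le> c"
    proof -
      have "(LBINT z. T2 z) \<le> (LBINT z. (\<alpha> * (2 * M) * A') * indicator (cbox (x - 1, 0) (x + 1, s)) z)"
      proof (rule Bochner_Integration.integral_mono[OF iT(2)])
        show "integrable lborel (\<lambda>z. (\<alpha> * (2 * M) * A') * indicator (cbox (x - 1, 0) (x + 1, s)) z)"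
          by (intro integrable_mult_right integrable_real_indicator) (use emeasure_lborel_cbox_finite[of "(x - 1, 0)" "(x + 1, s)"] in \<open>simp_all add: less_top\<close>)
        fix z :: "real \<times> real"
        show "T2 z \<le> (\<alpha> * (2 * M) * A') * indicator (cbox (x - 1, 0) (x + 1, s)) z"
        proof (cases "z \<in> cbox (x - 1, 0) (x + 1, s)")
          case True
          have "\<bar>kruzkov (w z) (u0 x)\<bar> \<le> \<alpha> * (2 * M)"
            using kruzkov_bound[of "w z" "u0 x"] M(1)[of z] M(2)[of x] alpha_pos
              mult_left_mono[of "\<bar>w z - u0 x\<bar>" "2 * M" \<alpha>] by linarith
          moreover have "\<bar>- a' (x - fst z) * \<theta> (snd z)\<bar> \<le> A' * 1"
            unfolding abs_mult using a(3) \<theta>(1,2) A0 by (intro mult_mono) auto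
          ultimately have "\<bar>kruzkov (w z) (u0 x)\<bar> * \<bar>- a' (x - fst z) * \<theta> (snd z)\<bar> \<le> (\<alpha> * (2 * M)) * (A' * 1)"
            using alpha_pos M0 by (intro mult_mono) auto
          then have "\<bar>T2 z\<bar> \<le> \<alpha> * (2 * M) * A'"
            unfolding T2_def abs_mult using alpha_pos M0 A0 by (auto simp: half_cases abs_mult)
          then show ?thesis using True by simp
        next
          case False
          then show ?thesis using sT by simp
        qed
      qed
      also have "\<dots> = c"
      proof -
        have "measure lborel (cbox (x - 1, 0) (x + 1, s)) = 2 * s"
          using pos by (simp add: content_Pair)
        then show ?thesis by (simp add: c_def)
      qed
      finally show ?thesis .
    qed
    finally have "- (LBINT z. T1 z) \<le> e + c + N x" by simp
    also have "- (LBINT z. T1 z) = (LBINT z. (half z * \<bar>u0 x - w z\<bar> * a (x - fst z) * - \<theta>' (snd z)))"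
      unfolding Bochner_Integration.integral_minus[symmetric] T1_def
      by (intro Bochner_Integration.integral_cong) (auto simp: abs_minus_commute)
    finally show ?thesis .
  qed
  have "(LBINT z2. (LBINT x. (half z2 * \<bar>u0 x - w z2\<bar> * \<psi> (x, 0) * (a (x - fst z2) * b (- snd z2)))))
    = (LBINT x. (LBINT z2. P (x, z2)))"
    using trans[OF FP(2) FP(1)[symmetric]] by (simp add: P_def)
  also have "\<dots> \<le> (LBINT x. C * ((e + c) * I x + I x * N x))"
  proof (rule Bochner_Integration.integral_mono[OF FP(3)])
    have "integrable lborel I" unfolding I_def by (intro integrable_real_indicator) (auto simp: emeasure_lborel_Icc_eq)
    then show "integrable lborel (\<lambda>x. C * ((e + c) * I x + I x * N x))"
      using FQ(3) unfolding Qx by (intro integrable_mult_right Bochner_Integration.integrable_add) auto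
    fix x
    show "(LBINT z2. P (x, z2)) \<le> C * ((e + c) * I x + I x * N x)"
    proof (cases "\<bar>x\<bar> \<le> X")
      case False
      then have "\<psi> (x, 0) = 0" using \<psi>(3)[of "(x, 0)"] by (simp add: norm_Pair)
      moreover have "I x = 0" using False by (auto simp: I_def indicator_def abs_le_iff)
      ultimately show ?thesis by (simp add: P_def)
    next
      case True
      then have I: "I x = 1" by (auto simp: I_def indicator_def abs_le_iff)
      have far: "a (x - fst z) = 0 \<or> half z = 0 \<or> (b (- snd z) = 0 \<and> \<theta>' (snd z) = 0)"
        if "norm z > \<bar>x\<bar> + 1 + s" for z :: "real \<times> real"
      proof -
        have "\<bar>fst z\<bar> + \<bar>snd z\<bar> > \<bar>x\<bar> + 1 + s" using that norm_Pair_le[of "fst z" "snd z"] by simp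
        then consider "\<bar>x - fst z\<bar> > 1" | "snd z < 0" | "s < snd z" by linarith
        then show ?thesis by cases (use a(2) b0 \<theta>(4) in \<open>auto simp: half_cases\<close>)
      qed
      have "(LBINT z2. P (x, z2)) \<le> (LBINT z. C * (half z * \<bar>u0 x - w z\<bar> * a (x - fst z) * - \<theta>' (snd z)))"
      proof (rule integral_mono_bounded_support[where R = "\<bar>x\<bar> + 1 + s" and R' = "\<bar>x\<bar> + 1 + s"])
        show "(\<lambda>z2. P (x, z2)) \<in> borel_measurable borel" unfolding P_def fst_conv snd_conv by measurable
        show "bounded_fun (\<lambda>z2. P (x, z2))" using bb(1) by (rule bounded_fun_compose)
        show "bounded_fun (\<lambda>z. C * (half z * \<bar>u0 x - w z\<bar> * a (x - fst z) * - \<theta>' (snd z)))"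
          using bu(1)[THEN bounded_fun_compose, of "\<lambda>z. z"] by (intro bdds)
        fix z :: "real \<times> real"
        show "P (x, z) = 0" "C * (half z * \<bar>u0 x - w z\<bar> * a (x - fst z) * - \<theta>' (snd z)) = 0" if "\<bar>x\<bar> + 1 + s < norm z"
          using far[OF that] by (auto simp: P_def)
        show "P (x, z) \<le> C * (half z * \<bar>u0 x - w z\<bar> * a (x - fst z) * - \<theta>' (snd z))"
        proof (cases "0 \<le> snd z")
          case True
          have "\<psi> (x, 0) * b (- snd z) \<le> 1 * (C * - \<theta>' (snd z))"
            using \<psi>(1,2) b(1)[OF True] b(2) by (intro mult_mono) auto
          then have "(half z * \<bar>u0 x - w z\<bar> * a (x - fst z)) * (\<psi> (x, 0) * b (- snd z)) \<le> (half z * \<bar>u0 x - w z\<bar> * a (x - fst z)) * (1 * (C * - \<theta>' (snd z)))"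
            using a(1) by (intro mult_left_mono) auto
          then show ?thesis by (simp add: P_def mult_ac)
        qed (simp add: P_def half_cases)
      qed measurable
      also have "\<dots> \<le> C * (e + c + N x)"
        unfolding integral_mult_right_zero using key[OF True] b(3) by (rule mult_left_mono)
      finally show ?thesis by (simp add: I)
    qed
  qed
  also have "\<dots> = C * ((e + c) * (2 * X) + (LBINT x. I x * N x))"
  proof -
    have "integrable lborel I" unfolding I_def by (intro integrable_real_indicator) (auto simp: emeasure_lborel_Icc_eq)
    moreover have "(LBINT x. I x) = 2 * X" using pos by (simp add: I_def)
    moreover have "integrable lborel (\<lambda>x. I x * N x)" using FQ(3) unfolding Qx .
    ultimately show ?thesis by simp
  qed
  finally show ?thesis by (simp add: c_def I_def N_def mult_ac)
qed

end

section \<open>Mollifiers and families of test functions\<close>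

text \<open>Lipschitz partial derivatives give all translates one common modulus, as tame families
  require. Compact support is left to the products: the one-variable profiles they are built from do
  not have it as functions on the plane.\<close>

definition C11 :: "(real \<times> real \<Rightarrow> real) \<Rightarrow> (real \<times> real \<Rightarrow> real) \<Rightarrow> (real \<times> real \<Rightarrow> real) \<Rightarrow> bool" where
  "C11 \<phi> \<phi>x \<phi>t \<longleftrightarrow>
     (\<exists>L. bounded_Lipschitz L \<phi>) \<and> (\<exists>L. bounded_Lipschitz L \<phi>x) \<and> (\<exists>L. bounded_Lipschitz L \<phi>t) \<and>
     (\<forall>z. (\<phi> has_derivative (\<lambda>h. \<phi>x z * fst h + \<phi>t z * snd h)) (at z))"

lemma ex_bounded_Lipschitz_intros:
  "\<exists>L. bounded_Lipschitz L g \<Longrightarrow> \<exists>L. bounded_Lipschitz L g' \<Longrightarrow> \<exists>L. bounded_Lipschitz L (\<lambda>z. g z * g' z)"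
  "\<exists>L. bounded_Lipschitz L g \<Longrightarrow> \<exists>L. bounded_Lipschitz L g' \<Longrightarrow> \<exists>L. bounded_Lipschitz L (\<lambda>z. g z + g' z)"
  "\<exists>L. bounded_Lipschitz L g \<Longrightarrow> \<exists>L. bounded_Lipschitz L (\<lambda>z. c * g z)"
  using bounded_Lipschitz_mult bounded_Lipschitz_add bounded_Lipschitz_cmult by blast+

text \<open>The kernels and the cone below are products of one-variable profiles evaluated at affine
  forms in (x, t); together with \<open>C11_mult\<close> this is how they are built.\<close>

lemma C11_affine:
  fixes g g' :: "real \<Rightarrow> real"
  assumes "\<exists>L. bounded_Lipschitz L g" "\<exists>L. bounded_Lipschitz L g'" "\<And>y. (g has_real_derivative g' y) (at y)"
  shows "C11 (\<lambda>z. g (p * fst z + q * snd z + r)) (\<lambda>z. p * g' (p * fst z + q * snd z + r))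
    (\<lambda>z. q * g' (p * fst z + q * snd z + r))"
proof -
  have d: "dist (p * fst z + q * snd z + r) (p * fst z' + q * snd z' + r) \<le> (\<bar>p\<bar> + \<bar>q\<bar> + 1) * dist z z'"
    for z z' :: "real \<times> real"
  proof -
    have "p * fst z + q * snd z + r - (p * fst z' + q * snd z' + r) = p * (fst z - fst z') + q * (snd z - snd z')"
      by (simp add: algebra_simps)
    then have "dist (p * fst z + q * snd z + r) (p * fst z' + q * snd z' + r) \<le> \<bar>p\<bar> * dist (fst z) (fst z') + \<bar>q\<bar> * dist (snd z) (snd z')"
      unfolding dist_real_def by (metis abs_mult abs_triangle_ineq)
    also have "\<dots> \<le> \<bar>p\<bar> * dist z z' + \<bar>q\<bar> * dist z z'"
      by (intro add_mono mult_left_mono dist_fst_le dist_snd_le) auto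
    also have "\<dots> \<le> (\<bar>p\<bar> + \<bar>q\<bar> + 1) * dist z z'" by (simp add: algebra_simps)
    finally show ?thesis .
  qed
  obtain L L' where L: "bounded_Lipschitz L g" "bounded_Lipschitz L' g'" using assms by blast
  have c: "bounded_Lipschitz (L * (\<bar>p\<bar> + \<bar>q\<bar> + 1)) (\<lambda>z. g (p * fst z + q * snd z + r))"
    "bounded_Lipschitz (L' * (\<bar>p\<bar> + \<bar>q\<bar> + 1)) (\<lambda>z. g' (p * fst z + q * snd z + r))"
    by (rule bounded_Lipschitz_compose[OF L(1) d], simp) (rule bounded_Lipschitz_compose[OF L(2) d], simp)
  have "((\<lambda>z. g (p * fst z + q * snd z + r)) has_derivative
      (\<lambda>h. p * g' (p * fst z + q * snd z + r) * fst h + q * g' (p * fst z + q * snd z + r) * snd h)) (at z)" for z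
  proof -
    have "((\<lambda>z. p * fst z + q * snd z + r) has_derivative (\<lambda>h. p * fst h + q * snd h)) (at z)"
      by (auto intro!: derivative_eq_intros)
    from DERIV_compose_FDERIV[OF assms(3) this] show ?thesis by (simp add: algebra_simps)
  qed
  then show ?thesis unfolding C11_def
    using c(1) bounded_Lipschitz_cmult[OF c(2), of p] bounded_Lipschitz_cmult[OF c(2), of q] by blast
qed

lemma C11_mult:
  assumes "C11 \<phi> \<phi>x \<phi>t" "C11 \<eta> \<eta>x \<eta>t"
  shows "C11 (\<lambda>z. \<phi> z * \<eta> z) (\<lambda>z. \<phi>x z * \<eta> z + \<phi> z * \<eta>x z) (\<lambda>z. \<phi>t z * \<eta> z + \<phi> z * \<eta>t z)"
proof -
  have "((\<lambda>z. \<phi> z * \<eta> z) has_derivative (\<lambda>h. (\<phi>x z * \<eta> z + \<phi> z * \<eta>x z) * fst h + (\<phi>t z * \<eta> z + \<phi> z * \<eta>t z) * snd h)) (at z)" for z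
  proof -
    have "(\<phi> has_derivative (\<lambda>h. \<phi>x z * fst h + \<phi>t z * snd h)) (at z)"
      "(\<eta> has_derivative (\<lambda>h. \<eta>x z * fst h + \<eta>t z * snd h)) (at z)"
      using assms unfolding C11_def by blast+
    from has_derivative_mult[OF this] show ?thesis
      by (rule has_derivative_eq_rhs) (auto simp: algebra_simps)
  qed
  then show ?thesis
    using assms unfolding C11_def by (intro conjI ex_bounded_Lipschitz_intros) blast+
qed

lemma C11_borel_measurable:
  assumes "C11 \<phi> \<phi>x \<phi>t"
  shows "\<phi> \<in> borel_measurable borel" "\<phi>x \<in> borel_measurable borel" "\<phi>t \<in> borel_measurable borel"
  using assms unfolding C11_def by (meson borel_measurable_continuous_onI bounded_Lipschitz_continuous)+

lemma C11_bounded_fun: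
  assumes "C11 \<phi> \<phi>x \<phi>t"
  shows "bounded_fun \<phi>" "bounded_fun \<phi>x" "bounded_fun \<phi>t"
  using assms unfolding C11_def by (meson bounded_fun_bounded_Lipschitz)+

lemma bounded_Lipschitz_translate:
  fixes g :: "'a::real_normed_vector \<Rightarrow> real"
  assumes "bounded_Lipschitz L g"
  shows "bounded_Lipschitz L (\<lambda>z. g (z - c))" "bounded_Lipschitz L (\<lambda>z. g (c - z))"
proof -
  have "dist (c - z) (c - z') = dist z z'" "dist (z - c) (z' - c) = dist z z'" for z z' :: 'a
    by (simp_all add: dist_norm norm_minus_commute)
  then show "bounded_Lipschitz L (\<lambda>z. g (z - c))" "bounded_Lipschitz L (\<lambda>z. g (c - z))"
    using bounded_Lipschitz_compose[OF assms, of "\<lambda>z. z - c" 1] bounded_Lipschitz_compose[OF assms, of "\<lambda>z. c - z" 1]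
    by simp_all
qed

text \<open>These are the test functions in the second variable of the doubling. Confining the
  centre c to a ball gives them a common support.\<close>

lemma tame_family_reflections:
  assumes "C11 \<eta> \<eta>x \<eta>t" and pos: "\<And>z. 0 \<le> \<eta> z"
    and supp: "\<And>z. norm z > r \<Longrightarrow> \<eta> z = 0 \<and> \<eta>x z = 0 \<and> \<eta>t z = 0"
  shows "tame_family {(\<lambda>z. \<eta> (c - z), \<lambda>z. - \<eta>x (c - z), \<lambda>z. - \<eta>t (c - z)) |c. norm c \<le> R}"
proof -
  obtain L0 L1 L2 where L: "bounded_Lipschitz L0 \<eta>" "bounded_Lipschitz L1 \<eta>x" "bounded_Lipschitz L2 \<eta>t"
    and d: "\<And>z. (\<eta> has_derivative (\<lambda>h. \<eta>x z * fst h + \<eta>t z * snd h)) (at z)"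
    using assms(1) unfolding C11_def by auto
  define K where "K = max L0 (max (2 * \<bar>-1\<bar> * L1) (2 * \<bar>-1\<bar> * L2))"
  show ?thesis
  proof (rule tame_familyI[where L = K and R = "R + r"], goal_cases)
    case (1 \<phi> \<phi>x \<phi>t z)
    then obtain c where c: "norm c \<le> R" "\<phi> = (\<lambda>z. \<eta> (c - z))" "\<phi>x = (\<lambda>z. - \<eta>x (c - z))" "\<phi>t = (\<lambda>z. - \<eta>t (c - z))"
      by auto
    have "((\<lambda>z. \<eta> (c - z)) has_derivative (\<lambda>h. \<eta>x (c - z) * fst (- h) + \<eta>t (c - z) * snd (- h))) (at z)"
      by (rule has_derivative_compose[OF _ d]) (auto intro!: derivative_eq_intros)
    moreover have "norm (c - z) > r" if "norm z > R + r"
      using that c(1) norm_triangle_ineq4[of c "c - z"] by auto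
    moreover have "\<bar>\<eta> (c - z)\<bar> \<le> K" using bounded_LipschitzD(1)[OF L(1), of "c - z"] by (simp add: K_def)
    ultimately show ?case using pos supp by (simp add: c)
  next
    case (2 \<phi> \<phi>x \<phi>t)
    then obtain c where c: "\<phi>x = (\<lambda>z. (-1) * \<eta>x (c - z))" "\<phi>t = (\<lambda>z. (-1) * \<eta>t (c - z))" by auto
    show ?case unfolding c
      using bounded_Lipschitz_cmult[OF bounded_Lipschitz_translate(2)[OF L(2)], of "-1" c]
        bounded_Lipschitz_cmult[OF bounded_Lipschitz_translate(2)[OF L(3)], of "-1" c]
      by (auto elim!: bounded_Lipschitz_mono simp: K_def)
  qed
qed

text \<open>These are the test functions in the first variable. The fixed factor \<psi> confines the
  supports, so c ranges over the whole plane.\<close>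

lemma tame_family_products:
  assumes "C11 \<psi> \<psi>x \<psi>t" "C11 \<eta> \<eta>x \<eta>t" and pos: "\<And>z. 0 \<le> \<psi> z" "\<And>z. 0 \<le> \<eta> z"
    and supp: "\<And>z. norm z > R \<Longrightarrow> \<psi> z = 0 \<and> \<psi>x z = 0 \<and> \<psi>t z = 0"
  shows "tame_family {(\<lambda>z. \<psi> z * \<eta> (z - c), \<lambda>z. \<psi>x z * \<eta> (z - c) + \<psi> z * \<eta>x (z - c), \<lambda>z. \<psi>t z * \<eta> (z - c) + \<psi> z * \<eta>t (z - c)) |c. True}"
proof -
  obtain L0 L1 L2 where L: "bounded_Lipschitz L0 \<eta>" "bounded_Lipschitz L1 \<eta>x" "bounded_Lipschitz L2 \<eta>t"
    and d: "\<And>z. (\<eta> has_derivative (\<lambda>h. \<eta>x z * fst h + \<eta>t z * snd h)) (at z)"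
    using assms(2) unfolding C11_def by auto
  obtain K0 K1 K2 where K: "bounded_Lipschitz K0 \<psi>" "bounded_Lipschitz K1 \<psi>x" "bounded_Lipschitz K2 \<psi>t"
    and d': "\<And>z. (\<psi> has_derivative (\<lambda>h. \<psi>x z * fst h + \<psi>t z * snd h)) (at z)"
    using assms(1) unfolding C11_def by auto
  define B where "B = max (2 * K0 * L0) (max (2 * K1 * L0 + 2 * K0 * L1) (2 * K2 * L0 + 2 * K0 * L2))"
  note b0 = bounded_Lipschitz_mult[OF K(1) bounded_Lipschitz_translate(1)[OF L(1)]]
  note b1 = bounded_Lipschitz_add[OF bounded_Lipschitz_mult[OF K(2) bounded_Lipschitz_translate(1)[OF L(1)]]
      bounded_Lipschitz_mult[OF K(1) bounded_Lipschitz_translate(1)[OF L(2)]]]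
  note b2 = bounded_Lipschitz_add[OF bounded_Lipschitz_mult[OF K(3) bounded_Lipschitz_translate(1)[OF L(1)]]
      bounded_Lipschitz_mult[OF K(1) bounded_Lipschitz_translate(1)[OF L(3)]]]
  show ?thesis
  proof (rule tame_familyI[where L = B and R = R], goal_cases)
    case (1 \<phi> \<phi>x \<phi>t z)
    then obtain c where c: "\<phi> = (\<lambda>z. \<psi> z * \<eta> (z - c))" "\<phi>x = (\<lambda>z. \<psi>x z * \<eta> (z - c) + \<psi> z * \<eta>x (z - c))"
      "\<phi>t = (\<lambda>z. \<psi>t z * \<eta> (z - c) + \<psi> z * \<eta>t (z - c))"
      by auto
    have e: "((\<lambda>z. \<eta> (z - c)) has_derivative (\<lambda>h. \<eta>x (z - c) * fst h + \<eta>t (z - c) * snd h)) (at z)"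
      by (rule has_derivative_compose[OF _ d]) (auto intro!: derivative_eq_intros)
    have "((\<lambda>z. \<psi> z * \<eta> (z - c)) has_derivative (\<lambda>h. (\<psi>x z * \<eta> (z - c) + \<psi> z * \<eta>x (z - c)) * fst h
        + (\<psi>t z * \<eta> (z - c) + \<psi> z * \<eta>t (z - c)) * snd h)) (at z)"
      by (rule has_derivative_eq_rhs[OF has_derivative_mult[OF d' e]]) (auto simp: algebra_simps)
    moreover have "\<bar>\<psi> z * \<eta> (z - c)\<bar> \<le> B" using bounded_LipschitzD(1)[OF b0[of c], of z] by (simp add: B_def)
    ultimately show ?case using pos supp by (simp add: c)
  next
    case (2 \<phi> \<phi>x \<phi>t)
    then obtain c where c: "\<phi>x = (\<lambda>z. \<psi>x z * \<eta> (z - c) + \<psi> z * \<eta>x (z - c))"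
      "\<phi>t = (\<lambda>z. \<psi>t z * \<eta> (z - c) + \<psi> z * \<eta>t (z - c))" by auto
    show ?case unfolding c using b1[of c c] b2[of c c] by (auto elim!: bounded_Lipschitz_mono simp: B_def)
  qed
qed

lemma lborel_integral_reflect:
  fixes g :: "real \<Rightarrow> real"
  shows "(LBINT y. g (x - y)) = (LBINT y. g y)"
  using lborel_integral_real_affine[of "-1" g x] by simp

lemma exists_space_mollifier:
  assumes "0 < \<epsilon>"
  shows "\<exists>a a'. (\<exists>L. bounded_Lipschitz L a) \<and> (\<exists>L. bounded_Lipschitz L a') \<and> (\<forall>y. (a has_real_derivative a' y) (at y))
    \<and> (\<forall>y. 0 \<le> a y) \<and> (\<forall>y. \<epsilon> < \<bar>y\<bar> \<longrightarrow> a y = 0 \<and> a' y = 0) \<and> (LBINT y. a y) = 1"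
proof -
  define k where "k = 1 / (bump_mass * \<epsilon>)"
  have k: "0 < k" using assms bump_mass_pos by (simp add: k_def)
  define a where "a y = k * bump (y / \<epsilon>)" for y
  define a' where "a' y = k / \<epsilon> * bump' (y / \<epsilon>)" for y
  have d: "dist (y / \<epsilon>) (y' / \<epsilon>) \<le> (1 / \<epsilon> + 1) * dist y y'" for y y'
  proof -
    have "dist (y / \<epsilon>) (y' / \<epsilon>) = 1 / \<epsilon> * dist y y'"
      using assms by (simp add: dist_real_def diff_divide_distrib[symmetric])
    then show ?thesis by (simp add: algebra_simps)
  qed
  have BL: "\<exists>L. bounded_Lipschitz L (\<lambda>y. c * g (y / \<epsilon>))" if g: "\<exists>L. bounded_Lipschitz L g" for g :: "real \<Rightarrow> real" and c
  proof -
    obtain L where "bounded_Lipschitz L g" using g by blast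
    then have "bounded_Lipschitz (L * (1 / \<epsilon> + 1)) (\<lambda>y. g (y / \<epsilon>))"
      by (rule bounded_Lipschitz_compose[OF _ d]) (use assms in simp)
    then show ?thesis by (intro ex_bounded_Lipschitz_intros) auto
  qed
  show ?thesis
  proof (rule exI[of _ a], rule exI[of _ a'], intro conjI allI impI)
    show "\<exists>L. bounded_Lipschitz L a" unfolding a_def by (rule BL[OF bounded_Lipschitz_bump(1)])
    show "\<exists>L. bounded_Lipschitz L a'" unfolding a'_def by (rule BL[OF bounded_Lipschitz_bump(2)])
    fix y
    have "((\<lambda>y. bump (y / \<epsilon>)) has_real_derivative bump' (y / \<epsilon>) * (1 / \<epsilon>)) (at y)"
      by (rule DERIV_chain2[OF has_real_derivative_bump]) (use assms in \<open>auto intro!: derivative_eq_intros\<close>)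
    then show "(a has_real_derivative a' y) (at y)"
      unfolding a_def a'_def by (auto intro!: derivative_eq_intros)
    show "0 \<le> a y" using k bump_bounds by (simp add: a_def)
    show "a y = 0" "a' y = 0" if "\<epsilon> < \<bar>y\<bar>"
    proof -
      have "1 \<le> \<bar>y / \<epsilon>\<bar>" using that assms by simp
      then show "a y = 0" "a' y = 0" by (simp_all add: a_def a'_def bump_zero)
    qed
    have "(LBINT y. a y) = \<epsilon> * (LBINT y. k * bump y)"
      using lborel_integral_real_affine[of \<epsilon> a 0] assms by (simp add: a_def)
    also have "\<dots> = 1" using assms bump_mass_pos by (simp add: k_def bump_mass_def[symmetric])
    finally show "(LBINT y. a y) = 1" .
  qed
qed

text \<open>The one-sided kernel \<open>b\<close> is dominated by \<open>- \<theta>'\<close>, with a factor independent of \<open>s\<close>: this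
  lets a test function with profile \<open>\<theta>\<close> control the initial layer seen by \<open>b\<close>.\<close>

lemma exists_time_mollifier:
  assumes "0 < s"
  shows "\<exists>b b' \<theta> \<theta>'. (\<exists>L. bounded_Lipschitz L b) \<and> (\<exists>L. bounded_Lipschitz L b') \<and> (\<forall>y. (b has_real_derivative b' y) (at y))
    \<and> (\<exists>L. bounded_Lipschitz L \<theta>) \<and> (\<exists>L. bounded_Lipschitz L \<theta>') \<and> (\<forall>y. (\<theta> has_real_derivative \<theta>' y) (at y))
    \<and> (\<forall>t. 0 \<le> b t) \<and> (\<forall>t. t < - s \<or> 0 \<le> t \<longrightarrow> b t = 0 \<and> b' t = 0) \<and> (LBINT y. b y) = 1
    \<and> (\<forall>t. 0 \<le> \<theta> t \<and> \<theta> t \<le> 1) \<and> (\<forall>t. t < - 3 * s \<or> s < t \<longrightarrow> \<theta> t = 0 \<and> \<theta>' t = 0)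
    \<and> (\<forall>t. 0 \<le> t \<longrightarrow> \<theta>' t \<le> 0 \<and> b (- t) \<le> 44 / bump_mass * - \<theta>' t)"
proof -
  define k where "k = 2 / (bump_mass * s)"
  have k: "0 < k" using assms bump_mass_pos by (simp add: k_def)
  \<comment> \<open>b is a bump on [-s, 0]. \<theta> is a bump on [-3 s, s] centred at -s, so [0, s]
    is the outer half of its decreasing flank, where \<theta>' vanishes only at t = s. There
    \<theta>' has a zero of first order and b (- t) one of second order, which makes the domination
    possible.\<close>
  define b where "b t = k * bump (2 / s * t + 1)" for t
  define b' where "b' t = k * 2 / s * bump' (2 / s * t + 1)" for t
  define \<theta> where "\<theta> t = 1 * bump (1 / (2 * s) * t + 1 / 2)" for t
  define \<theta>' where "\<theta>' t = 1 / (2 * s) * bump' (1 / (2 * s) * t + 1 / 2)" for t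
  have d: "dist (m * y + r) (m * y' + r) \<le> (\<bar>m\<bar> + 1) * dist y y'" for m r y y' :: real
  proof -
    have d: "dist (m * y + r) (m * y' + r) = \<bar>m\<bar> * dist y y'"
      by (simp add: dist_real_def abs_mult[symmetric] algebra_simps)
    then show ?thesis by (simp add: algebra_simps)
  qed
  have BL: "\<exists>L. bounded_Lipschitz L (\<lambda>y. c * g (m * y + r))" if g: "\<exists>L. bounded_Lipschitz L g" for g :: "real \<Rightarrow> real" and c m r
  proof -
    obtain L where "bounded_Lipschitz L g" using g by blast
    then have "bounded_Lipschitz (L * (\<bar>m\<bar> + 1)) (\<lambda>y. g (m * y + r))"
      by (rule bounded_Lipschitz_compose[OF _ d]) simp
    then show ?thesis by (intro ex_bounded_Lipschitz_intros) auto
  qed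
  have der: "((\<lambda>y. c * bump (m * y + r)) has_real_derivative c * m * bump' (m * y + r)) (at y)" for c m r y
  proof -
    have "((\<lambda>y. bump (m * y + r)) has_real_derivative bump' (m * y + r) * m) (at y)"
      by (rule DERIV_chain2[OF has_real_derivative_bump]) (auto intro!: derivative_eq_intros)
    then show ?thesis by (auto intro!: derivative_eq_intros)
  qed
  show ?thesis
  proof (rule exI[of _ b], rule exI[of _ b'], rule exI[of _ \<theta>], rule exI[of _ \<theta>'], intro conjI allI impI)
    show "\<exists>L. bounded_Lipschitz L b" "\<exists>L. bounded_Lipschitz L \<theta>"
      unfolding b_def \<theta>_def by (rule BL[OF bounded_Lipschitz_bump(1)])+
    show "\<exists>L. bounded_Lipschitz L b'" "\<exists>L. bounded_Lipschitz L \<theta>'"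
      unfolding b'_def \<theta>'_def by (rule BL[OF bounded_Lipschitz_bump(2)])+
    fix t
    show "(b has_real_derivative b' t) (at t)"
      unfolding b_def b'_def using der[of k "2 / s" 1 t] by simp
    show "(\<theta> has_real_derivative \<theta>' t) (at t)"
      unfolding \<theta>_def \<theta>'_def using der[of 1 "1 / (2 * s)" "1 / 2" t] by simp
    show "0 \<le> b t" using k bump_bounds by (simp add: b_def)
    show "0 \<le> \<theta> t" "\<theta> t \<le> 1" using bump_bounds by (simp_all add: \<theta>_def)
    show "b t = 0" "b' t = 0" if "t < - s \<or> 0 \<le> t"
    proof -
      have "2 / s * t \<le> -2 \<or> 0 \<le> 2 / s * t" using that assms by (auto simp: field_simps)
      then have "1 \<le> \<bar>2 / s * t + 1\<bar>" by linarith
      then show "b t = 0" "b' t = 0" by (simp_all add: b_def b'_def bump_zero)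
    qed
    show "\<theta> t = 0" "\<theta>' t = 0" if "t < - 3 * s \<or> s < t"
    proof -
      have "1 / (2 * s) * t \<le> - 3 / 2 \<or> 1 / 2 \<le> 1 / (2 * s) * t" using that assms by (auto simp: field_simps)
      then have "1 \<le> \<bar>1 / (2 * s) * t + 1 / 2\<bar>" by linarith
      then show "\<theta> t = 0" "\<theta>' t = 0" by (simp_all add: \<theta>_def \<theta>'_def bump_zero)
    qed
    have "(LBINT y. b y) = s / 2 * (LBINT y. b (- (s / 2) + s / 2 * y))"
      using lborel_integral_real_affine[of "s / 2" b "- (s / 2)"] assms by simp
    also have "(\<lambda>y. b (- (s / 2) + s / 2 * y)) = (\<lambda>y. k * bump y)"
      using assms by (auto simp: b_def field_simps)
    also have "s / 2 * (LBINT y. k * bump y) = 1"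
      using assms bump_mass_pos by (simp add: k_def bump_mass_def[symmetric])
    finally show "(LBINT y. b y) = 1" .
    assume t: "0 \<le> t"
    define y where "y = 1 / (2 * s) * t + 1 / 2"
    have y: "1 / 2 \<le> y" using t assms by (simp add: y_def)
    have \<theta>y: "\<theta>' t = 1 / (2 * s) * step' y" unfolding \<theta>'_def y_def[symmetric] using y by (simp add: bump_nonneg_arg)
    show "\<theta>' t \<le> 0" unfolding \<theta>y using assms step_bounds(3)[of y] by (simp add: mult_le_0_iff zero_le_mult_iff divide_le_0_iff)
    have "2 / s * (- t) + 1 = 3 - 4 * y" using assms by (simp add: y_def field_simps)
    then have by': "b (- t) = k * bump (3 - 4 * y)" unfolding b_def by simp
    \<comment> \<open>For 1/2 \<le> y < 1 the left side is at most 32 (1 - y), while - step' y = 4 y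
      (1 + y) (1 - y) is at least 3 (1 - y); 11 is the least integer that bridges the two.\<close>
    have "bump (3 - 4 * y) \<le> 11 * - step' y"
    proof (cases "y < 1")
      case False
      then show ?thesis using bump_zero(1)[of "3 - 4 * y"] step_bounds(3)[of y] by simp
    next
      case True
      define u where "u = 3 - 4 * y"
      have u: "\<bar>u\<bar> \<le> 1" using True y by (simp add: u_def abs_le_iff)
      have e: "bump u = (1 - u\<^sup>2)\<^sup>2"
      proof (cases "0 \<le> u")
        case True
        then show ?thesis using u by (simp add: bump_def step_def)
      next
        case False
        then show ?thesis using u by (simp add: bump_def step_def)
      qed
      have s': "- step' y = 4 * y * (1 - y\<^sup>2)" using True y by (simp add: step'_def)
      have "(1 - u\<^sup>2) = 8 * (2 * y - 1) * (1 - y)" by (simp add: u_def power2_eq_square algebra_simps)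
      then have "(1 - u\<^sup>2)\<^sup>2 = (8 * (2 * y - 1) * (1 - y))\<^sup>2" by (simp only:)
      also have "\<dots> = 64 * ((2 * y - 1)\<^sup>2 * (1 - y)) * (1 - y)" by (simp add: power2_eq_square algebra_simps)
      also have "\<dots> \<le> 64 * (1 * (1 / 2)) * (1 - y)"
      proof (intro mult_right_mono mult_left_mono mult_mono)
        have "(2 * y - 1)\<^sup>2 \<le> 1\<^sup>2" using y True by (intro power_mono) auto
        then show "(2 * y - 1)\<^sup>2 \<le> 1" by simp
      qed (use y True in auto)
      also have "\<dots> \<le> 11 * (4 * (1 / 2) * (1 + 1 / 2)) * (1 - y)" using True by simp
      also have "\<dots> \<le> 11 * (4 * y * (1 + y)) * (1 - y)"
        using y True by (intro mult_right_mono mult_left_mono mult_mono) auto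
      also have "\<dots> = 11 * - step' y" unfolding s' by (simp add: power2_eq_square algebra_simps)
      finally show ?thesis using e by (simp add: u_def)
    qed
    then have "b (- t) \<le> k * (11 * - step' y)" unfolding by' using k by (intro mult_left_mono) auto
    \<comment> \<open>44 = 2 * 11 * 2: the 2 in k, the 11 above, and the factor 2 s between step'
      and \<theta>', whose s cancels the one in k.\<close>
    also have "\<dots> = 44 / bump_mass * - \<theta>' t" unfolding \<theta>y k_def using assms bump_mass_pos by (simp add: field_simps)
    finally show "b (- t) \<le> 44 / bump_mass * - \<theta>' t" .
  qed
qed

section \<open>Stability\<close>

abbreviation window :: "real \<Rightarrow> (real \<times> real) set" where
  "window \<rho> \<equiv> {-\<rho>..\<rho>} \<times> {0..\<rho>}"

text \<open>A smooth substitute for the indicator function of a backward cone of slope \<open>\<alpha>\<close>, the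
  domain of dependence of the box.\<close>

lemma exists_cone:
  assumes "0 < \<alpha>" "0 < \<rho>"
  shows "\<exists>\<psi> \<psi>x \<psi>t R b0. C11 \<psi> \<psi>x \<psi>t \<and> 0 \<le> R \<and> 0 < b0 \<and> (\<forall>z. 0 \<le> \<psi> z \<and> \<psi> z \<le> 1)
    \<and> (\<forall>z. norm z > R \<longrightarrow> \<psi> z = 0 \<and> \<psi>x z = 0 \<and> \<psi>t z = 0)
    \<and> (\<forall>z. 0 \<le> snd z \<longrightarrow> 0 \<le> - (\<psi>t z + \<alpha> * \<bar>\<psi>x z\<bar>))
    \<and> (\<forall>z \<in> window \<rho>. b0 \<le> - (\<psi>t z + \<alpha> * \<bar>\<psi>x z\<bar>))"
proof -
  \<comment> \<open>With these choices the time profile has its argument (t + 1) / T in [1/T, 1/2]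
    on the window, away from the zeros of \<open>step'\<close>, while the two lateral profiles are
    identically 1 there.\<close>
  define T where "T = 2 * (\<rho> + 1)"
  define Q where "Q = \<rho> * (1 + \<alpha>)"
  have T: "2 < T" using assms by (simp add: T_def)
  define yB :: "real \<times> real \<Rightarrow> real" where "yB z = 0 * fst z + 1 / T * snd z + 1 / T" for z
  define yS :: "real \<times> real \<Rightarrow> real" where "yS z = 1 * fst z + \<alpha> * snd z + - Q" for z
  define yT :: "real \<times> real \<Rightarrow> real" where "yT z = (- 1) * fst z + \<alpha> * snd z + - Q" for z
  define \<psi> where "\<psi> z = bump (yB z) * (step (yS z) * step (yT z))" for z
  define \<psi>x where "\<psi>x z = 0 * bump' (yB z) * (step (yS z) * step (yT z))
    + bump (yB z) * (1 * step' (yS z) * step (yT z) + step (yS z) * ((-1) * step' (yT z)))" for z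
  define \<psi>t where "\<psi>t z = 1 / T * bump' (yB z) * (step (yS z) * step (yT z))
    + bump (yB z) * (\<alpha> * step' (yS z) * step (yT z) + step (yS z) * (\<alpha> * step' (yT z)))" for z
  \<comment> \<open>The cone widens backwards in time, and the time profile reaches down to about t
    = - (T + 1); this accounts for the summand \<alpha> (T + 1).\<close>
  define R where "R = (T + 1) + (1 + Q + \<alpha> * (T + 1))"
  note aff = C11_affine[OF bounded_Lipschitz_bump has_real_derivative_bump, of 0 "1 / T" "1 / T", folded yB_def]
    C11_affine[OF bounded_Lipschitz_step bounded_Lipschitz_step' has_real_derivative_step, of 1 \<alpha> "- Q", folded yS_def]
    C11_affine[OF bounded_Lipschitz_step bounded_Lipschitz_step' has_real_derivative_step, of "-1" \<alpha> "- Q", folded yT_def]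
  have C: "C11 \<psi> \<psi>x \<psi>t"
    using C11_mult[OF aff(1) C11_mult[OF aff(2,3)]] unfolding \<psi>_def[abs_def] \<psi>x_def[abs_def] \<psi>t_def[abs_def] .
  have supp: "\<psi> z = 0 \<and> \<psi>x z = 0 \<and> \<psi>t z = 0" if "norm z > R" for z
  proof -
    have n: "\<bar>fst z\<bar> + \<bar>snd z\<bar> > R" using that norm_Pair_le[of "fst z" "snd z"] by simp
    consider "T + 1 < \<bar>snd z\<bar>" | "\<bar>snd z\<bar> \<le> T + 1" "1 + Q + \<alpha> * (T + 1) < \<bar>fst z\<bar>"
      using n by (fastforce simp: R_def)
    then show ?thesis
    proof cases
      case 1
      have "yB z = (snd z + 1) / T" by (simp add: yB_def add_divide_distrib)
      then have "1 \<le> \<bar>yB z\<bar>" using 1 T by simp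
      then show ?thesis by (simp add: \<psi>_def \<psi>x_def \<psi>t_def bump_zero)
    next
      case 2
      have "- (\<alpha> * (T + 1)) \<le> \<alpha> * snd z"
      proof -
        have "- (T + 1) \<le> snd z" using 2(1) by linarith
        from mult_left_mono[OF this, of \<alpha>] show ?thesis using assms(1) by (simp add: algebra_simps)
      qed
      then have "1 \<le> yS z \<or> 1 \<le> yT z" using 2(2) by (auto simp: yS_def yT_def)
      then show ?thesis by (auto simp: \<psi>_def \<psi>x_def \<psi>t_def)
    qed
  qed
  have bounds: "0 \<le> \<psi> z \<and> \<psi> z \<le> 1" for z
  proof -
    have "bump (yB z) * (step (yS z) * step (yT z)) \<le> 1 * (1 * 1)"
      using bump_bounds step_bounds by (intro mult_mono) auto
    then show ?thesis using bump_bounds step_bounds by (auto simp: \<psi>_def)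
  qed
  \<comment> \<open>The lateral profiles move with speed \<alpha>: their time derivatives contribute
    - \<alpha> (p + q), which outweighs \<alpha> times the modulus of q - p coming from
    \<open>\<psi>x\<close>. Only the decay of the time profile is left.\<close>
  have main: "\<psi>t z + \<alpha> * \<bar>\<psi>x z\<bar> \<le> 1 / T * bump' (yB z) * (step (yS z) * step (yT z))" for z
  proof -
    define p where "p = - (step' (yS z) * step (yT z))"
    define q where "q = - (step (yS z) * step' (yT z))"
    have pq: "0 \<le> p" "0 \<le> q" using step_bounds by (auto simp: p_def q_def mult_le_0_iff)
    have "\<psi>x z = bump (yB z) * (q - p)" by (simp add: \<psi>x_def p_def q_def algebra_simps)
    then have "\<alpha> * \<bar>\<psi>x z\<bar> = bump (yB z) * (\<alpha> * \<bar>q - p\<bar>)" using bump_bounds by (simp add: abs_mult)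
    moreover have "\<psi>t z = 1 / T * bump' (yB z) * (step (yS z) * step (yT z)) - bump (yB z) * (\<alpha> * (p + q))"
      by (simp add: \<psi>t_def p_def q_def algebra_simps)
    moreover have "bump (yB z) * (\<alpha> * \<bar>q - p\<bar>) \<le> bump (yB z) * (\<alpha> * (p + q))"
      using bump_bounds assms pq by (intro mult_left_mono) auto
    ultimately show ?thesis by linarith
  qed
  have nonneg: "0 \<le> - (\<psi>t z + \<alpha> * \<bar>\<psi>x z\<bar>)" if "0 \<le> snd z" for z
  proof -
    have "0 \<le> yB z" using that T by (simp add: yB_def)
    then have "bump' (yB z) \<le> 0" using step_bounds(3) by (simp add: bump_nonneg_arg)
    then have "1 / T * bump' (yB z) * (step (yS z) * step (yT z)) \<le> 0"
      using T by (intro mult_nonpos_nonneg mult_nonneg_nonneg mult_nonneg_nonpos step_bounds) auto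
    then show ?thesis using main[of z] by linarith
  qed
  \<comment> \<open>On the window - step' y = 4 y (1 - y^2) is at least 4 (1/T) (3/4) = 3/T; the
    inner derivative adds another factor 1/T.\<close>
  have pos: "3 / T\<^sup>2 \<le> - (\<psi>t z + \<alpha> * \<bar>\<psi>x z\<bar>)" if "z \<in> window \<rho>" for z
  proof -
    have z: "- \<rho> \<le> fst z" "fst z \<le> \<rho>" "0 \<le> snd z" "snd z \<le> \<rho>" using that by (cases z; auto)+
    have y: "1 / T \<le> yB z" "yB z \<le> 1 / 2" using z T by (auto simp: yB_def T_def field_simps)
    have y0: "0 \<le> yB z" using y(1) T by (meson order_trans divide_nonneg_nonneg less_imp_le zero_le_one le_less_trans zero_le_numeral)
    have "\<alpha> * snd z \<le> \<alpha> * \<rho>" using z assms by (intro mult_left_mono) auto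
    then have "yS z \<le> 0" "yT z \<le> 0" using z by (auto simp: yS_def yT_def Q_def algebra_simps)
    then have "\<psi>t z + \<alpha> * \<bar>\<psi>x z\<bar> \<le> 1 / T * step' (yB z)" using main[of z] y0 by (simp add: bump_nonneg_arg)
    moreover have "3 / T \<le> - step' (yB z)"
    proof -
      have "(yB z)\<^sup>2 \<le> (1 / 2)\<^sup>2" using y y0 by (intro power_mono) auto
      then have "4 * (1 / T) * (3 / 4) \<le> 4 * yB z * (1 - (yB z)\<^sup>2)"
        using y y0 T by (intro mult_mono) (auto simp: power2_eq_square)
      then show ?thesis using y y0 by (simp add: step'_def)
    qed
    then have "1 / T * (3 / T) \<le> 1 / T * - step' (yB z)" using T by (intro mult_left_mono) auto
    ultimately show ?thesis using T by (simp add: power2_eq_square)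
  qed
  show ?thesis
  proof (rule exI[of _ \<psi>], rule exI[of _ \<psi>x], rule exI[of _ \<psi>t], rule exI[of _ R], rule exI[of _ "3 / T\<^sup>2"], intro conjI allI impI ballI)
    show "0 \<le> R" using assms T by (simp add: R_def Q_def)
    show "0 < 3 / T\<^sup>2" using T by simp
  qed (use C supp bounds nonneg pos in auto)
qed

text \<open>Triangle inequality through w z2, averaged over z2 with a kernel of mass 1. The second
  term is the doubled expression of the pair (w, w): the entropy estimate bounds it, taking the
  place of a modulus of continuity of w.\<close>

lemma integral_le_mollified_differences:
  fixes v w \<beta> \<omega> :: "real \<times> real \<Rightarrow> real"
  assumes [measurable]: "v \<in> borel_measurable borel" "w \<in> borel_measurable borel" "\<beta> \<in> borel_measurable borel" "\<omega> \<in> borel_measurable borel"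
    and bd: "bounded_fun v" "bounded_fun w" "bounded_fun \<beta>" "bounded_fun \<omega>"
    and \<beta>: "\<And>z. 0 \<le> snd z \<Longrightarrow> 0 \<le> \<beta> z" "\<And>z. norm z > R \<Longrightarrow> \<beta> z = 0"
    and \<omega>: "\<And>z. 0 \<le> \<omega> z" "\<And>z. norm z > 1 \<Longrightarrow> \<omega> z = 0" "\<And>z. snd z \<ge> 0 \<Longrightarrow> \<omega> z = 0"
      "\<And>z. (LBINT z2. \<omega> (z - z2)) = 1"
  shows "(LBINT z. (half z * \<bar>v z - w z\<bar> * \<beta> z)) \<le>
      (LBINT z1. (LBINT z2. (half z1 * half z2 * \<bar>v z1 - w z2\<bar> * \<beta> z1 * \<omega> (z1 - z2))))
    + (LBINT z1. (LBINT z2. (half z1 * half z2 * \<bar>w z1 - w z2\<bar> * \<beta> z1 * \<omega> (z1 - z2))))"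
proof -
  define G where "G u = (\<lambda>p. half (fst p) * half (snd p) * \<bar>u (fst p) - w (snd p)\<bar> * \<beta> (fst p) * \<omega> (fst p - snd p))"
    for u :: "real \<times> real \<Rightarrow> real"
  have m: "G u \<in> borel_measurable borel" if [measurable]: "u \<in> borel_measurable borel" for u
    unfolding G_def by measurable
  have b: "bounded_fun (G u)" if "bounded_fun u" for u
    unfolding G_def by (intro bdd bd[THEN bounded_fun_compose] that[THEN bounded_fun_compose])
  have z2: "G u (z1, z2) = 0" if "norm z2 > R + 1 \<or> norm z1 > R" for u z1 z2
  proof (cases "norm z1 > R")
    case False
    then have "norm (z1 - z2) > 1" using that norm_triangle_ineq4[of z1 "z1 - z2"] by auto
    then show ?thesis using \<omega>(2) by (simp add: G_def)
  qed (simp add: G_def \<beta>)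
  have s: "G u p = 0" if "norm p > 2 * R + 1" for u p
    using that z2[of "snd p" "fst p" u] norm_Pair_le[of "fst p" "snd p"] by fastforce
  note Fv = fubini_bounded_fun_support[OF m[OF assms(1)] b[OF bd(1)] s]
  note Fw = fubini_bounded_fun_support[OF m[OF assms(2)] b[OF bd(2)] s]
  have int2: "integrable lborel (\<lambda>z2. G u (z1, z2))" if [measurable]: "u \<in> borel_measurable borel" and "bounded_fun u" for u z1
  proof (rule integrable_bounded_fun_support)
    show "(\<lambda>z2. G u (z1, z2)) \<in> borel_measurable borel" unfolding G_def fst_conv snd_conv by measurable
    show "bounded_fun (\<lambda>z2. G u (z1, z2))" using b[OF that(2)] by (rule bounded_fun_compose)
    show "G u (z1, z2') = 0" if "norm z2' > R + 1" for z2' using that z2 by blast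
  qed
  have "(LBINT z. (half z * \<bar>v z - w z\<bar> * \<beta> z)) \<le> (LBINT z1. ((LBINT z2. G v (z1, z2)) + (LBINT z2. G w (z1, z2))))"
  proof (rule Bochner_Integration.integral_mono)
    show "integrable lborel (\<lambda>z. half z * \<bar>v z - w z\<bar> * \<beta> z)"
    proof (rule integrable_bounded_fun_support[where R = R])
      show "bounded_fun (\<lambda>z. half z * \<bar>v z - w z\<bar> * \<beta> z)"
        using bd(3) by (intro bdd bd) 
    qed (auto simp: \<beta>)
    show "integrable lborel (\<lambda>z1. (LBINT z2. G v (z1, z2)) + (LBINT z2. G w (z1, z2)))"
      using Fv(3) Fw(3) by (rule Bochner_Integration.integrable_add)
    fix z1 :: "real \<times> real"
    show "half z1 * \<bar>v z1 - w z1\<bar> * \<beta> z1 \<le> (LBINT z2. G v (z1, z2)) + (LBINT z2. G w (z1, z2))"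
    proof (cases "0 \<le> snd z1")
      case False
      then show ?thesis by (simp add: G_def half_cases)
    next
      case True
      have "half z1 * \<bar>v z1 - w z1\<bar> * \<beta> z1 = (LBINT z2. (\<bar>v z1 - w z1\<bar> * \<beta> z1) * \<omega> (z1 - z2))"
        using True \<omega>(4)[of z1] by (simp add: half_cases)
      also have "\<dots> \<le> (LBINT z2. (G v (z1, z2) + G w (z1, z2)))"
      proof (rule Bochner_Integration.integral_mono)
        \<comment> \<open>The integral of a non-integrable function is 0 by convention, so an
          integral equal to 1 certifies integrability.\<close>
        show "integrable lborel (\<lambda>z2. (\<bar>v z1 - w z1\<bar> * \<beta> z1) * \<omega> (z1 - z2))"
          using \<omega>(4)[of z1] by (intro integrable_mult_right) (metis not_integrable_integral_eq zero_neq_one)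
        show "integrable lborel (\<lambda>z2. G v (z1, z2) + G w (z1, z2))"
          using int2[OF assms(1) bd(1)] int2[OF assms(2) bd(2)] by (rule Bochner_Integration.integrable_add)
        fix z2 :: "real \<times> real"
        show "(\<bar>v z1 - w z1\<bar> * \<beta> z1) * \<omega> (z1 - z2) \<le> G v (z1, z2) + G w (z1, z2)"
        proof (cases "\<omega> (z1 - z2) = 0")
          case False
          \<comment> \<open>The kernel sees only points z2 later than z1. These stay in the
            half-plane, so none of its mass is lost at t = 0.\<close>
          then have "snd (z1 - z2) < 0" using \<omega>(3)[of "z1 - z2"] by linarith
          then have h: "half z2 = 1" "half z1 = 1" using True by (auto simp: half_cases)
          have "\<bar>v z1 - w z1\<bar> * (\<beta> z1 * \<omega> (z1 - z2)) \<le> (\<bar>v z1 - w z2\<bar> + \<bar>w z1 - w z2\<bar>) * (\<beta> z1 * \<omega> (z1 - z2))"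
            using \<beta>(1)[OF True] \<omega>(1)[of "z1 - z2"] by (intro mult_right_mono) auto
          then show ?thesis by (simp add: G_def h algebra_simps)
        qed (simp add: G_def)
      qed
      also have "\<dots> = (LBINT z2. G v (z1, z2)) + (LBINT z2. G w (z1, z2))"
        using int2[OF assms(1) bd(1)] int2[OF assms(2) bd(2)] by (rule Bochner_Integration.integral_add)
      finally show ?thesis .
    qed
  qed
  also have "\<dots> = (LBINT z1. (LBINT z2. G v (z1, z2))) + (LBINT z1. (LBINT z2. G w (z1, z2)))"
    using Fv(3) Fw(3) by (rule Bochner_Integration.integral_add)
  finally show ?thesis by (simp add: G_def)
qed

lemma product_kernel_mass:
  fixes a b :: "real \<Rightarrow> real"
  assumes [measurable]: "a \<in> borel_measurable borel" "b \<in> borel_measurable borel"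
    and "bounded_fun a" "bounded_fun b" "(LBINT y. a y) = 1" "(LBINT y. b y) = 1"
    and s: "\<And>y. 1 < \<bar>y\<bar> \<Longrightarrow> a y = 0" "\<And>y. 1 < \<bar>y\<bar> \<Longrightarrow> b y = 0"
  shows "(LBINT z2. a (fst (z - z2)) * b (snd (z - z2))) = 1"
proof -
  have "(LBINT z2. a (fst (z - z2)) * b (snd (z - z2)))
    = (LBINT x. (LBINT t. a (fst z - x) * b (snd z - t)))"
  proof -
    have far: "a (fst (z - p)) * b (snd (z - p)) = 0" if "norm p > norm (fst z) + norm (snd z) + 2" for p
    proof -
      have "\<bar>fst p\<bar> + \<bar>snd p\<bar> > norm (fst z) + norm (snd z) + 2" using that norm_Pair_le[of "fst p" "snd p"] by simp
      then have "1 < \<bar>fst (z - p)\<bar> \<or> 1 < \<bar>snd (z - p)\<bar>" by auto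
      then show ?thesis using s by auto
    qed
    have "bounded_fun (\<lambda>p. a (fst (z - p)) * b (snd (z - p)))"
      by (intro bdd assms(3,4)[THEN bounded_fun_compose])
    from fubini_bounded_fun_support(1)[OF _ this far] show ?thesis by simp
  qed
  also have "\<dots> = 1" using assms(5,6) by (simp add: lborel_integral_reflect)
  finally show ?thesis .
qed

lemma exists_small_factor: "0 < (e::real) \<Longrightarrow> 0 \<le> c \<Longrightarrow> \<exists>x>0. x \<le> 1 / 2 \<and> c * x \<le> e"
proof (intro exI conjI)
  assume e: "0 < e" "0 \<le> c"
  show "0 < min (1 / 2) (e / (c + 1))" using e by simp
  show "min (1 / 2) (e / (c + 1)) \<le> 1 / 2" by (rule min.cobounded1)
  have "c * min (1 / 2) (e / (c + 1)) \<le> c * (e / (c + 1))" using e by (intro mult_left_mono) auto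
  also have "\<dots> \<le> e" using e by (simp add: field_simps)
  finally show "c * min (1 / 2) (e / (c + 1)) \<le> e" .
qed

context lipschitz_flux
begin

text \<open>The threshold for n is uniform over a tame family and over bounded levels k, because the
  levels used are the values w z2, v z1 and u0 x, which vary with the point of integration.\<close>

definition asymptotic_entropy :: "(real \<Rightarrow> real) \<Rightarrow> real \<Rightarrow> (nat \<Rightarrow> real \<times> real \<Rightarrow> real) \<Rightarrow> bool" where
  "asymptotic_entropy u0 M v \<longleftrightarrow> (\<forall>n. v n \<in> borel_measurable borel) \<and> (\<forall>n z. \<bar>v n z\<bar> \<le> M) \<and>
     (\<forall>B \<Phi> e. tame_family \<Phi> \<longrightarrow> 0 < e \<longrightarrow> (\<forall>\<^sub>F n in sequentially. \<forall>k. \<bar>k\<bar> \<le> B \<longrightarrow>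
        (\<forall>(\<phi>, \<phi>x, \<phi>t) \<in> \<Phi>. - e \<le> entropy_functional f u0 (v n) k \<phi> \<phi>x \<phi>t)))"

lemma asymptotic_entropyD:
  assumes "asymptotic_entropy u0 M v"
  shows "v n \<in> borel_measurable borel" "\<bar>v n z\<bar> \<le> M"
    and "tame_family \<Phi> \<Longrightarrow> 0 < e \<Longrightarrow> (\<forall>\<^sub>F n in sequentially. \<forall>k. \<bar>k\<bar> \<le> B \<longrightarrow>
        (\<forall>(\<phi>, \<phi>x, \<phi>t) \<in> \<Phi>. - e \<le> entropy_functional f u0 (v n) k \<phi> \<phi>x \<phi>t))"
  using assms unfolding asymptotic_entropy_def by blast+

text \<open>The time scale \<open>s\<close> of the mollifier is chosen after its space scale \<open>\<epsilon>\<close>, and the bound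
  on the defects of the entropy inequalities after both.\<close>

lemma stability_eventually:
  assumes [measurable]: "u0 \<in> borel_measurable borel" and M: "\<And>x. \<bar>u0 x\<bar> \<le> M"
    and v: "asymptotic_entropy u0 M v" and w: "asymptotic_entropy u0 M w" and "0 < \<rho>" "0 < e"
  shows "\<forall>\<^sub>F n in sequentially. (LBINT z. (indicator (window \<rho>) z * \<bar>v n z - w n z\<bar>)) \<le> e"
proof -
  have M0: "0 \<le> M" using M[of 0] by linarith
  obtain \<psi> \<psi>x \<psi>t R b0 where C\<psi>: "C11 \<psi> \<psi>x \<psi>t" and R: "0 \<le> R" and b0: "0 < b0"
    and \<psi>: "\<And>z. 0 \<le> \<psi> z" "\<And>z. \<psi> z \<le> 1" "\<And>z. norm z > R \<Longrightarrow> \<psi> z = 0 \<and> \<psi>x z = 0 \<and> \<psi>t z = 0"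
    and \<beta>0: "\<And>z. 0 \<le> snd z \<Longrightarrow> 0 \<le> - (\<psi>t z + \<alpha> * \<bar>\<psi>x z\<bar>)"
    and \<beta>1: "\<And>z. z \<in> window \<rho> \<Longrightarrow> b0 \<le> - (\<psi>t z + \<alpha> * \<bar>\<psi>x z\<bar>)"
    using exists_cone[OF alpha_pos \<open>0 < \<rho>\<close>] by (smt (verit))
  define A where "A = measure lborel (cball (0::real \<times> real) (R + 1))"
  define C where "C = 44 / bump_mass"
  have C0: "0 < C" using bump_mass_pos by (simp add: C_def)
  \<comment> \<open>The final bound is twice a sum of three terms, governed by m, s and \<eta>; each
    is made at most an eighth of \<open>b0 * e\<close>.\<close>
  obtain m where m: "0 < m" "C * m \<le> b0 * e / 8"
    using exists_small_factor[of "b0 * e / 8" C] b0 \<open>0 < e\<close> C0 by auto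
  obtain r where r: "0 < r" and kernel: "\<And>K. K \<in> borel_measurable borel \<Longrightarrow> bounded_fun K \<Longrightarrow> (\<And>z. 0 \<le> K z) \<Longrightarrow>
      (\<And>x y. r < \<bar>x - y\<bar> \<Longrightarrow> K (x, y) = 0) \<Longrightarrow> (\<And>x. (LBINT y. K (x, y)) \<le> 1) \<Longrightarrow> (\<And>y. (LBINT x. K (x, y)) \<le> 1)
      \<Longrightarrow> (LBINT x. indicator {-R..R} x * (LBINT y. (\<bar>u0 y - u0 x\<bar> * K (x, y)))) \<le> m"
    using L1_kernel_approx[OF assms(1) M m(1) R] by (smt (verit))
  define \<epsilon> where "\<epsilon> = min r (1 / 2)"
  have \<epsilon>: "0 < \<epsilon>" "\<epsilon> \<le> 1 / 2" "\<epsilon> \<le> r" using r by (auto simp: \<epsilon>_def)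
  obtain a a' where a: "\<exists>L. bounded_Lipschitz L a" "\<exists>L. bounded_Lipschitz L a'" "\<And>y. (a has_real_derivative a' y) (at y)"
    and a0: "\<And>y. 0 \<le> a y" "\<And>y. \<epsilon> < \<bar>y\<bar> \<Longrightarrow> a y = 0 \<and> a' y = 0" "(LBINT y. a y) = 1"
    using exists_space_mollifier[OF \<epsilon>(1)] by (elim exE conjE) blast
  have [measurable]: "a \<in> borel_measurable borel" "a' \<in> borel_measurable borel"
    using a(1,2) by (auto intro!: borel_measurable_continuous_onI intro: bounded_Lipschitz_continuous)
  have ba: "bounded_fun a" "bounded_fun a'" using a(1,2) bounded_fun_bounded_Lipschitz by blast+
  then obtain A' where A': "\<And>y. \<bar>a' y\<bar> \<le> A'" by (auto simp: bounded_fun_def)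
  have A'0: "0 \<le> A'" using A'[of 0] by linarith
  have "0 \<le> C * (2 * R * (\<alpha> * (2 * M) * A' * 2))" using C0 R alpha_pos M0 A'0 by simp
  then obtain s where s: "0 < s" "s \<le> 1 / 2" "C * (2 * R * (\<alpha> * (2 * M) * A' * 2)) * s \<le> b0 * e / 8"
    using exists_small_factor[of "b0 * e / 8"] b0 \<open>0 < e\<close> by (metis divide_pos_pos mult_pos_pos zero_less_numeral)
  obtain b b' \<theta> \<theta>' where b: "\<exists>L. bounded_Lipschitz L b" "\<exists>L. bounded_Lipschitz L b'" "\<And>y. (b has_real_derivative b' y) (at y)"
    and \<theta>: "\<exists>L. bounded_Lipschitz L \<theta>" "\<exists>L. bounded_Lipschitz L \<theta>'" "\<And>y. (\<theta> has_real_derivative \<theta>' y) (at y)"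
    and bs: "\<And>t. 0 \<le> b t" "\<And>t. t < - s \<or> 0 \<le> t \<Longrightarrow> b t = 0 \<and> b' t = 0" "(LBINT y. b y) = 1"
    and \<theta>s: "\<And>t. 0 \<le> \<theta> t \<and> \<theta> t \<le> 1" "\<And>t. t < - 3 * s \<or> s < t \<Longrightarrow> \<theta> t = 0 \<and> \<theta>' t = 0"
      "\<And>t. 0 \<le> t \<Longrightarrow> \<theta>' t \<le> 0 \<and> b (- t) \<le> C * - \<theta>' t"
    using exists_time_mollifier[OF s(1)] unfolding C_def[symmetric] by (elim exE conjE) blast
  have [measurable]: "b \<in> borel_measurable borel" "\<theta> \<in> borel_measurable borel" "\<theta>' \<in> borel_measurable borel"
    using b(1) \<theta>(1,2) by (auto intro!: borel_measurable_continuous_onI intro: bounded_Lipschitz_continuous)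
  have bb: "bounded_fun b" "bounded_fun \<theta>'" using b(1) \<theta>(2) bounded_fun_bounded_Lipschitz by blast+
  \<comment> \<open>The coefficient of \<eta> in the final bound: C (2 R) from the initial layer and
    2 A from the doubling.\<close>
  define c where "c = C * (2 * R) + 2 * A"
  have "0 \<le> c" using C0 R by (simp add: c_def A_def)
  then obtain \<eta> where \<eta>: "0 < \<eta>" "c * \<eta> \<le> b0 * e / 8"
    using exists_small_factor[of "b0 * e / 8" c] b0 \<open>0 < e\<close> by auto

  define \<omega> :: "real \<times> real \<Rightarrow> real" where "\<omega> z = a (fst z) * b (snd z)" for z
  define \<omega>x :: "real \<times> real \<Rightarrow> real" where "\<omega>x z = a' (fst z) * b (snd z)" for z
  define \<omega>t :: "real \<times> real \<Rightarrow> real" where "\<omega>t z = a (fst z) * b' (snd z)" for z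
  \<comment> \<open>Time is reversed so that \<Theta> ((x, 0) - z) is the test function of the
    initial layer, which makes it a member of a family of reflections.\<close>
  define \<Theta> :: "real \<times> real \<Rightarrow> real" where "\<Theta> z = a (fst z) * \<theta> (- snd z)" for z
  define \<Theta>x :: "real \<times> real \<Rightarrow> real" where "\<Theta>x z = a' (fst z) * \<theta> (- snd z)" for z
  define \<Theta>t :: "real \<times> real \<Rightarrow> real" where "\<Theta>t z = a (fst z) * - \<theta>' (- snd z)" for z
  have C\<omega>: "C11 \<omega> \<omega>x \<omega>t"
    using C11_mult[OF C11_affine[OF a, of 1 0 0] C11_affine[OF b, of 0 1 0]]
    by (simp add: \<omega>_def[abs_def] \<omega>x_def[abs_def] \<omega>t_def[abs_def])
  have C\<Theta>: "C11 \<Theta> \<Theta>x \<Theta>t"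
    using C11_mult[OF C11_affine[OF a, of 1 0 0] C11_affine[OF \<theta>, of 0 "-1" 0]]
    by (simp add: \<Theta>_def[abs_def] \<Theta>x_def[abs_def] \<Theta>t_def[abs_def])
  have \<omega>s: "\<omega> z = 0 \<and> \<omega>x z = 0 \<and> \<omega>t z = 0" if "norm z > 1" for z
  proof -
    have "\<bar>fst z\<bar> + \<bar>snd z\<bar> > 1" using that norm_Pair_le[of "fst z" "snd z"] by simp
    then have "\<epsilon> < \<bar>fst z\<bar> \<or> (snd z < - s \<or> 0 \<le> snd z)" using \<epsilon> s by linarith
    then show ?thesis using a0(2) bs(2) by (auto simp: \<omega>_def \<omega>x_def \<omega>t_def)
  qed
  have \<Theta>s: "\<Theta> z = 0 \<and> \<Theta>x z = 0 \<and> \<Theta>t z = 0" if "norm z > 2" for z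
  proof -
    have "\<bar>fst z\<bar> + \<bar>snd z\<bar> > 2" using that norm_Pair_le[of "fst z" "snd z"] by simp
    then have "\<epsilon> < \<bar>fst z\<bar> \<or> (- snd z < - 3 * s \<or> s < - snd z)" using \<epsilon> s by linarith
    then show ?thesis using a0(2) \<theta>s(2) by (auto simp: \<Theta>_def \<Theta>x_def \<Theta>t_def)
  qed
  have \<omega>0: "0 \<le> \<omega> z" "snd z \<ge> 0 \<Longrightarrow> \<omega> z = 0" for z
    using a0(1) bs(1,2) by (auto simp: \<omega>_def)
  have \<Theta>0: "0 \<le> \<Theta> z" for z using a0(1) \<theta>s(1) by (simp add: \<Theta>_def)
  have \<omega>1: "(LBINT z2. \<omega> (z - z2)) = 1" for z
    unfolding \<omega>_def using \<epsilon> s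
    by (intro product_kernel_mass ba(1) bb(1) a0(3) bs(3)) (auto intro!: conjunct1[OF a0(2)] conjunct1[OF bs(2)])
  \<comment> \<open>The families serve the first variable of the doubling (for \<open>v\<close> and,
    in the pair (w, w), for \<open>w\<close>), the second variable, and the initial layer,
    respectively.\<close>
  define \<Phi>1 where "\<Phi>1 = {(\<lambda>z. \<psi> z * \<omega> (z - c), \<lambda>z. \<psi>x z * \<omega> (z - c) + \<psi> z * \<omega>x (z - c),
    \<lambda>z. \<psi>t z * \<omega> (z - c) + \<psi> z * \<omega>t (z - c)) |c. True}"
  define \<Phi>2 where "\<Phi>2 = {(\<lambda>z. \<omega> (c - z), \<lambda>z. - \<omega>x (c - z), \<lambda>z. - \<omega>t (c - z)) |c. norm c \<le> R}"
  define \<Phi>3 where "\<Phi>3 = {(\<lambda>z. \<Theta> (c - z), \<lambda>z. - \<Theta>x (c - z), \<lambda>z. - \<Theta>t (c - z)) |c. norm c \<le> R}"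
  have t1: "tame_family \<Phi>1" unfolding \<Phi>1_def by (rule tame_family_products[OF C\<psi> C\<omega> \<psi>(1) \<omega>0(1) \<psi>(3)])
  have t2: "tame_family \<Phi>2" unfolding \<Phi>2_def by (rule tame_family_reflections[OF C\<omega> \<omega>0(1) \<omega>s])
  have t3: "tame_family \<Phi>3" unfolding \<Phi>3_def by (rule tame_family_reflections[OF C\<Theta> \<Theta>0 \<Theta>s])
  note meas\<psi> = C11_borel_measurable[OF C\<psi>] and meas\<omega> = C11_borel_measurable[OF C\<omega>]
  note b\<psi> = C11_bounded_fun[OF C\<psi>] and b\<omega> = C11_bounded_fun[OF C\<omega>]
  have bu: "bounded_fun u0" using M by (rule bounded_funI)
  define K where "K = (\<lambda>p. a (fst p - snd p))"
  have kernel_a: "(LBINT x. indicator {-R..R} x * (LBINT y. (\<bar>u0 y - u0 x\<bar> * a (x - y)))) \<le> m"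
  proof -
    have "(LBINT x. indicator {-R..R} x * (LBINT y. (\<bar>u0 y - u0 x\<bar> * K (x, y)))) \<le> m"
    proof (rule kernel)
      show "K \<in> borel_measurable borel" unfolding K_def by measurable
      show "bounded_fun K" unfolding K_def by (rule bounded_fun_compose[OF ba(1)])
      show "K (x, y) = 0" if "r < \<bar>x - y\<bar>" for x y using that \<epsilon> a0(2)[of "x - y"] by (simp add: K_def)
      show "(LBINT y. K (x, y)) \<le> 1" for x using a0(3) by (simp add: K_def lborel_integral_reflect)
      show "(LBINT x. K (x, y)) \<le> 1" for y
        using lborel_integral_translate[of a "- y"] a0(3) by (simp add: K_def)
    qed (simp add: K_def a0)
    then show ?thesis by (simp add: K_def)
  qed
  show ?thesis
    using asymptotic_entropyD(3)[OF v t1 \<eta>(1), of M] asymptotic_entropyD(3)[OF w t1 \<eta>(1), of M]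
      asymptotic_entropyD(3)[OF w t2 \<eta>(1), of M] asymptotic_entropyD(3)[OF w t3 \<eta>(1), of M]
  proof eventually_elim
    case (elim n)
    note [measurable] = asymptotic_entropyD(1)[OF v, of n] asymptotic_entropyD(1)[OF w, of n] meas\<psi> meas\<omega>
    note vM = asymptotic_entropyD(2)[OF v, of n] and wM = asymptotic_entropyD(2)[OF w, of n]
    have bv: "bounded_fun (v n)" "bounded_fun (w n)" by (rule bounded_funI[OF vM], rule bounded_funI[OF wM])
    define \<beta> where "\<beta> z = - (\<psi>t z + \<alpha> * \<bar>\<psi>x z\<bar>)" for z
    have [measurable]: "\<beta> \<in> borel_measurable borel" unfolding \<beta>_def by measurable
    have b\<beta>: "bounded_fun \<beta>" unfolding \<beta>_def by (intro bdd b\<psi>)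
    have \<beta>': "0 \<le> snd z \<Longrightarrow> 0 \<le> \<beta> z" "norm z > R \<Longrightarrow> \<beta> z = 0" for z
      unfolding \<beta>_def using \<beta>0 \<psi>(3) by auto
    define J where "J u = (LBINT z1. (LBINT z2. (half z1 * half z2 * \<bar>u z1 - w n z2\<bar> * \<beta> z1 * \<omega> (z1 - z2))))"
      for u :: "real \<times> real \<Rightarrow> real"
    define I0 where "I0 = (LBINT z2. (LBINT x. (half z2 * \<bar>u0 x - w n z2\<bar> * \<psi> (x, 0) * \<omega> ((x, 0) - z2))))"
    \<comment> \<open>The first function is kept general: the estimate is used for
      \<open>v n\<close> and for \<open>w n\<close>, with the same initial term I0.\<close>
    have J: "J u \<le> I0 + 2 * \<eta> * A"
      if [measurable]: "u \<in> borel_measurable borel" and uM: "\<And>z. \<bar>u z\<bar> \<le> M"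
        and el: "\<forall>k. \<bar>k\<bar> \<le> M \<longrightarrow> (\<forall>(\<phi>, \<phi>x, \<phi>t)\<in>\<Phi>1. - \<eta> \<le> entropy_functional f u0 u k \<phi> \<phi>x \<phi>t)" for u
      unfolding J_def I0_def \<beta>_def A_def
    proof (rule doubling_of_variables[where \<omega>x = \<omega>x and \<omega>t = \<omega>t])
      show "bounded_fun u" using uM by (rule bounded_funI)
      show "- \<eta> \<le> entropy_functional f u0 u (w n z2) (\<lambda>z1. \<psi> z1 * \<omega> (z1 - z2))
        (\<lambda>z1. \<psi>x z1 * \<omega> (z1 - z2) + \<psi> z1 * \<omega>x (z1 - z2))
        (\<lambda>z1. \<psi>t z1 * \<omega> (z1 - z2) + \<psi> z1 * \<omega>t (z1 - z2))" for z2
        using el[rule_format, OF wM[of z2]] unfolding \<Phi>1_def by blast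
      show "- \<eta> \<le> entropy_functional f u0 (w n) (u z1) (\<lambda>z2. \<omega> (z1 - z2))
        (\<lambda>z2. - \<omega>x (z1 - z2)) (\<lambda>z2. - \<omega>t (z1 - z2))" if "norm z1 \<le> R" for z1
        using elim(3)[rule_format, OF uM[of z1]] that unfolding \<Phi>2_def by blast
    qed (use bu bv b\<psi> b\<omega> \<psi> \<omega>s \<omega>0 \<eta> in auto)
    have I0: "I0 \<le> C * (2 * R * (\<eta> + \<alpha> * (2 * M) * A' * (2 * s)) + m)"
    proof -
      have "I0 = (LBINT z2. (LBINT x. (half z2 * \<bar>u0 x - w n z2\<bar> * \<psi> (x, 0) * (a (x - fst z2) * b (- snd z2)))))"
        by (simp add: I0_def \<omega>_def)
      also have "\<dots> \<le> C * (2 * R * (\<eta> + \<alpha> * (2 * M) * A' * (2 * s))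
        + (LBINT x. indicator {-R..R} x * (LBINT y. (\<bar>u0 y - u0 x\<bar> * a (x - y)))))"
      proof (rule initial_layer[where \<theta> = \<theta> and \<theta>' = \<theta>' and a' = a'])
        fix x :: real assume x: "\<bar>x\<bar> \<le> R"
        then have "norm (x, 0::real) \<le> R" by (simp add: norm_Pair)
        then have "- \<eta> \<le> entropy_functional f u0 (w n) (u0 x) (\<lambda>z. \<Theta> ((x, 0) - z)) (\<lambda>z. - \<Theta>x ((x, 0) - z)) (\<lambda>z. - \<Theta>t ((x, 0) - z))"
          using elim(4)[rule_format, OF M[of x]] unfolding \<Phi>3_def by blast
        then show "- \<eta> \<le> entropy_functional f u0 (w n) (u0 x) (\<lambda>z. a (x - fst z) * \<theta> (snd z))
            (\<lambda>z. - a' (x - fst z) * \<theta> (snd z)) (\<lambda>z. a (x - fst z) * \<theta>' (snd z))"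
          by (simp add: \<Theta>_def \<Theta>x_def \<Theta>t_def)
      next
        show "b (- t) \<le> C * - \<theta>' t" "\<theta>' t \<le> 0" if "0 \<le> t" for t using \<theta>s(3)[OF that] by auto
      next
        fix y :: real assume "1 < \<bar>y\<bar>"
        then show "a y = 0" "a' y = 0" using a0(2)[of y] \<epsilon> by auto
      qed (use wM M ba bb a0(1) A' \<theta>s(1,2) bs(1) C0 \<psi> s \<eta> R in auto)
      also have "\<dots> \<le> C * (2 * R * (\<eta> + \<alpha> * (2 * M) * A' * (2 * s)) + m)"
        using kernel_a C0 by (intro mult_left_mono) auto
      finally show ?thesis .
    qed
    have "b0 * (LBINT z. (indicator (window \<rho>) z * \<bar>v n z - w n z\<bar>))
      = (LBINT z. b0 * (indicator (window \<rho>) z * \<bar>v n z - w n z\<bar>))" by simp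
    also have "\<dots> \<le> (LBINT z. (half z * \<bar>v n z - w n z\<bar> * \<beta> z))"
    proof (rule integral_mono_bounded_support[where R = "2 * \<rho>" and R' = R])
      show "bounded_fun (\<lambda>z. b0 * (indicator (window \<rho>) z * \<bar>v n z - w n z\<bar>))"
        "bounded_fun (\<lambda>z. half z * \<bar>v n z - w n z\<bar> * \<beta> z)" by (intro bdd bv b\<beta>)+
      have [measurable]: "window \<rho> \<in> sets (borel :: (real \<times> real) measure)"
        by (intro borel_closed closed_Times) auto
      show "(\<lambda>z. b0 * (indicator (window \<rho>) z * \<bar>v n z - w n z\<bar>)) \<in> borel_measurable borel"
        by measurable
      fix z :: "real \<times> real"
      show "b0 * (indicator (window \<rho>) z * \<bar>v n z - w n z\<bar>) = 0" if "2 * \<rho> < norm z"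
      proof -
        have "\<bar>fst z\<bar> + \<bar>snd z\<bar> > 2 * \<rho>" using that norm_Pair_le[of "fst z" "snd z"] by simp
        then have "z \<notin> window \<rho>" by (auto simp: mem_Times_iff)
        then show ?thesis by simp
      qed
      show "half z * \<bar>v n z - w n z\<bar> * \<beta> z = 0" if "R < norm z" using \<psi>(3)[OF that] by (simp add: \<beta>_def)
      show "b0 * (indicator (window \<rho>) z * \<bar>v n z - w n z\<bar>) \<le> half z * \<bar>v n z - w n z\<bar> * \<beta> z"
      proof (cases "z \<in> window \<rho>")
        case True
        then have "half z = 1" by (auto simp: half_cases)
        moreover have "\<bar>v n z - w n z\<bar> * b0 \<le> \<bar>v n z - w n z\<bar> * \<beta> z"
          using \<beta>1[OF True] by (intro mult_left_mono) (auto simp: \<beta>_def)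
        ultimately show ?thesis using True by (simp add: mult.commute[of b0])
      next
        case False
        then show ?thesis using \<beta>0[of z] by (auto simp: half_cases \<beta>_def)
      qed
    qed measurable
    also have "\<dots> \<le> J (v n) + J (w n)"
      unfolding J_def
      by (rule integral_le_mollified_differences[where R = R])
        (use bv b\<beta> b\<omega> \<beta>' \<omega>0 \<omega>s \<omega>1 in auto)
    also have "\<dots> \<le> 2 * (I0 + 2 * \<eta> * A)"
      using J[OF _ vM elim(1)] J[OF _ wM elim(2)] by simp
    also have "\<dots> \<le> 2 * (C * (2 * R * (\<eta> + \<alpha> * (2 * M) * A' * (2 * s)) + m) + 2 * \<eta> * A)"
      using I0 by simp
    also have "\<dots> = 2 * (c * \<eta> + C * (2 * R * (\<alpha> * (2 * M) * A' * 2)) * s + C * m)"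
      by (simp add: c_def algebra_simps)
    also have "\<dots> \<le> b0 * e"
    proof -
      have "2 * (x + y + z) \<le> d" if "x \<le> d / 8" "y \<le> d / 8" "z \<le> d / 8" "0 < d" for x y z d :: real
        using that by simp
      from this[OF \<eta>(2) s(3) m(2) mult_pos_pos[OF b0 \<open>0 < e\<close>]] show ?thesis .
    qed
    finally show ?case using b0 by simp
  qed
qed

end

section \<open>Entropy solutions as limits\<close>

lemma partial_derivatives_zero:
  fixes \<phi> \<phi>x \<phi>t :: "real \<times> real \<Rightarrow> real"
  assumes d: "(\<phi> has_derivative (\<lambda>h. \<phi>x z * fst h + \<phi>t z * snd h)) (at z)"
    and S: "open S" "z \<in> S" "\<And>z. z \<in> S \<Longrightarrow> \<phi> z = 0"
  shows "\<phi>x z = 0" "\<phi>t z = 0"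
proof -
  have "((\<lambda>z. 0) has_derivative (\<lambda>h. \<phi>x z * fst h + \<phi>t z * snd h)) (at z)"
    by (rule has_derivative_transform_within_open[OF d S(1,2)]) (rule S(3))
  then have e: "(\<lambda>h. \<phi>x z * fst h + \<phi>t z * snd h) = (\<lambda>h. 0)"
    by (rule has_derivative_unique) (rule has_derivative_const)
  show "\<phi>x z = 0" using fun_cong[OF e, of "(1, 0)"] by simp
  show "\<phi>t z = 0" using fun_cong[OF e, of "(0, 1)"] by simp
qed

lemma uniformly_continuous_compact_support:
  fixes g :: "real \<times> real \<Rightarrow> real"
  assumes "continuous_on UNIV g" "\<And>z. norm z > R \<Longrightarrow> g z = 0"
  shows "\<exists>L. \<forall>z. \<bar>g z\<bar> \<le> L" "\<forall>d>0. \<exists>r>0. \<forall>z z'. dist z z' < r \<longrightarrow> \<bar>g z - g z'\<bar> \<le> d"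
proof -
  have "compact (g ` cball 0 R)" using assms(1) by (intro compact_continuous_image continuous_on_subset[OF assms(1)]) auto
  then have "bounded (g ` cball 0 R)" by (rule compact_imp_bounded)
  then obtain L where "\<forall>y \<in> g ` cball 0 R. norm y \<le> L" unfolding bounded_iff by blast
  then have L: "\<bar>g z\<bar> \<le> L" if "z \<in> cball 0 R" for z using that by simp
  have "\<bar>g z\<bar> \<le> max L 0" for z
    using L[of z] assms(2)[of z] by (cases "norm z \<le> R") auto
  then show "\<exists>L. \<forall>z. \<bar>g z\<bar> \<le> L" by blast
  \<comment> \<open>Radius R + 1, so that two points at distance below 1 lie in the ball as soon as
    one of them has norm at most R.\<close>
  have u: "uniformly_continuous_on (cball 0 (R + 1)) g"
    by (intro compact_uniformly_continuous continuous_on_subset[OF assms(1)]) auto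
  show "\<forall>d>0. \<exists>r>0. \<forall>z z'. dist z z' < r \<longrightarrow> \<bar>g z - g z'\<bar> \<le> d"
  proof (intro allI impI)
    fix d :: real assume "0 < d"
    then obtain r where r: "0 < r" "\<And>z z'. z \<in> cball 0 (R + 1) \<Longrightarrow> z' \<in> cball 0 (R + 1) \<Longrightarrow> dist z' z < r \<Longrightarrow> dist (g z') (g z) < d"
      using u unfolding uniformly_continuous_on_def by metis
    show "\<exists>r>0. \<forall>z z'. dist z z' < r \<longrightarrow> \<bar>g z - g z'\<bar> \<le> d"
    proof (rule exI[of _ "min r 1"], intro conjI allI impI)
      show "0 < min r 1" using r by simp
      fix z z' :: "real \<times> real" assume D: "dist z z' < min r 1"
      show "\<bar>g z - g z'\<bar> \<le> d"
      proof (cases "norm z > R \<and> norm z' > R")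
        case True
        then show ?thesis using assms(2) \<open>0 < d\<close> by simp
      next
        case False
        have "norm z \<le> norm z' + dist z z'" "norm z' \<le> norm z + dist z z'"
          using norm_triangle_ineq2[of z z'] norm_triangle_ineq3[of z z'] by (auto simp: dist_norm)
        then have "z \<in> cball 0 (R + 1)" "z' \<in> cball 0 (R + 1)" using False D by auto
        then show ?thesis using r(2)[of z' z] D by (simp add: dist_real_def)
      qed
    qed
  qed
qed

lemma test_function_support:
  assumes "test_function \<phi> \<phi>x \<phi>t"
  obtains R where "\<And>z. norm z > R \<Longrightarrow> \<phi> z = 0 \<and> \<phi>x z = 0 \<and> \<phi>t z = 0"
proof -
  obtain K where K: "compact K" "\<And>z. z \<notin> K \<Longrightarrow> \<phi> z = 0" using assms by (auto simp: test_function_def)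
  obtain R where R: "\<And>z. z \<in> K \<Longrightarrow> norm z \<le> R" using compact_imp_bounded[OF K(1)] by (auto simp: bounded_iff)
  have d: "(\<phi> has_derivative (\<lambda>h. \<phi>x z * fst h + \<phi>t z * snd h)) (at z)" for z
    using assms unfolding test_function_def by blast
  have "\<phi> z = 0 \<and> \<phi>x z = 0 \<and> \<phi>t z = 0" if "norm z > R" for z
  proof -
    have "z \<in> - K" using R[of z] that by auto
    moreover have "open (- K)" using K(1) by (simp add: compact_imp_closed open_Compl)
    moreover have "\<And>y. y \<in> - K \<Longrightarrow> \<phi> y = 0" using K(2) by blast
    ultimately show ?thesis
      using partial_derivatives_zero[where \<phi> = \<phi> and \<phi>x = \<phi>x and \<phi>t = \<phi>t and S = "- K" and z = z, OF d]
      by blast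
  qed
  then show thesis by (rule that)
qed

lemma test_function_continuous:
  assumes "test_function \<phi> \<phi>x \<phi>t"
  shows "continuous_on UNIV \<phi>" "continuous_on UNIV \<phi>x" "continuous_on UNIV \<phi>t"
proof -
  have "(\<phi> has_derivative (\<lambda>h. \<phi>x z * fst h + \<phi>t z * snd h)) (at z)" for z
    using assms unfolding test_function_def by blast
  then show "continuous_on UNIV \<phi>"
    by (intro continuous_at_imp_continuous_on ballI has_derivative_continuous)
qed (use assms in \<open>auto simp: test_function_def\<close>)

lemma test_function_bounded_fun:
  assumes "test_function \<phi> \<phi>x \<phi>t"
  shows "bounded_fun \<phi>" "bounded_fun \<phi>x" "bounded_fun \<phi>t"
proof -
  obtain R where R: "\<And>z. norm z > R \<Longrightarrow> \<phi> z = 0 \<and> \<phi>x z = 0 \<and> \<phi>t z = 0"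
    using test_function_support[OF assms] by blast
  show "bounded_fun \<phi>" "bounded_fun \<phi>x" "bounded_fun \<phi>t"
    using uniformly_continuous_compact_support(1)[of _ R] test_function_continuous[OF assms] R
    unfolding bounded_fun_def by blast+
qed

lemma tame_family_test_function:
  assumes "test_function \<phi> \<phi>x \<phi>t"
  shows "tame_family {(\<phi>, \<phi>x, \<phi>t)}"
proof -
  obtain R where R: "\<And>z. norm z > R \<Longrightarrow> \<phi> z = 0 \<and> \<phi>x z = 0 \<and> \<phi>t z = 0"
    using test_function_support[OF assms] by blast
  obtain L1 L2 L3 where L: "\<And>z. \<bar>\<phi> z\<bar> \<le> L1" "\<And>z. \<bar>\<phi>x z\<bar> \<le> L2" "\<And>z. \<bar>\<phi>t z\<bar> \<le> L3"
    using test_function_bounded_fun[OF assms] unfolding bounded_fun_def by blast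
  have ux: "\<forall>d>0. \<exists>r>0. \<forall>z z'. dist z z' < r \<longrightarrow> \<bar>\<phi>x z - \<phi>x z'\<bar> \<le> d"
    and ut: "\<forall>d>0. \<exists>r>0. \<forall>z z'. dist z z' < r \<longrightarrow> \<bar>\<phi>t z - \<phi>t z'\<bar> \<le> d"
    using uniformly_continuous_compact_support(2)[of _ R] test_function_continuous[OF assms] R by blast+
  show ?thesis unfolding tame_family_def
  proof (rule exI[of _ R], rule exI[of _ "max L1 (max L2 L3)"], intro conjI allI impI)
    show "\<forall>(\<phi>, \<phi>x, \<phi>t)\<in>{(\<phi>, \<phi>x, \<phi>t)}. \<forall>z. 0 \<le> \<phi> z \<and> \<bar>\<phi> z\<bar> \<le> max L1 (max L2 L3) \<and>
         \<bar>\<phi>x z\<bar> \<le> max L1 (max L2 L3) \<and> \<bar>\<phi>t z\<bar> \<le> max L1 (max L2 L3) \<and>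
         (\<phi> has_derivative (\<lambda>h. \<phi>x z * fst h + \<phi>t z * snd h)) (at z) \<and>
         (R < norm z \<longrightarrow> \<phi> z = 0 \<and> \<phi>x z = 0 \<and> \<phi>t z = 0)"
    proof -
      have "\<bar>\<phi> z\<bar> \<le> max L1 (max L2 L3)" "\<bar>\<phi>x z\<bar> \<le> max L1 (max L2 L3)" "\<bar>\<phi>t z\<bar> \<le> max L1 (max L2 L3)" for z
        using L[of z] by linarith+
      moreover have "\<And>z. 0 \<le> \<phi> z" "\<And>z. (\<phi> has_derivative (\<lambda>h. \<phi>x z * fst h + \<phi>t z * snd h)) (at z)"
        using assms unfolding test_function_def by blast+
      ultimately show ?thesis using R by blast
    qed
    fix d :: real assume "0 < d"
    then obtain r1 r2 where "0 < r1" "0 < r2" "\<And>z z'. dist z z' < r1 \<Longrightarrow> \<bar>\<phi>x z - \<phi>x z'\<bar> \<le> d"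
      "\<And>z z'. dist z z' < r2 \<Longrightarrow> \<bar>\<phi>t z - \<phi>t z'\<bar> \<le> d" using ux ut by metis
    then show "\<exists>r>0. \<forall>(\<phi>, \<phi>x, \<phi>t)\<in>{(\<phi>, \<phi>x, \<phi>t)}. \<forall>z z'. dist z z' < r \<longrightarrow>
             \<bar>\<phi>x z - \<phi>x z'\<bar> \<le> d \<and> \<bar>\<phi>t z - \<phi>t z'\<bar> \<le> d"
      by (intro exI[of _ "min r1 r2"]) auto
  qed
qed

lemma tame_family_imp_test_function:
  assumes "tame_family \<Phi>" "(\<phi>, \<phi>x, \<phi>t) \<in> \<Phi>"
  shows "test_function \<phi> \<phi>x \<phi>t"
proof -
  obtain R L where R: "\<forall>(\<phi>, \<phi>x, \<phi>t) \<in> \<Phi>. \<forall>z.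
        0 \<le> \<phi> z \<and> \<bar>\<phi> z\<bar> \<le> L \<and> \<bar>\<phi>x z\<bar> \<le> L \<and> \<bar>\<phi>t z\<bar> \<le> L \<and>
        (\<phi> has_derivative (\<lambda>h. \<phi>x z * fst h + \<phi>t z * snd h)) (at z) \<and>
        (norm z > R \<longrightarrow> \<phi> z = 0 \<and> \<phi>x z = 0 \<and> \<phi>t z = 0)"
    and U: "\<forall>d>0. \<exists>r>0. \<forall>(\<phi>, \<phi>x, \<phi>t) \<in> \<Phi>. \<forall>z z'. dist z z' < r \<longrightarrow>
          \<bar>\<phi>x z - \<phi>x z'\<bar> \<le> d \<and> \<bar>\<phi>t z - \<phi>t z'\<bar> \<le> d"
    using assms(1) unfolding tame_family_def by blast
  have "\<exists>r>0. \<forall>z'. dist z' z < r \<longrightarrow> dist (\<phi>x z') (\<phi>x z) < d \<and> dist (\<phi>t z') (\<phi>t z) < d" if "0 < d" for z d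
  proof -
    have "0 < d / 2" using that by simp
    from U[THEN spec, THEN mp, OF this]
    obtain r where "0 < r" and r: "\<forall>(\<phi>, \<phi>x, \<phi>t) \<in> \<Phi>. \<forall>z z'. dist z z' < r \<longrightarrow>
          \<bar>\<phi>x z - \<phi>x z'\<bar> \<le> d / 2 \<and> \<bar>\<phi>t z - \<phi>t z'\<bar> \<le> d / 2" by blast
    have "\<bar>\<phi>x z' - \<phi>x z\<bar> \<le> d / 2 \<and> \<bar>\<phi>t z' - \<phi>t z\<bar> \<le> d / 2" if "dist z' z < r" for z'
      using r assms(2) that by fast
    then show ?thesis using that \<open>0 < r\<close> by (intro exI[of _ r]) (fastforce simp: dist_real_def)
  qed
  note near = this
  have "continuous_on UNIV \<phi>x" unfolding continuous_on_iff
  proof (intro ballI allI impI)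
    fix z and d :: real assume "0 < d"
    then obtain r where "0 < r" "\<forall>z'. dist z' z < r \<longrightarrow> dist (\<phi>x z') (\<phi>x z) < d" using near[OF \<open>0 < d\<close>, of z] by blast
    then show "\<exists>r>0. \<forall>z'\<in>UNIV. dist z' z < r \<longrightarrow> dist (\<phi>x z') (\<phi>x z) < d" by blast
  qed
  moreover have "continuous_on UNIV \<phi>t" unfolding continuous_on_iff
  proof (intro ballI allI impI)
    fix z and d :: real assume "0 < d"
    then obtain r where "0 < r" "\<forall>z'. dist z' z < r \<longrightarrow> dist (\<phi>t z') (\<phi>t z) < d" using near[OF \<open>0 < d\<close>, of z] by blast
    then show "\<exists>r>0. \<forall>z'\<in>UNIV. dist z' z < r \<longrightarrow> dist (\<phi>t z') (\<phi>t z) < d" by blast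
  qed
  moreover have "compact (cball (0 :: real \<times> real) R)" by simp
  moreover have "\<And>z. z \<notin> cball 0 R \<Longrightarrow> \<phi> z = 0" using R assms(2) by fastforce
  moreover have "\<And>z. 0 \<le> \<phi> z" "\<And>z. (\<phi> has_derivative (\<lambda>h. \<phi>x z * fst h + \<phi>t z * snd h)) (at z)"
    using R assms(2) by fast+
  ultimately show ?thesis unfolding test_function_def by blast
qed

text \<open>Turns bounds that hold almost everywhere, or on bounded time spans only, into the bound
  at every point required by \<open>asymptotic_entropy\<close>; values that already obey it do not
  change.\<close>

definition clamp_to :: "real \<Rightarrow> real \<Rightarrow> real" where
  "clamp_to M x = max (- M) (min M x)"

lemma clamp_to_measurable [measurable]: "clamp_to M \<in> borel_measurable borel"
  unfolding clamp_to_def[abs_def] by measurable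

lemma abs_clamp_to: "0 \<le> M \<Longrightarrow> \<bar>clamp_to M x\<bar> \<le> M"
  by (auto simp: clamp_to_def)

lemma clamp_to_id: "\<bar>x\<bar> \<le> M \<Longrightarrow> clamp_to M x = x"
  by (auto simp: clamp_to_def)

context lipschitz_flux
begin

text \<open>The sign jumps only where the flux difference vanishes. If k lies between a and b, the
  two Kruzkov fluxes are bounded by \<alpha> times the distances of a and of b to k, and these
  distances add up to the distance of a and b; so the flux is Lipschitz in a.\<close>

lemma tendsto_kruzkov:
  assumes "(g \<longlongrightarrow> c) F"
  shows "((\<lambda>i. kruzkov (g i) k) \<longlongrightarrow> kruzkov c k) F"
proof -
  have "\<bar>kruzkov a k - kruzkov b k\<bar> \<le> \<alpha> * \<bar>a - b\<bar>" for a b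
  proof -
    have ab: "\<bar>f a - f b\<bar> \<le> \<alpha> * \<bar>a - b\<bar>" by (rule flux_Lipschitz)
    have m: "\<alpha> * \<bar>a - k\<bar> + \<alpha> * \<bar>b - k\<bar> = \<alpha> * \<bar>a - b\<bar>" if "a \<le> k \<and> k \<le> b \<or> b \<le> k \<and> k \<le> a"
      using that by (auto simp: algebra_simps abs_if)
    show ?thesis
    proof (cases "a \<le> k \<and> k \<le> b \<or> b \<le> k \<and> k \<le> a")
      case True
      have "\<bar>kruzkov a k - kruzkov b k\<bar> \<le> \<bar>kruzkov a k\<bar> + \<bar>kruzkov b k\<bar>" by linarith
      also have "\<dots> \<le> \<alpha> * \<bar>a - b\<bar>" using kruzkov_bound[of a k] kruzkov_bound[of b k] m[OF True] by linarith
      finally show ?thesis .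
    next
      case False
      then show ?thesis using ab by (auto simp: kruzkov_def sgn_if)
    qed
  qed
  then have "\<alpha>-lipschitz_on UNIV (\<lambda>a. kruzkov a k)"
    using alpha_pos by (auto simp: lipschitz_on_def dist_real_def)
  then have "continuous_on UNIV (\<lambda>a. kruzkov a k)" by (rule lipschitz_on_continuous_on)
  then have "isCont (\<lambda>a. kruzkov a k) c" by (simp add: continuous_on_eq_continuous_at)
  from isCont_tendsto_compose[OF this assms] show ?thesis .
qed

lemma entropy_functional_cong_AE:
  assumes [measurable]: "v \<in> borel_measurable borel" "v' \<in> borel_measurable borel"
      "u0 \<in> borel_measurable borel" "u0' \<in> borel_measurable borel"
    and "AE z in lborel. z \<in> half_plane \<longrightarrow> v z = v' z" "AE x in lborel. u0 x = u0' x"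
    and \<phi>: "test_function \<phi> \<phi>x \<phi>t"
  shows "entropy_functional f u0 v k \<phi> \<phi>x \<phi>t = entropy_functional f u0' v' k \<phi> \<phi>x \<phi>t"
proof -
  note [measurable] = test_function_continuous[OF \<phi>, THEN borel_measurable_continuous_onI]
  have "(LBINT z. half z * (\<bar>v z - k\<bar> * \<phi>t z + kruzkov (v z) k * \<phi>x z))
    = (LBINT z. half z * (\<bar>v' z - k\<bar> * \<phi>t z + kruzkov (v' z) k * \<phi>x z))"
    using assms(5) by (intro integral_cong_AE) (auto elim!: eventually_mono simp: indicator_def)
  moreover have "(LBINT x. (\<bar>u0 x - k\<bar> * \<phi> (x, 0))) = (LBINT x. (\<bar>u0' x - k\<bar> * \<phi> (x, 0)))"
    using assms(6) by (intro integral_cong_AE) (auto elim!: eventually_mono)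
  ultimately show ?thesis by (simp add: entropy_functional_alt)
qed

lemma entropy_solution_iff:
  "entropy_solution f u0 u \<longleftrightarrow> L_infinity_on half_plane u \<and>
     (\<forall>k \<phi> \<phi>x \<phi>t. test_function \<phi> \<phi>x \<phi>t \<longrightarrow> 0 \<le> entropy_functional f u0 u k \<phi> \<phi>x \<phi>t)"
  by (simp add: entropy_solution_def entropy_functional_def)

lemma asymptotic_entropy_const:
  assumes [measurable]: "u0 \<in> borel_measurable borel" and u: "entropy_solution f u0 u"
    and M: "AE z in lborel. z \<in> half_plane \<longrightarrow> \<bar>u z\<bar> \<le> M" "0 \<le> M"
  shows "asymptotic_entropy u0 M (\<lambda>n z. clamp_to M (u z))"
  unfolding asymptotic_entropy_def
proof (intro conjI allI impI)
  have [measurable]: "u \<in> borel_measurable borel" using u by (auto simp: entropy_solution_def L_infinity_on_def)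
  show "(\<lambda>z. clamp_to M (u z)) \<in> borel_measurable borel" by measurable
  show "\<bar>clamp_to M (u z)\<bar> \<le> M" for z using M(2) by (rule abs_clamp_to)
  fix B e :: real and \<Phi> assume \<Phi>: "tame_family \<Phi>" and "0 < e"
  have "- e \<le> entropy_functional f u0 (\<lambda>z. clamp_to M (u z)) k \<phi> \<phi>x \<phi>t" if "(\<phi>, \<phi>x, \<phi>t) \<in> \<Phi>" for k \<phi> \<phi>x \<phi>t
  proof -
    note t = tame_family_imp_test_function[OF \<Phi> that]
    have "entropy_functional f u0 (\<lambda>z. clamp_to M (u z)) k \<phi> \<phi>x \<phi>t = entropy_functional f u0 u k \<phi> \<phi>x \<phi>t"
      using M(1) by (intro entropy_functional_cong_AE[OF _ _ _ _ _ _ t]) (auto elim!: eventually_mono simp: clamp_to_id)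
    moreover have "0 \<le> entropy_functional f u0 u k \<phi> \<phi>x \<phi>t" using u t unfolding entropy_solution_iff by blast
    ultimately show ?thesis using \<open>0 < e\<close> by linarith
  qed
  then show "\<forall>\<^sub>F n in sequentially. \<forall>k. \<bar>k\<bar> \<le> B \<longrightarrow>
        (\<forall>(\<phi>, \<phi>x, \<phi>t) \<in> \<Phi>. - e \<le> entropy_functional f u0 (\<lambda>z. clamp_to M (u z)) k \<phi> \<phi>x \<phi>t)"
    by (auto intro!: always_eventually)
qed

text \<open>The index map is asked only to tend to infinity, because the index sequences of the
  Cauchy argument are obtained by choice and may fail to increase.\<close>

lemma asymptotic_entropy_subseq:
  assumes "asymptotic_entropy u0 M v" "filterlim r sequentially sequentially"
  shows "asymptotic_entropy u0 M (\<lambda>n. v (r n))"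
proof -
  have "\<forall>\<^sub>F n in sequentially. \<forall>k. \<bar>k\<bar> \<le> B \<longrightarrow>
        (\<forall>(\<phi>, \<phi>x, \<phi>t) \<in> \<Phi>. - e \<le> entropy_functional f u0 (v (r n)) k \<phi> \<phi>x \<phi>t)"
    if "tame_family \<Phi>" "0 < e" for B \<Phi> e
    using asymptotic_entropyD(3)[OF assms(1) that] assms(2) by (rule eventually_compose_filterlim)
  then show ?thesis
    using asymptotic_entropyD(1,2)[OF assms(1)] unfolding asymptotic_entropy_def by simp
qed

text \<open>If this failed, the offending pairs of indices would give two sequences of indices
  tending to infinity, and \<open>stability_eventually\<close>, applied to v along them, would be
  violated.\<close>

lemma asymptotic_entropy_Cauchy:
  assumes "u0 \<in> borel_measurable borel" and "\<And>x. \<bar>u0 x\<bar> \<le> M"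
    and v: "asymptotic_entropy u0 M v" and "0 < \<rho>" "0 < e"
  shows "\<exists>N. \<forall>m\<ge>N. \<forall>n\<ge>N. (LBINT z. (indicator (window \<rho>) z * \<bar>v m z - v n z\<bar>)) \<le> e"
proof (rule ccontr)
  define P where "P m n \<longleftrightarrow> (LBINT z. (indicator (window \<rho>) z * \<bar>v m z - v n z\<bar>)) \<le> e" for m n
  assume "\<not> ?thesis"
  then have "\<forall>N. \<exists>m n. m \<ge> N \<and> n \<ge> N \<and> \<not> P m n"
    unfolding P_def by blast
  then obtain a b where ab: "\<And>N. N \<le> a N" "\<And>N. N \<le> b N" "\<And>N. \<not> P (a N) (b N)" by metis
  have "filterlim a sequentially sequentially" "filterlim b sequentially sequentially"
    using ab(1,2) by (auto intro!: filterlim_at_top_mono[OF filterlim_ident] always_eventually)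
  from stability_eventually[OF assms(1,2) asymptotic_entropy_subseq[OF v this(1)] asymptotic_entropy_subseq[OF v this(2)] assms(4,5)]
  show False using ab(3) unfolding P_def[symmetric] by (auto simp: eventually_sequentially)
qed

text \<open>A positive integrable weight g turns the local Cauchy property in L1 into a global one:
  outside a large window the difference is at most 2 M times a small tail of the integral of g. An
  almost everywhere Cauchy subsequence of the weighted functions can then be divided by g.\<close>

lemma asymptotic_entropy_AE_convergent_subseq:
  assumes "u0 \<in> borel_measurable borel" and "\<And>x. \<bar>u0 x\<bar> \<le> M" and v: "asymptotic_entropy u0 M v"
  shows "\<exists>r. strict_mono r \<and> (AE z in lborel. z \<in> half_plane \<longrightarrow> Cauchy (\<lambda>i. v (r i) z))"
proof -
  have M0: "0 \<le> M" using assms(2)[of 0] by linarith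
  note [measurable] = asymptotic_entropyD(1)[OF v]
  note vM = asymptotic_entropyD(2)[OF v]
  obtain g :: "real \<times> real \<Rightarrow> real" where [measurable]: "g \<in> borel_measurable lborel"
    and g: "\<And>z. 0 < g z" "\<And>z. g z \<le> 1" "integrable lborel g"
    using sigma_finite_measure.obtain_positive_integrable_function[OF lborel.sigma_finite_measure_axioms] by blast
  define K where "K \<rho> = {-\<rho>..\<rho>} \<times> {0..\<rho>::real}" for \<rho> :: real
  have [measurable]: "K \<rho> \<in> sets borel" for \<rho> unfolding K_def by (intro borel_closed closed_Times) auto
  define s where "s n z = half z * v n z * g z" for n z
  have int: "integrable lborel (\<lambda>z. h z * g z)" if [measurable]: "h \<in> borel_measurable borel" and h: "\<And>z. \<bar>h z\<bar> \<le> C" for h C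
  proof (rule Bochner_Integration.integrable_bound)
    show "integrable lborel (\<lambda>z. C * g z)" using g(3) by simp
    show "AE z in lborel. norm (h z * g z) \<le> norm (C * g z)"
      using h g(1) by (intro AE_I2) (auto simp: abs_mult intro!: mult_right_mono intro: order_trans[OF _ abs_ge_self])
  qed measurable
  have si: "integrable lborel (s n)" for n
    unfolding s_def by (rule int[where C = M]) (use vM M0 in \<open>auto simp: half_cases\<close>)
  have tail: "\<exists>\<rho>>0. (LBINT z. half z * indicator (- K \<rho>) z * g z) < d" if "0 < d" for d
  proof -
    have "(\<lambda>n. \<integral>z. half z * indicator (- K (real n + 1)) z * g z \<partial>lborel) \<longlonglongrightarrow> (\<integral>z. 0 \<partial>(lborel :: (real \<times> real) measure))"
    proof (rule integral_dominated_convergence[where w = g])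
      show "AE z in lborel. (\<lambda>n. half z * indicator (- K (real n + 1)) z * g z) \<longlonglongrightarrow> 0"
      proof (rule AE_I2)
        fix z :: "real \<times> real"
        have "half z * indicator (- K (real n + 1)) z * g z = 0" if "nat \<lceil>norm z\<rceil> \<le> n" for n
        proof -
          have "norm z \<le> real n" using that by linarith
          then have "\<bar>fst z\<bar> \<le> n" "\<bar>snd z\<bar> \<le> n" using norm_fst_le[of "fst z" "snd z"] norm_snd_le[of "snd z" "fst z"] by auto
          then show ?thesis by (auto simp: half_cases K_def mem_Times_iff abs_le_iff)
        qed
        then show "(\<lambda>n. half z * indicator (- K (real n + 1)) z * g z) \<longlonglongrightarrow> 0"
          by (intro tendsto_eventually eventually_sequentiallyI[of "nat \<lceil>norm z\<rceil>"])
      qed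
      show "AE z in lborel. norm (half z * indicator (- K (real n + 1)) z * g z) \<le> g z" for n
        using g(1) by (intro AE_I2) (auto simp: indicator_def less_imp_le)
    qed (use g(3) in auto)
    then have "(\<lambda>n. \<integral>z. half z * indicator (- K (real n + 1)) z * g z \<partial>lborel) \<longlonglongrightarrow> 0" by simp
    from order_tendstoD(2)[OF this \<open>0 < d\<close>]
    obtain n where "(LBINT z. half z * indicator (- K (real n + 1)) z * g z) < d"
      by (auto simp: eventually_sequentially)
    then show ?thesis by (intro exI[of _ "real n + 1"]) auto
  qed
  have "\<exists>N. \<forall>i\<ge>N. \<forall>j\<ge>N. (LINT z|lborel. norm (s i z - s j z)) < e" if "0 < e" for e
  proof -
    \<comment> \<open>Multiplied by 2 M this tail is at most e/2; M + 1 keeps the denominator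
      positive when M = 0.\<close>
    have "0 < e / (4 * (M + 1))" using that M0 by simp
    then obtain \<rho> where \<rho>: "0 < \<rho>" "(LBINT z. half z * indicator (- K \<rho>) z * g z) < e / (4 * (M + 1))"
      using tail by blast
    obtain N where N: "\<And>m n. N \<le> m \<Longrightarrow> N \<le> n \<Longrightarrow> (LBINT z. (indicator (K \<rho>) z * \<bar>v m z - v n z\<bar>)) \<le> e / 4"
      using asymptotic_entropy_Cauchy[OF assms \<rho>(1), of "e / 4"] \<open>0 < e\<close> unfolding K_def by auto
    have "(LINT z|lborel. norm (s i z - s j z)) < e" if "N \<le> i" "N \<le> j" for i j
    proof -
      have d2: "\<bar>v i z - v j z\<bar> \<le> 2 * M" for z using vM[of i z] vM[of j z] by linarith
      have Ks: "z \<notin> K \<rho>" if "norm z > 2 * \<rho>" for z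
      proof -
        have "\<bar>fst z\<bar> + \<bar>snd z\<bar> > 2 * \<rho>" using that norm_Pair_le[of "fst z" "snd z"] by simp
        then show ?thesis by (auto simp: K_def mem_Times_iff)
      qed
      have i1: "integrable lborel (\<lambda>z. indicator (K \<rho>) z * \<bar>v i z - v j z\<bar>)"
        using d2 M0 Ks by (intro integrable_bounded_support[where C = "2 * M" and R = "2 * \<rho>"]) (auto simp: indicator_def)
      have i2: "integrable lborel (\<lambda>z. half z * indicator (- K \<rho>) z * g z)"
        by (rule int[where C = 1]) (auto simp: indicator_def)
      have "(LINT z|lborel. norm (s i z - s j z)) \<le>
        (LBINT z. (indicator (K \<rho>) z * \<bar>v i z - v j z\<bar> + 2 * M * (half z * indicator (- K \<rho>) z * g z)))"
      proof (rule Bochner_Integration.integral_mono)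
        show "integrable lborel (\<lambda>z. norm (s i z - s j z))"
          by (intro integrable_norm Bochner_Integration.integrable_diff si)
        show "integrable lborel (\<lambda>z. indicator (K \<rho>) z * \<bar>v i z - v j z\<bar> + 2 * M * (half z * indicator (- K \<rho>) z * g z))"
          using i1 i2 by (intro Bochner_Integration.integrable_add integrable_mult_right)
        fix z
        have "norm (s i z - s j z) = half z * \<bar>v i z - v j z\<bar> * g z"
          using g(1)[of z] by (simp add: s_def abs_mult left_diff_distrib[symmetric] right_diff_distrib[symmetric])
        also have "\<dots> \<le> indicator (K \<rho>) z * \<bar>v i z - v j z\<bar> + 2 * M * (half z * indicator (- K \<rho>) z * g z)"
        proof (cases "z \<in> K \<rho>")
          case True
          then have "half z = 1" by (auto simp: K_def half_cases)
          then show ?thesis using True g(2)[of z] mult_left_mono[of "g z" 1 "\<bar>v i z - v j z\<bar>"] by simp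
        next
          case False
          have "\<bar>v i z - v j z\<bar> * (half z * g z) \<le> 2 * M * (half z * g z)"
            using d2[of z] g(1)[of z] by (intro mult_right_mono) auto
          then show ?thesis using False by (simp add: mult_ac)
        qed
        finally show "norm (s i z - s j z) \<le> indicator (K \<rho>) z * \<bar>v i z - v j z\<bar> + 2 * M * (half z * indicator (- K \<rho>) z * g z)" .
      qed
      also have "\<dots> = (LBINT z. (indicator (K \<rho>) z * \<bar>v i z - v j z\<bar>)) + 2 * M * (LBINT z. half z * indicator (- K \<rho>) z * g z)"
        using i1 i2 by simp
      also have "\<dots> \<le> e / 4 + 2 * M * (e / (4 * (M + 1)))"
        using N[OF that] \<rho>(2) M0 by (intro add_mono mult_left_mono) auto
      also have "\<dots> \<le> e / 4 + e / 2" using M0 \<open>0 < e\<close> by (simp add: field_simps)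
      also have "\<dots> < e" using \<open>0 < e\<close> by simp
      finally show ?thesis .
    qed
    then show ?thesis by blast
  qed
  from cauchy_L1_AE_cauchy_subseq[OF si this]
  obtain r where r: "strict_mono r" "AE z in lborel. Cauchy (\<lambda>i. s (r i) z)" by blast
  have "Cauchy (\<lambda>i. v (r i) z)" if C: "Cauchy (\<lambda>i. s (r i) z)" and z: "z \<in> half_plane" for z
  proof -
    have "v (r i) z = s (r i) z / g z" for i using g(1)[of z] z by (simp add: s_def)
    then show ?thesis using C g(1)[of z]
      by (auto simp: Cauchy_convergent_iff intro: convergent_mult_const_right_iff[THEN iffD2] simp: divide_inverse)
  qed
  with r show ?thesis by (auto elim!: eventually_mono)
qed

text \<open>Along an almost everywhere convergent subsequence, dominated convergence carries each
  entropy functional to the limit, and the defects disappear because a single test function is a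
  tame family.\<close>

lemma asymptotic_entropy_limit:
  assumes [measurable]: "u0 \<in> borel_measurable borel" and M: "\<And>x. \<bar>u0 x\<bar> \<le> M" and v: "asymptotic_entropy u0 M v"
  shows "\<exists>u. entropy_solution f u0 u \<and> (\<forall>z. \<bar>u z\<bar> \<le> M)"
proof -
  have M0: "0 \<le> M" using M[of 0] by linarith
  obtain r where r: "strict_mono r" and C: "AE z in lborel. z \<in> half_plane \<longrightarrow> Cauchy (\<lambda>i. v (r i) z)"
    using asymptotic_entropy_AE_convergent_subseq[OF assms] by blast
  define w where "w i = v (r i)" for i
  have w: "asymptotic_entropy u0 M w"
    unfolding w_def using v filterlim_subseq[OF r] by (rule asymptotic_entropy_subseq)
  note [measurable] = asymptotic_entropyD(1)[OF w]
  note wM = asymptotic_entropyD(2)[OF w]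
  \<comment> \<open>Where the sequence diverges \<open>lim\<close> is an arbitrary value, which
    clamping bounds; a genuine limit already lies in [-M, M] and is left unchanged.\<close>
  define u where "u z = clamp_to M (lim (\<lambda>i. w i z))" for z
  have [measurable]: "u \<in> borel_measurable borel" unfolding u_def by measurable
  have uM: "\<bar>u z\<bar> \<le> M" for z unfolding u_def using M0 by (rule abs_clamp_to)
  have lim: "AE z in lborel. z \<in> half_plane \<longrightarrow> (\<lambda>i. w i z) \<longlonglongrightarrow> u z"
    using C
  proof (rule eventually_mono, intro impI)
    fix z assume "z \<in> half_plane \<longrightarrow> Cauchy (\<lambda>i. v (r i) z)" "z \<in> half_plane"
    then have L: "(\<lambda>i. w i z) \<longlonglongrightarrow> lim (\<lambda>i. w i z)"
      by (simp add: w_def Cauchy_convergent_iff convergent_LIMSEQ_iff)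
    have "(\<lambda>i. clamp_to M (w i z)) \<longlonglongrightarrow> clamp_to M (lim (\<lambda>i. w i z))"
      unfolding clamp_to_def by (intro tendsto_intros L)
    then show "(\<lambda>i. w i z) \<longlonglongrightarrow> u z" using wM by (simp add: clamp_to_id u_def)
  qed
  have "0 \<le> entropy_functional f u0 u k \<phi> \<phi>x \<phi>t" if \<phi>: "test_function \<phi> \<phi>x \<phi>t" for k \<phi> \<phi>x \<phi>t
  proof -
    note [measurable] = test_function_continuous[OF \<phi>, THEN borel_measurable_continuous_onI]
    obtain R where R: "\<And>z. norm z > R \<Longrightarrow> \<phi> z = 0 \<and> \<phi>x z = 0 \<and> \<phi>t z = 0"
      using test_function_support[OF \<phi>] by blast
    define W where "W z = (M + \<bar>k\<bar>) * \<bar>\<phi>t z\<bar> + \<alpha> * (M + \<bar>k\<bar>) * \<bar>\<phi>x z\<bar>" for z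
    have b: "bounded_fun W" unfolding W_def by (intro bdd test_function_bounded_fun[OF \<phi>])
    have Wi: "integrable lborel W"
    proof (rule integrable_bounded_fun_support[where R = R])
      show "W \<in> borel_measurable borel" unfolding W_def by measurable
    qed (use b R in \<open>auto simp: W_def\<close>)
    have "(\<lambda>i. \<integral>z. half z * (\<bar>w i z - k\<bar> * \<phi>t z + kruzkov (w i z) k * \<phi>x z) \<partial>lborel)
      \<longlonglongrightarrow> (LBINT z. half z * (\<bar>u z - k\<bar> * \<phi>t z + kruzkov (u z) k * \<phi>x z))"
    proof (rule integral_dominated_convergence[where w = W])
      show "AE z in lborel. (\<lambda>i. half z * (\<bar>w i z - k\<bar> * \<phi>t z + kruzkov (w i z) k * \<phi>x z))
        \<longlonglongrightarrow> half z * (\<bar>u z - k\<bar> * \<phi>t z + kruzkov (u z) k * \<phi>x z)"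
        using lim
      proof eventually_elim
        case (elim z)
        show ?case
        proof (cases "z \<in> half_plane")
          case True
          then have L: "(\<lambda>i. w i z) \<longlonglongrightarrow> u z" using elim by simp
          show ?thesis by (intro tendsto_intros L tendsto_kruzkov)
        qed simp
      qed
      show "AE z in lborel. norm (half z * (\<bar>w i z - k\<bar> * \<phi>t z + kruzkov (w i z) k * \<phi>x z)) \<le> W z" for i
      proof (rule AE_I2)
        fix z
        have a: "\<bar>w i z - k\<bar> \<le> M + \<bar>k\<bar>" using wM[of i z] by linarith
        then have "\<bar>kruzkov (w i z) k\<bar> \<le> \<alpha> * (M + \<bar>k\<bar>)"
          using kruzkov_bound[of "w i z" k] mult_left_mono[OF a, of \<alpha>] alpha_pos by linarith
        with a have "\<bar>w i z - k\<bar> * \<bar>\<phi>t z\<bar> + \<bar>kruzkov (w i z) k\<bar> * \<bar>\<phi>x z\<bar> \<le> W z"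
          unfolding W_def by (intro add_mono mult_right_mono) auto
        moreover have "\<bar>\<bar>w i z - k\<bar> * \<phi>t z + kruzkov (w i z) k * \<phi>x z\<bar> \<le> \<bar>w i z - k\<bar> * \<bar>\<phi>t z\<bar> + \<bar>kruzkov (w i z) k\<bar> * \<bar>\<phi>x z\<bar>"
          using abs_triangle_ineq[of "\<bar>w i z - k\<bar> * \<phi>t z" "kruzkov (w i z) k * \<phi>x z"] by (simp add: abs_mult)
        moreover have "0 \<le> W z" using M0 alpha_pos by (simp add: W_def)
        ultimately show "norm (half z * (\<bar>w i z - k\<bar> * \<phi>t z + kruzkov (w i z) k * \<phi>x z)) \<le> W z"
          by (auto simp: half_cases)
      qed
    qed (use Wi in measurable)
    then have T: "(\<lambda>i. entropy_functional f u0 (w i) k \<phi> \<phi>x \<phi>t) \<longlonglongrightarrow> entropy_functional f u0 u k \<phi> \<phi>x \<phi>t"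
      unfolding entropy_functional_alt by (intro tendsto_intros)
    have "- e \<le> entropy_functional f u0 u k \<phi> \<phi>x \<phi>t" if "0 < e" for e
    proof (rule tendsto_lowerbound[OF T])
      show "\<forall>\<^sub>F i in sequentially. - e \<le> entropy_functional f u0 (w i) k \<phi> \<phi>x \<phi>t"
        using asymptotic_entropyD(3)[OF w tame_family_test_function[OF \<phi>] that, of "\<bar>k\<bar>"]
        by eventually_elim auto
    qed simp
    then have "- entropy_functional f u0 u k \<phi> \<phi>x \<phi>t \<le> 0 + e" if "0 < e" for e using that by fastforce
    then show ?thesis using field_le_epsilon[of "- entropy_functional f u0 u k \<phi> \<phi>x \<phi>t" 0] by auto
  qed
  then have "entropy_solution f u0 u" using uM unfolding entropy_solution_iff L_infinity_on_def
    by (auto intro!: exI[of _ M] AE_I2)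
  then show ?thesis using uM by blast
qed

text \<open>Intended for w the reconstructions and v their clamped versions: the two agree on every
  window from some index on, hence have the same local limit.\<close>

lemma asymptotic_entropy_tendsto:
  assumes u0: "u0 \<in> borel_measurable borel" "\<And>x. \<bar>u0 x\<bar> \<le> M"
    and v: "asymptotic_entropy u0 M v" and u: "entropy_solution f u0 u" "\<And>z. \<bar>u z\<bar> \<le> M"
    and w: "\<And>\<rho>. \<forall>\<^sub>F k in sequentially. \<forall>z \<in> window \<rho>. w k z = v k z"
  shows "tendsto_L1_loc w u"
  unfolding tendsto_L1_loc_def
proof (intro allI impI)
  fix K :: "(real \<times> real) set" assume K: "compact K \<and> K \<subseteq> half_plane"
  have M0: "0 \<le> M" using u0(2)[of 0] by linarith
  obtain R where R: "\<And>z. z \<in> K \<Longrightarrow> norm z \<le> R" using K compact_imp_bounded[of K] by (auto simp: bounded_iff)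
  define \<rho> where "\<rho> = \<bar>R\<bar> + 1"
  define Q where "Q = window \<rho>"
  have KQ: "K \<subseteq> Q"
  proof
    fix z assume z: "z \<in> K"
    then have "0 \<le> snd z" using K by (auto simp: half_plane_def)
    moreover have "\<bar>fst z\<bar> \<le> \<rho>" "\<bar>snd z\<bar> \<le> \<rho>"
      using R[OF z] norm_fst_le[of "fst z" "snd z"] norm_snd_le[of "snd z" "fst z"] by (auto simp: \<rho>_def)
    ultimately show "z \<in> Q" by (auto simp: Q_def mem_Times_iff abs_le_iff)
  qed
  have [measurable]: "Q \<in> sets borel" unfolding Q_def by (intro borel_closed closed_Times) auto
  have [measurable]: "u \<in> borel_measurable borel" using u(1) by (auto simp: entropy_solution_def L_infinity_on_def)
  note [measurable] = asymptotic_entropyD(1)[OF v]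
  \<comment> \<open>The limit enters as a constant sequence, so that convergence to it is an
    instance of stability.\<close>
  have uc: "asymptotic_entropy u0 M (\<lambda>n. u)"
    using asymptotic_entropy_const[OF u0(1) u(1) _ M0] u(2) by (simp add: clamp_to_id)
  show "(\<lambda>k. \<integral>\<^sup>+z\<in>K. ennreal \<bar>w k z - u z\<bar> \<partial>lborel) \<longlonglongrightarrow> 0"
  proof (rule tendsto_sandwich[where f = "\<lambda>_. 0"])
    show "\<forall>\<^sub>F k in sequentially. (\<integral>\<^sup>+z\<in>K. ennreal \<bar>w k z - u z\<bar> \<partial>lborel) \<le> ennreal (LBINT z. (indicator Q z * \<bar>v k z - u z\<bar>))"
      using w[of \<rho>]
    proof eventually_elim
      case (elim k)
      have "(\<integral>\<^sup>+z\<in>K. ennreal \<bar>w k z - u z\<bar> \<partial>lborel) \<le> (\<integral>\<^sup>+z. ennreal (indicator Q z * \<bar>v k z - u z\<bar>) \<partial>lborel)"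
        using elim KQ by (intro nn_integral_mono) (auto simp: indicator_def Q_def)
      also have "\<dots> = ennreal (LBINT z. (indicator Q z * \<bar>v k z - u z\<bar>))"
      proof (rule nn_integral_eq_integral)
        show "integrable lborel (\<lambda>z. indicator Q z * \<bar>v k z - u z\<bar>)"
        proof (rule integrable_bounded_support[where C = "2 * M" and R = "2 * \<rho>"])
          show "\<bar>indicator Q z * \<bar>v k z - u z\<bar>\<bar> \<le> 2 * M" for z
            using asymptotic_entropyD(2)[OF v, of k z] u(2)[of z] M0 by (auto simp: indicator_def)
          show "indicator Q z * \<bar>v k z - u z\<bar> = 0" if "2 * \<rho> < norm z" for z
          proof -
            have "\<bar>fst z\<bar> + \<bar>snd z\<bar> > 2 * \<rho>" using that norm_Pair_le[of "fst z" "snd z"] by simp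
            then have "z \<notin> Q" by (auto simp: Q_def mem_Times_iff)
            then show ?thesis by simp
          qed
        qed measurable
      qed simp
      finally show ?case .
    qed
    have "(\<lambda>k. \<integral>z. indicator Q z * \<bar>v k z - u z\<bar> \<partial>lborel) \<longlonglongrightarrow> 0"
    proof (rule LIMSEQ_I)
      fix e :: real assume "0 < e"
      have "\<forall>\<^sub>F k in sequentially. (LBINT z. (indicator Q z * \<bar>v k z - u z\<bar>)) \<le> e / 2"
        unfolding Q_def by (rule stability_eventually[OF u0 v uc]) (use \<open>0 < e\<close> in \<open>auto simp: \<rho>_def\<close>)
      then obtain N where N: "\<And>k. N \<le> k \<Longrightarrow> (LBINT z. (indicator Q z * \<bar>v k z - u z\<bar>)) \<le> e / 2"
        by (auto simp: eventually_sequentially)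
      have "norm ((LBINT z. (indicator Q z * \<bar>v k z - u z\<bar>)) - 0) < e" if "N \<le> k" for k
      proof -
        have "0 \<le> (LBINT z. (indicator Q z * \<bar>v k z - u z\<bar>))"
          by (intro Bochner_Integration.integral_nonneg) auto
        then show ?thesis using N[OF that] \<open>0 < e\<close> by simp
      qed
      then show "\<exists>N. \<forall>k\<ge>N. norm ((LBINT z. (indicator Q z * \<bar>v k z - u z\<bar>)) - 0) < e" by blast
    qed
    from tendsto_ennrealI[OF this] show "(\<lambda>k. ennreal (LBINT z. (indicator Q z * \<bar>v k z - u z\<bar>))) \<longlonglongrightarrow> 0"
      by simp
  qed auto
qed

text \<open>Clamped to a common bound, the two solutions are constant sequences to which stability
  applies with every e > 0; so they agree almost everywhere on each window, and countably many
  windows cover the half-plane.\<close>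

lemma entropy_solution_unique:
  assumes u0: "u0 \<in> borel_measurable borel" "\<And>x. \<bar>u0 x\<bar> \<le> M0"
    and u: "entropy_solution f u0 u" and v: "entropy_solution f u0 v"
  shows "AE z in lborel. z \<in> half_plane \<longrightarrow> v z = u z"
proof -
  have [measurable]: "u \<in> borel_measurable borel" "v \<in> borel_measurable borel"
    using u v by (auto simp: entropy_solution_def L_infinity_on_def)
  obtain Mu Mv where Mu: "AE z in lborel. z \<in> half_plane \<longrightarrow> \<bar>u z\<bar> \<le> Mu" and Mv: "AE z in lborel. z \<in> half_plane \<longrightarrow> \<bar>v z\<bar> \<le> Mv"
    using u v by (auto simp: entropy_solution_def L_infinity_on_def)
  define M where "M = max (max 0 M0) (max Mu Mv)"
  have Mu': "AE z in lborel. z \<in> half_plane \<longrightarrow> \<bar>u z\<bar> \<le> M" and Mv': "AE z in lborel. z \<in> half_plane \<longrightarrow> \<bar>v z\<bar> \<le> M"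
  proof -
    show "AE z in lborel. z \<in> half_plane \<longrightarrow> \<bar>u z\<bar> \<le> M" using Mu by eventually_elim (auto simp: M_def le_max_iff_disj)
    show "AE z in lborel. z \<in> half_plane \<longrightarrow> \<bar>v z\<bar> \<le> M" using Mv by eventually_elim (auto simp: M_def le_max_iff_disj)
  qed
  have M: "0 \<le> M" "\<And>x. \<bar>u0 x\<bar> \<le> M" using u0(2) by (auto simp: M_def le_max_iff_disj)
  define U where "U z = clamp_to M (u z)" for z
  define V where "V z = clamp_to M (v z)" for z
  have [measurable]: "U \<in> borel_measurable borel" "V \<in> borel_measurable borel" unfolding U_def V_def by measurable
  have UV: "\<bar>U z\<bar> \<le> M" "\<bar>V z\<bar> \<le> M" for z unfolding U_def V_def using M(1) by (auto intro: abs_clamp_to)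
  have "AE z in lborel. z \<in> window \<rho> \<longrightarrow> V z = U z" if "0 < \<rho>" for \<rho>
  proof -
    define Q where "Q = window \<rho>"
    have [measurable]: "Q \<in> sets borel" unfolding Q_def by (intro borel_closed closed_Times) auto
    have s: "z \<notin> Q" if "2 * \<rho> < norm z" for z
    proof -
      have "\<bar>fst z\<bar> + \<bar>snd z\<bar> > 2 * \<rho>" using that norm_Pair_le[of "fst z" "snd z"] by simp
      then show ?thesis by (auto simp: Q_def mem_Times_iff)
    qed
    have i: "integrable lborel (\<lambda>z. indicator Q z * \<bar>V z - U z\<bar>)"
    proof (rule integrable_bounded_support[where C = "2 * M" and R = "2 * \<rho>"])
      show "\<bar>indicator Q z * \<bar>V z - U z\<bar>\<bar> \<le> 2 * M" for z using UV[of z] M(1) by (auto simp: indicator_def)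
    qed (use s in auto)
    have "(LBINT z. (indicator Q z * \<bar>V z - U z\<bar>)) \<le> 0 + e" if "0 < e" for e
      using stability_eventually[OF u0(1) M(2) asymptotic_entropy_const[OF u0(1) v Mv' M(1)]
          asymptotic_entropy_const[OF u0(1) u Mu' M(1)] \<open>0 < \<rho>\<close> that]
      by (simp add: Q_def U_def V_def)
    then have "(LBINT z. (indicator Q z * \<bar>V z - U z\<bar>)) \<le> 0" by (rule field_le_epsilon)
    moreover have "0 \<le> (LBINT z. (indicator Q z * \<bar>V z - U z\<bar>))" by (intro Bochner_Integration.integral_nonneg) auto
    ultimately have "(LBINT z. (indicator Q z * \<bar>V z - U z\<bar>)) = 0" by linarith
    then have "AE z in lborel. indicator Q z * \<bar>V z - U z\<bar> = 0"
      using integral_nonneg_eq_0_iff_AE[OF i] by simp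
    then show ?thesis by (auto elim!: eventually_mono simp: Q_def)
  qed
  note box = this
  have "\<forall>n. AE z in lborel. z \<in> window (real n + 1) \<longrightarrow> V z = U z"
    by (rule allI, rule box) simp
  then have "AE z in lborel. \<forall>n. z \<in> window (real n + 1) \<longrightarrow> V z = U z"
    unfolding AE_all_countable .
  then show ?thesis using Mu' Mv'
  proof eventually_elim
    case (elim z)
    show ?case
    proof
      assume z: "z \<in> half_plane"
      define n where "n = nat \<lceil>norm z\<rceil>"
      have "norm z \<le> real n" by (simp add: n_def real_nat_ceiling_ge)
      then have "\<bar>fst z\<bar> \<le> n" "\<bar>snd z\<bar> \<le> n" using norm_fst_le[of "fst z" "snd z"] norm_snd_le[of "snd z" "fst z"] by auto
      then have "z \<in> window (real n + 1)"
        using z by (auto simp: half_plane_def mem_Times_iff abs_le_iff)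
      then have "V z = U z" using elim by blast
      then show "v z = u z" using elim z by (simp add: U_def V_def clamp_to_id)
    qed
  qed
qed

end

section \<open>The entropy inequality of the unquantised scheme\<close>

text \<open>\<open>split_bound\<close> is the derivative-free form of fp' - fm' \<le> \<alpha>. It
  yields both the Lipschitz constant \<alpha> of f and, under the CFL condition, the monotonicity of
  the unquantised update.\<close>

locale flux_splitting =
  fixes f fp fm :: "real \<Rightarrow> real" and \<alpha> :: real
  assumes split: "f u = fp u + fm u"
    and fp_mono: "a \<le> b \<Longrightarrow> fp a \<le> fp b"
    and fm_antimono: "a \<le> b \<Longrightarrow> fm b \<le> fm a"
    and split_bound: "a \<le> b \<Longrightarrow> (fp b - fp a) + (fm a - fm b) \<le> \<alpha> * (b - a)"
    and pos: "0 < \<alpha>"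
begin

lemma split_abs_bound: "\<bar>fp a - fp b\<bar> + \<bar>fm a - fm b\<bar> \<le> \<alpha> * \<bar>a - b\<bar>"
proof (cases "a \<le> b")
  case True
  then show ?thesis using fp_mono[OF True] fm_antimono[OF True] split_bound[OF True] by (simp add: abs_minus_commute)
next
  case False
  then have ba: "b \<le> a" by simp
  show ?thesis using fp_mono[OF ba] fm_antimono[OF ba] split_bound[OF ba] ba by simp
qed

sublocale lipschitz_flux f \<alpha>
proof
  show "\<bar>f a - f b\<bar> \<le> \<alpha> * \<bar>a - b\<bar>" for a b using split_abs_bound[of a b] unfolding split by linarith
qed (rule pos)

text \<open>Monotonicity of the two parts absorbs the sign. The entropy flux thereby splits just as
  the numerical flux does, so the discrete entropy inequality produces exactly this flux.\<close>

lemma kruzkov_split: "kruzkov a k = \<bar>fp a - fp k\<bar> - \<bar>fm a - fm k\<bar>"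
proof (cases "a \<le> k")
  case True
  then show ?thesis using fp_mono[OF True] fm_antimono[OF True] by (cases "a = k") (auto simp: kruzkov_def split sgn_if)
next
  case False
  then have ka: "k \<le> a" by simp
  show ?thesis using fp_mono[OF ka] fm_antimono[OF ka] False by (simp add: kruzkov_def split sgn_if)
qed

lemma continuous_split: "continuous_on UNIV fp" "continuous_on UNIV fm"
proof -
  have "\<bar>fp a - fp b\<bar> \<le> \<alpha> * \<bar>a - b\<bar>" "\<bar>fm a - fm b\<bar> \<le> \<alpha> * \<bar>a - b\<bar>" for a b using split_abs_bound[of a b] by linarith+
  then have "\<alpha>-lipschitz_on UNIV fp" "\<alpha>-lipschitz_on UNIV fm"
    using pos by (auto simp: lipschitz_on_def dist_real_def)
  then show "continuous_on UNIV fp" "continuous_on UNIV fm" by (auto intro: lipschitz_on_continuous_on)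
qed

lemma split_measurable [measurable]: "fp \<in> borel_measurable borel" "fm \<in> borel_measurable borel"
  using continuous_split by (auto intro: borel_measurable_continuous_onI)

definition upwind :: "real \<Rightarrow> real \<Rightarrow> real \<Rightarrow> real \<Rightarrow> real" where
  "upwind \<mu> a b c = b - \<mu> * ((fp b + fm c) - (fp a + fm b))"

text \<open>Under the CFL condition the update is nondecreasing in each of its three arguments and
  reproduces constants, so it can be compared with the constants B and - B.\<close>

lemma upwind_bound:
  assumes "0 \<le> \<mu>" "\<mu> * \<alpha> \<le> 1" "\<bar>a\<bar> \<le> B" "\<bar>b\<bar> \<le> B" "\<bar>c\<bar> \<le> B"
  shows "\<bar>upwind \<mu> a b c\<bar> \<le> B"
proof -
  have m: "x - \<mu> * (fp x - fm x) \<le> y - \<mu> * (fp y - fm y)" if "x \<le> y" for x y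
  proof -
    have "\<mu> * ((fp y - fp x) + (fm x - fm y)) \<le> \<mu> * (\<alpha> * (y - x))"
      using split_bound[OF that] assms(1) by (rule mult_left_mono)
    also have "\<dots> \<le> 1 * (y - x)" unfolding mult.assoc[symmetric] using assms(2) that by (intro mult_right_mono) auto
    finally show ?thesis by (simp add: algebra_simps)
  qed
  have e: "upwind \<mu> a b c = b - \<mu> * (fp b - fm b) + \<mu> * fp a - \<mu> * fm c"
    by (simp add: upwind_def algebra_simps)
  have b: "- B \<le> a" "a \<le> B" "- B \<le> b" "b \<le> B" "- B \<le> c" "c \<le> B" using assms by (auto simp: abs_le_iff)
  have "upwind \<mu> a b c \<le> B - \<mu> * (fp B - fm B) + \<mu> * fp B - \<mu> * fm B"
    unfolding e using m[OF b(4)] mult_left_mono[OF fp_mono[OF b(2)] assms(1)] mult_left_mono[OF fm_antimono[OF b(6)] assms(1)]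
    by linarith
  moreover have "- B - \<mu> * (fp (-B) - fm (-B)) + \<mu> * fp (-B) - \<mu> * fm (-B) \<le> upwind \<mu> a b c"
    unfolding e using m[OF b(3)] mult_left_mono[OF fp_mono[OF b(1)] assms(1)] mult_left_mono[OF fm_antimono[OF b(5)] assms(1)]
    by linarith
  ultimately show ?thesis by (simp add: algebra_simps abs_le_iff)
qed

text \<open>X collects the terms that depend on the middle cell. The CFL condition prevents the flux
  terms from reversing the sign of b - k, so the modulus of X is computed exactly; the neighbours
  are added by the triangle inequality.\<close>

lemma upwind_entropy:
  assumes "0 \<le> \<mu>" "\<mu> * \<alpha> \<le> 1"
  shows "\<bar>upwind \<mu> a b c - k\<bar> \<le> \<bar>b - k\<bar> - \<mu> * (\<bar>fp b - fp k\<bar> + \<bar>fm b - fm k\<bar>)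
    + \<mu> * \<bar>fp a - fp k\<bar> + \<mu> * \<bar>fm c - fm k\<bar>"
proof -
  define X where "X = (b - k) - \<mu> * (fp b - fp k) + \<mu> * (fm b - fm k)"
  have "\<mu> * (\<bar>fp b - fp k\<bar> + \<bar>fm b - fm k\<bar>) \<le> \<mu> * (\<alpha> * \<bar>b - k\<bar>)"
    using split_abs_bound assms(1) by (intro mult_left_mono) auto
  also have "\<dots> \<le> 1 * \<bar>b - k\<bar>" unfolding mult.assoc[symmetric] using assms(2) by (intro mult_right_mono) auto
  finally have nn: "\<mu> * (\<bar>fp b - fp k\<bar> + \<bar>fm b - fm k\<bar>) \<le> \<bar>b - k\<bar>" by simp
  have X: "\<bar>X\<bar> = \<bar>b - k\<bar> - \<mu> * (\<bar>fp b - fp k\<bar> + \<bar>fm b - fm k\<bar>)"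
  proof (cases "b \<le> k")
    case True
    then have "\<bar>fp b - fp k\<bar> = fp k - fp b" "\<bar>fm b - fm k\<bar> = fm b - fm k" "\<bar>b - k\<bar> = k - b"
      using fp_mono[OF True] fm_antimono[OF True] by auto
    with nn show ?thesis unfolding X_def by (simp add: algebra_simps)
  next
    case False
    then have kb: "k \<le> b" by simp
    then have "\<bar>fp b - fp k\<bar> = fp b - fp k" "\<bar>fm b - fm k\<bar> = fm k - fm b" "\<bar>b - k\<bar> = b - k"
      using fp_mono[OF kb] fm_antimono[OF kb] by auto
    with nn show ?thesis unfolding X_def by (simp add: algebra_simps)
  qed
  have "upwind \<mu> a b c - k = X + \<mu> * (fp a - fp k) + - (\<mu> * (fm c - fm k))"
    by (simp add: upwind_def X_def algebra_simps)
  then have "\<bar>upwind \<mu> a b c - k\<bar> \<le> \<bar>X\<bar> + \<bar>\<mu> * (fp a - fp k)\<bar> + \<bar>\<mu> * (fm c - fm k)\<bar>" by linarith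
  then show ?thesis unfolding X using assms(1) by (simp add: abs_mult)
qed

end

lemma partial_mean_value:
  fixes \<phi> \<phi>x \<phi>t :: "real \<times> real \<Rightarrow> real"
  assumes d: "\<And>z. (\<phi> has_derivative (\<lambda>h. \<phi>x z * fst h + \<phi>t z * snd h)) (at z)" and "0 < h"
  shows "\<exists>\<xi>. 0 < \<xi> \<and> \<xi> < h \<and> \<phi> (x + h, t) - \<phi> (x, t) = h * \<phi>x (x + \<xi>, t)"
    and "\<exists>\<xi>. 0 < \<xi> \<and> \<xi> < h \<and> \<phi> (x, t + h) - \<phi> (x, t) = h * \<phi>t (x, t + \<xi>)"
proof -
  have "((\<lambda>s. \<phi> (x + s, t)) has_real_derivative \<phi>x (x + s, t)) (at s)" for s
  proof -
    have "((\<lambda>s. \<phi> (x + s, t)) has_derivative (\<lambda>h. \<phi>x (x + s, t) * fst (h, 0::real) + \<phi>t (x + s, t) * snd (h, 0::real))) (at s)"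
      by (rule has_derivative_compose[OF _ d]) (auto intro!: derivative_eq_intros)
    then show ?thesis by (simp add: has_field_derivative_def)
  qed
  from MVT2[OF \<open>0 < h\<close> this] show "\<exists>\<xi>. 0 < \<xi> \<and> \<xi> < h \<and> \<phi> (x + h, t) - \<phi> (x, t) = h * \<phi>x (x + \<xi>, t)"
    by auto
  have "((\<lambda>s. \<phi> (x, t + s)) has_real_derivative \<phi>t (x, t + s)) (at s)" for s
  proof -
    have "((\<lambda>s. \<phi> (x, t + s)) has_derivative (\<lambda>h. \<phi>x (x, t + s) * fst (0::real, h) + \<phi>t (x, t + s) * snd (0::real, h))) (at s)"
      by (rule has_derivative_compose[OF _ d]) (auto intro!: derivative_eq_intros)
    then show ?thesis by (simp add: has_field_derivative_def)
  qed
  from MVT2[OF \<open>0 < h\<close> this] show "\<exists>\<xi>. 0 < \<xi> \<and> \<xi> < h \<and> \<phi> (x, t + h) - \<phi> (x, t) = h * \<phi>t (x, t + \<xi>)"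
    by auto
qed

text \<open>Summation by parts in time leaves a term on the strip 0 \<le> t < dt; divided by dt, it
  approximates the initial term of Kruzkov's inequality. Moving the test function to t = 0 costs at
  most (M + B) L dt over a length 2 R, and replacing v by u0 costs L times their L1
  distance.\<close>

lemma initial_strip_estimate:
  fixes v \<phi> :: "real \<times> real \<Rightarrow> real" and u0 :: "real \<Rightarrow> real"
  assumes meas [measurable]: "v \<in> borel_measurable borel" "u0 \<in> borel_measurable borel" "\<phi> \<in> borel_measurable borel"
    and M: "\<And>z. \<bar>v z\<bar> \<le> M" "\<And>x. \<bar>u0 x\<bar> \<le> M" and "\<bar>k\<bar> \<le> B"
    and \<phi>: "\<And>z. 0 \<le> \<phi> z" "\<And>z. \<phi> z \<le> L" "\<And>z. norm z > R \<Longrightarrow> \<phi> z = 0"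
      "\<And>x t. 0 \<le> t \<Longrightarrow> \<phi> (x, t) - \<phi> (x, 0) \<le> L * t"
    and "0 < dt" "0 \<le> R" "dt \<le> 1"
    and v0: "\<And>x t. 0 \<le> t \<Longrightarrow> t < dt \<Longrightarrow> v (x, t) = v (x, 0)"
  shows "(LBINT z. (indicator (UNIV \<times> {0..<dt}) z * \<bar>v z - k\<bar> * \<phi> z))
    \<le> dt * ((LBINT x. (\<bar>u0 x - k\<bar> * \<phi> (x, 0))) + L * (LBINT x. (indicator {-R..R} x * \<bar>u0 x - v (x, 0)\<bar>))
      + (M + B) * L * dt * (2 * R))"
proof -
  have L0: "0 \<le> L" using \<phi>(1,2) order_trans by blast
  have M0: "0 \<le> M" using M(2)[of 0] by linarith
  have bd: "bounded_fun v" "bounded_fun u0" "bounded_fun \<phi>"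
    using M \<phi>(1,2) by (auto intro: bounded_funI[of _ M] bounded_funI[of _ L])
  note bdds = bdd bd[THEN bounded_fun_compose]
  define G where "G = (\<lambda>z. indicator {0..<dt} (snd z) * \<bar>v z - k\<bar> * \<phi> z)"
  have mG: "G \<in> borel_measurable borel" unfolding G_def by measurable
  have bG: "bounded_fun G" unfolding G_def by (intro bdds bd)
  have sG: "G z = 0" if "norm z > R" for z using \<phi>(3)[OF that] by (simp add: G_def)
  note F = fubini_bounded_fun_support[OF mG bG sG]
  have \<phi>0: "\<phi> (x, t) = 0" if "\<bar>x\<bar> > R" for x t using \<phi>(3)[of "(x, t)"] that norm_fst_le[of x t] by simp
  define J where "J = (LBINT x. (\<bar>u0 x - k\<bar> * \<phi> (x, 0))) + L * (LBINT x. (indicator {-R..R} x * \<bar>u0 x - v (x, 0)\<bar>))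
      + (M + B) * L * dt * (2 * R)"
  have inner: "(LBINT x. G (x, t)) \<le> indicator {0..<dt} t * J" for t
  proof (cases "t \<in> {0..<dt}")
    case False
    then show ?thesis by (simp add: G_def)
  next
    case True
    define a1 where "a1 x = \<bar>u0 x - k\<bar> * \<phi> (x, 0)" for x
    define a2 where "a2 x = indicator {-R..R} x * \<bar>u0 x - v (x, 0)\<bar>" for x
    define a3 where "a3 x = (indicator {-R..R} x :: real)" for x
    have i1: "integrable lborel a1"
    proof (rule integrable_bounded_fun_support[where R = R])
      show "a1 \<in> borel_measurable borel" unfolding a1_def by measurable
      show "bounded_fun a1" unfolding a1_def by (intro bdds bd)
    qed (auto simp: a1_def \<phi>0)
    have i2: "integrable lborel a2"
    proof (rule integrable_bounded_fun_support[where R = R])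
      show "a2 \<in> borel_measurable borel" unfolding a2_def by measurable
      show "bounded_fun a2" unfolding a2_def by (intro bdds bd)
    qed (auto simp: a2_def indicator_def)
    have i3: "integrable lborel a3" unfolding a3_def
      by (intro integrable_real_indicator) (auto simp: emeasure_lborel_Icc_eq)
    have "(LBINT x. G (x, t)) \<le> (LBINT x. (a1 x + L * a2 x + (M + B) * L * dt * a3 x))"
    proof (rule Bochner_Integration.integral_mono)
      show "integrable lborel (\<lambda>x. G (x, t))"
      proof (rule integrable_bounded_fun_support[where R = R])
        show "(\<lambda>x. G (x, t)) \<in> borel_measurable borel" unfolding G_def snd_conv by measurable
        show "bounded_fun (\<lambda>x. G (x, t))" by (rule bounded_fun_compose[OF bG])
      qed (simp add: G_def \<phi>0)
      show "integrable lborel (\<lambda>x. a1 x + L * a2 x + (M + B) * L * dt * a3 x)"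
        using i1 i2 i3 by (intro Bochner_Integration.integrable_add integrable_mult_right)
      fix x
      show "G (x, t) \<le> a1 x + L * a2 x + (M + B) * L * dt * a3 x"
      proof (cases "\<bar>x\<bar> \<le> R")
        case False
        then show ?thesis by (auto simp: G_def a1_def a2_def a3_def \<phi>0 indicator_def)
      next
        case xR: True
        have vk: "\<bar>v (x, 0) - k\<bar> \<le> M + B" using M(1)[of "(x, 0)"] assms(6) by linarith
        have "\<phi> (x, t) \<le> \<phi> (x, 0) + L * dt"
          using \<phi>(4)[of t x] True mult_left_mono[of t dt L] L0 by auto
        then have "\<bar>v (x, 0) - k\<bar> * \<phi> (x, t) \<le> \<bar>v (x, 0) - k\<bar> * (\<phi> (x, 0) + L * dt)" by (intro mult_left_mono) auto
        also have "\<dots> \<le> \<bar>v (x, 0) - k\<bar> * \<phi> (x, 0) + (M + B) * (L * dt)"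
          using mult_right_mono[OF vk, of "L * dt"] L0 \<open>0 < dt\<close> by (simp add: algebra_simps)
        also have "\<bar>v (x, 0) - k\<bar> * \<phi> (x, 0) \<le> (\<bar>u0 x - k\<bar> + \<bar>u0 x - v (x, 0)\<bar>) * \<phi> (x, 0)"
          using \<phi>(1) by (intro mult_right_mono) auto
        also have "\<dots> \<le> \<bar>u0 x - k\<bar> * \<phi> (x, 0) + L * \<bar>u0 x - v (x, 0)\<bar>"
          using mult_left_mono[OF \<phi>(2)[of "(x, 0)"], of "\<bar>u0 x - v (x, 0)\<bar>"] by (simp add: algebra_simps)
        finally have "\<bar>v (x, 0) - k\<bar> * \<phi> (x, t) \<le> \<bar>u0 x - k\<bar> * \<phi> (x, 0) + L * \<bar>u0 x - v (x, 0)\<bar> + (M + B) * (L * dt)" by simp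
        moreover have "a2 x = \<bar>u0 x - v (x, 0)\<bar>" "a3 x = 1" using xR by (auto simp: a2_def a3_def indicator_def)
        moreover have "G (x, t) = \<bar>v (x, 0) - k\<bar> * \<phi> (x, t)" using True v0[of t x] by (simp add: G_def)
        ultimately show ?thesis by (simp add: a1_def algebra_simps)
      qed
    qed
    also have "\<dots> = J"
    proof -
      have "(LBINT x. a3 x) = 2 * R" using \<open>0 \<le> R\<close> by (simp add: a3_def)
      then show ?thesis using i1 i2 i3 by (simp add: J_def a1_def[symmetric] a2_def[symmetric])
    qed
    finally show ?thesis using True by simp
  qed
  have "(LBINT z. (indicator (UNIV \<times> {0..<dt}) z * \<bar>v z - k\<bar> * \<phi> z)) = (LBINT z. G z)"
    by (intro Bochner_Integration.integral_cong) (auto simp: G_def indicator_def)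
  also have "\<dots> = (LBINT t. (LBINT x. G (x, t)))" by (rule F(2)[symmetric])
  also have "\<dots> \<le> (LBINT t. indicator {0..<dt} t * J)"
  proof (rule Bochner_Integration.integral_mono[OF F(4) _ inner])
    show "integrable lborel (\<lambda>t. indicator {0..<dt} t * J)"
      using \<open>0 < dt\<close> by (intro integrable_mult_left integrable_real_indicator) auto
  qed
  also have "\<dots> = dt * J" using \<open>0 < dt\<close> by simp
  finally show ?thesis by (simp add: J_def)
qed

context flux_splitting
begin

text \<open>The discrete entropy inequality is integrated over all \<open>(x, t)\<close> with \<open>t \<ge> 0\<close>, not summed
  over cells; summation by parts then becomes a translation of the integration variable.\<close>

lemma discrete_entropy_inequality:
  fixes v \<phi> :: "real \<times> real \<Rightarrow> real"
  assumes meas [measurable]: "v \<in> borel_measurable borel" "\<phi> \<in> borel_measurable borel"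
    and M: "\<And>z. \<bar>v z\<bar> \<le> M"
    and \<phi>: "\<And>z. 0 \<le> \<phi> z" "\<And>z. \<phi> z \<le> L" "\<And>z. norm z > R \<Longrightarrow> \<phi> z = 0"
    and grid: "0 < dx" "dx \<le> 1 / 2" "0 < dt" "dt \<le> 1 / 2" "\<alpha> * (dt / dx) \<le> 1"
    and step: "\<And>x t. 0 \<le> t \<Longrightarrow> t + dt \<le> R \<Longrightarrow>
        \<bar>v (x, t + dt) - upwind (dt / dx) (v (x - dx, t)) (v (x, t)) (v (x + dx, t))\<bar> \<le> \<eta>"
  shows "0 \<le> (LBINT z. half z * (\<bar>v z - k\<bar> * (\<phi> (z + (0, dt)) - \<phi> z)
        + dt / dx * \<bar>fp (v z) - fp k\<bar> * (\<phi> (z + (dx, dt)) - \<phi> (z + (0, dt)))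
        - dt / dx * \<bar>fm (v z) - fm k\<bar> * (\<phi> (z + (0, dt)) - \<phi> (z + (- dx, dt)))
        + \<eta> * \<phi> (z + (0, dt))))
      + (LBINT z. (indicator (UNIV \<times> {0..<dt}) z * \<bar>v z - k\<bar> * \<phi> z))"
proof -
  define \<mu> where "\<mu> = dt / dx"
  have \<mu>: "0 \<le> \<mu>" "\<mu> * \<alpha> \<le> 1" using grid by (auto simp: \<mu>_def mult.commute)
  define N where "N z = \<bar>v z - k\<bar>" for z
  define P where "P z = \<bar>fp (v z) - fp k\<bar>" for z
  define Q where "Q z = \<bar>fm (v z) - fm k\<bar>" for z
  have [measurable]: "N \<in> borel_measurable borel" "P \<in> borel_measurable borel" "Q \<in> borel_measurable borel"
    unfolding N_def P_def Q_def by measurable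
  have bv: "bounded_fun v" using M by (rule bounded_funI)
  have bN: "bounded_fun N" unfolding N_def by (intro bdd bv)
  have bPQ: "bounded_fun P" "bounded_fun Q"
  proof -
    have "bounded_fun (\<lambda>z. \<alpha> * N z)" by (intro bdd bN)
    then obtain C where C: "\<And>z. \<bar>\<alpha> * N z\<bar> \<le> C" by (auto simp: bounded_fun_def)
    have "\<bar>P z\<bar> \<le> C" "\<bar>Q z\<bar> \<le> C" for z
      using C[of z] split_abs_bound[of "v z" k] by (auto simp: P_def Q_def N_def)
    then show "bounded_fun P" "bounded_fun Q" by (blast intro: bounded_funI)+
  qed
  have b\<phi>: "bounded_fun \<phi>" using \<phi>(1,2) by (auto intro: bounded_funI[of _ L])
  note b = bN bPQ b\<phi>
  have far: "\<phi> (z + c) = 0" if "norm z > R + 1" "norm c \<le> 1" for z c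
    using norm_triangle_ineq4[of "z + c" c] that by (intro \<phi>(3)) auto
  have nc: "norm (0::real, dt) \<le> 1" "norm (dx, dt) \<le> 1" "norm (- dx, dt) \<le> 1" "norm (0::real, 0::real) \<le> 1"
    using grid norm_Pair_le[of 0 dt] norm_Pair_le[of dx dt] norm_Pair_le[of "-dx" dt] by auto
  have int: "integrable lborel (\<lambda>z. half z * (h z * \<phi> (z + c)))"
    if [measurable]: "h \<in> borel_measurable borel" and "bounded_fun h" "norm c \<le> 1" for h c
    by (rule integrable_bounded_fun_support[where R = "R + 1"])
      (use far that in \<open>auto intro!: bdd b\<phi>[THEN bounded_fun_compose]\<close>)
  define eN where "eN = (LBINT z. half z * (N z * \<phi> (z + (0, dt))))"
  define eP where "eP = (LBINT z. half z * (P z * \<phi> (z + (0, dt))))"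
  define eQ where "eQ = (LBINT z. half z * (Q z * \<phi> (z + (0, dt))))"
  define eP' where "eP' = (LBINT z. half z * (P z * \<phi> (z + (dx, dt))))"
  define eQ' where "eQ' = (LBINT z. half z * (Q z * \<phi> (z + (- dx, dt))))"
  define e1 where "e1 = (LBINT z. half z * (1 * \<phi> (z + (0, dt))))"
  define eN0 where "eN0 = (LBINT z. half z * (N z * \<phi> z))"
  define I where "I = (LBINT z. (indicator (UNIV \<times> {0..<dt}) z * \<bar>v z - k\<bar> * \<phi> z))"
  note iN = int[OF _ bN nc(1)] and iP = int[OF _ bPQ(1) nc(1)] and iQ = int[OF _ bPQ(2) nc(1)]
    and iP' = int[OF _ bPQ(1) nc(2)] and iQ' = int[OF _ bPQ(2) nc(3)]
    and i1 = int[OF _ bounded_fun_intros(1)[of 1] nc(1)]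
    and iN0 = int[OF _ bN nc(4)]
  have tP: "(LBINT z. half z * (P (z + (- dx, 0)) * \<phi> (z + (0, dt)))) = eP'"
  proof -
    define g where "g z = half z * (P z * \<phi> (z + (dx, dt)))" for z
    have "g \<in> borel_measurable borel" unfolding g_def by measurable
    from lborel_integral_translate[OF this, of "(- dx, 0)"]
    have "(LBINT z. g ((- dx, 0) + z)) = eP'" unfolding eP'_def g_def .
    moreover have "g ((- dx, 0) + z) = half z * (P (z + (- dx, 0)) * \<phi> (z + (0, dt)))" for z
      by (cases z) (simp add: g_def half_cases)
    ultimately show ?thesis by (simp only:)
  qed
  have tQ: "(LBINT z. half z * (Q (z + (dx, 0)) * \<phi> (z + (0, dt)))) = eQ'"
  proof -
    define g where "g z = half z * (Q z * \<phi> (z + (- dx, dt)))" for z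
    have "g \<in> borel_measurable borel" unfolding g_def by measurable
    from lborel_integral_translate[OF this, of "(dx, 0)"]
    have "(LBINT z. g ((dx, 0) + z)) = eQ'" unfolding eQ'_def g_def .
    moreover have "g ((dx, 0) + z) = half z * (Q (z + (dx, 0)) * \<phi> (z + (0, dt)))" for z
      by (cases z) (simp add: g_def half_cases add.commute[of dx])
    ultimately show ?thesis by (simp only:)
  qed
  \<comment> \<open>The shift by dt moves the half-plane to t \<ge> dt; the strip that is lost is
    the term I.\<close>
  have tN: "(LBINT z. half z * (N (z + (0, dt)) * \<phi> (z + (0, dt)))) = eN0 - I"
  proof -
    define g where "g z = indicator (UNIV \<times> {dt..}) z * (N z * \<phi> z)" for z :: "real \<times> real"
    have [measurable]: "UNIV \<times> {dt..} \<in> sets (borel :: (real \<times> real) measure)"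
      by (intro borel_closed closed_Times) auto
    have [measurable]: "UNIV \<times> {0..<dt} \<in> sets (borel :: (real \<times> real) measure)"
      unfolding borel_prod[symmetric] by (intro pair_measureI) auto
    have mg: "g \<in> borel_measurable borel" unfolding g_def by measurable
    have "(LBINT z. half z * (N (z + (0, dt)) * \<phi> (z + (0, dt)))) = (LBINT z. g ((0, dt) + z))"
      by (intro Bochner_Integration.integral_cong) (auto simp: g_def half_plane_def add.commute[of dt] indicator_def)
    also have "\<dots> = (LBINT z. g z)" by (rule lborel_integral_translate[OF mg])
    also have "\<dots> = (LBINT z. (half z * (N z * \<phi> (z + (0, 0))) - indicator (UNIV \<times> {0..<dt}) z * \<bar>v z - k\<bar> * \<phi> z))"
      using grid by (intro Bochner_Integration.integral_cong) (auto simp: g_def half_plane_def N_def indicator_def zero_prod_def[symmetric])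
    also have "\<dots> = eN0 - I"
    proof -
      have "integrable lborel (\<lambda>z. indicator (UNIV \<times> {0..<dt}) z * \<bar>v z - k\<bar> * \<phi> z)"
        by (rule integrable_bounded_fun_support[where R = R])
          (use \<phi>(3) in \<open>auto intro!: bdd bv b\<phi>\<close>)
      from Bochner_Integration.integral_diff[OF iN0 this] show ?thesis
        by (simp add: eN0_def I_def zero_prod_def[symmetric])
    qed
    finally show ?thesis .
  qed
  have "(LBINT z. half z * (N (z + (0, dt)) * \<phi> (z + (0, dt)))) \<le>
    (LBINT z. (half z * (N z * \<phi> (z + (0, dt))) - \<mu> * (half z * (P z * \<phi> (z + (0, dt)))) - \<mu> * (half z * (Q z * \<phi> (z + (0, dt))))
      + \<mu> * (half z * (P (z + (- dx, 0)) * \<phi> (z + (0, dt)))) + \<mu> * (half z * (Q (z + (dx, 0)) * \<phi> (z + (0, dt))))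
      + \<eta> * (half z * (1 * \<phi> (z + (0, dt))))))" (is "?l \<le> (LBINT z. ?r z)")
  proof (rule Bochner_Integration.integral_mono)
    show "integrable lborel (\<lambda>z. half z * (N (z + (0, dt)) * \<phi> (z + (0, dt))))"
      by (rule int[OF _ bounded_fun_compose[OF bN] nc(1)]) measurable
    have "integrable lborel (\<lambda>z. half z * (P (z + (- dx, 0)) * \<phi> (z + (0, dt))))"
      "integrable lborel (\<lambda>z. half z * (Q (z + (dx, 0)) * \<phi> (z + (0, dt))))"
      by (rule int[OF _ bounded_fun_compose[OF bPQ(1)] nc(1)], measurable)
        (rule int[OF _ bounded_fun_compose[OF bPQ(2)] nc(1)], measurable)
    then show "integrable lborel ?r"
      using iN iP iQ i1 by (intro Bochner_Integration.integrable_add Bochner_Integration.integrable_diff integrable_mult_right) auto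
    fix z :: "real \<times> real"
    obtain x t where z: "z = (x, t)" by (cases z)
    show "half z * (N (z + (0, dt)) * \<phi> (z + (0, dt))) \<le> ?r z"
    proof (cases "0 \<le> t \<and> \<phi> (x, t + dt) \<noteq> 0")
      case False
      then show ?thesis by (auto simp: z half_cases)
    next
      case True
      \<comment> \<open>Where the test function does not vanish the time is at most R, and only
        there is the scheme relation available.\<close>
      then have "norm (x, t + dt) \<le> R" using \<phi>(3)[of "(x, t + dt)"] by force
      then have tR: "t + dt \<le> R" using norm_snd_le[of "t + dt" x] by simp
      have "\<bar>v (x, t + dt) - k\<bar> \<le> \<bar>upwind \<mu> (v (x - dx, t)) (v (x, t)) (v (x + dx, t)) - k\<bar> + \<eta>"
        using step[OF _ tR, of x] True unfolding \<mu>_def[symmetric] by linarith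
      also have "\<dots> \<le> N z - \<mu> * (P z + Q z) + \<mu> * P (x - dx, t) + \<mu> * Q (x + dx, t) + \<eta>"
        using upwind_entropy[OF \<mu>] by (simp add: N_def P_def Q_def z)
      finally have "N (x, t + dt) * \<phi> (x, t + dt) \<le> (N z - \<mu> * (P z + Q z) + \<mu> * P (x - dx, t) + \<mu> * Q (x + dx, t) + \<eta>) * \<phi> (x, t + dt)"
        using \<phi>(1) unfolding N_def[of "(x, t + dt)"] by (rule mult_right_mono)
      then show ?thesis using True by (simp add: z half_cases algebra_simps)
    qed
  qed
  also have "(LBINT z. ?r z) = eN - \<mu> * eP - \<mu> * eQ + \<mu> * eP' + \<mu> * eQ' + \<eta> * e1"
  proof -
    have iPs: "integrable lborel (\<lambda>z. half z * (P (z + (- dx, 0)) * \<phi> (z + (0, dt))))"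
      "integrable lborel (\<lambda>z. half z * (Q (z + (dx, 0)) * \<phi> (z + (0, dt))))"
      by (rule int[OF _ bounded_fun_compose[OF bPQ(1)] nc(1)], measurable)
        (rule int[OF _ bounded_fun_compose[OF bPQ(2)] nc(1)], measurable)
    show ?thesis using iN iP iQ i1 iPs
      by (simp add: eN_def eP_def eQ_def e1_def tP[symmetric] tQ[symmetric])
  qed
  finally have "eN0 - I \<le> eN - \<mu> * eP - \<mu> * eQ + \<mu> * eP' + \<mu> * eQ' + \<eta> * e1" unfolding tN .
  moreover have "(LBINT z. half z * (\<bar>v z - k\<bar> * (\<phi> (z + (0, dt)) - \<phi> z)
        + dt / dx * \<bar>fp (v z) - fp k\<bar> * (\<phi> (z + (dx, dt)) - \<phi> (z + (0, dt)))
        - dt / dx * \<bar>fm (v z) - fm k\<bar> * (\<phi> (z + (0, dt)) - \<phi> (z + (- dx, dt)))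
        + \<eta> * \<phi> (z + (0, dt)))) = eN - eN0 + \<mu> * eP' - \<mu> * eP - \<mu> * eQ + \<mu> * eQ' + \<eta> * e1"
  proof -
    have "(\<lambda>z. half z * (\<bar>v z - k\<bar> * (\<phi> (z + (0, dt)) - \<phi> z)
        + dt / dx * \<bar>fp (v z) - fp k\<bar> * (\<phi> (z + (dx, dt)) - \<phi> (z + (0, dt)))
        - dt / dx * \<bar>fm (v z) - fm k\<bar> * (\<phi> (z + (0, dt)) - \<phi> (z + (- dx, dt)))
        + \<eta> * \<phi> (z + (0, dt)))) = (\<lambda>z. half z * (N z * \<phi> (z + (0, dt))) - half z * (N z * \<phi> z)
      + \<mu> * (half z * (P z * \<phi> (z + (dx, dt)))) - \<mu> * (half z * (P z * \<phi> (z + (0, dt))))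
      - \<mu> * (half z * (Q z * \<phi> (z + (0, dt)))) + \<mu> * (half z * (Q z * \<phi> (z + (- dx, dt))))
      + \<eta> * (half z * (1 * \<phi> (z + (0, dt)))))"
      by (auto simp: N_def P_def Q_def \<mu>_def algebra_simps)
    moreover have "integrable lborel (\<lambda>z. half z * (N z * \<phi> z))" using iN0 by (simp add: zero_prod_def[symmetric])
    ultimately show ?thesis using iN iP iQ iP' iQ' i1
      by (simp add: eN_def eP_def eQ_def eP'_def eQ'_def e1_def eN0_def)
  qed
  ultimately show ?thesis by (simp add: I_def)
qed

end

section \<open>The quantised scheme\<close>

context flux_splitting
begin

text \<open>By the mean value theorem the difference quotients of the test function are its
  derivatives at points closer than r, at the cost d each. The error \<eta> of one step is divided
  by dt, which is what lets rounding errors accumulate, and the strip integral supplies the initial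
  term.\<close>

lemma entropy_functional_lower_bound:
  fixes v \<phi> \<phi>x \<phi>t :: "real \<times> real \<Rightarrow> real" and u0 :: "real \<Rightarrow> real"
  assumes meas [measurable]: "v \<in> borel_measurable borel" "u0 \<in> borel_measurable borel"
    and M: "\<And>z. \<bar>v z\<bar> \<le> M" "\<And>x. \<bar>u0 x\<bar> \<le> M" and k: "\<bar>k\<bar> \<le> B"
    and \<phi>: "test_function \<phi> \<phi>x \<phi>t" "\<And>z. \<bar>\<phi> z\<bar> \<le> L" "\<And>z. \<bar>\<phi>t z\<bar> \<le> L"
      "\<And>z. norm z > R \<Longrightarrow> \<phi> z = 0 \<and> \<phi>x z = 0 \<and> \<phi>t z = 0"
    and modulus: "\<And>z z'. dist z z' < r \<Longrightarrow> \<bar>\<phi>x z - \<phi>x z'\<bar> \<le> d \<and> \<bar>\<phi>t z - \<phi>t z'\<bar> \<le> d"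
    and grid: "0 < dx" "dx \<le> 1 / 2" "0 < dt" "dt \<le> 1 / 2" "\<alpha> * (dt / dx) \<le> 1" "dx + dt < r"
    and R: "0 \<le> R" and \<eta>: "0 \<le> \<eta>"
    and step: "\<And>x t. 0 \<le> t \<Longrightarrow> t + dt \<le> R \<Longrightarrow>
        \<bar>v (x, t + dt) - upwind (dt / dx) (v (x - dx, t)) (v (x, t)) (v (x + dx, t))\<bar> \<le> \<eta>"
    and v0: "\<And>x t. 0 \<le> t \<Longrightarrow> t < dt \<Longrightarrow> v (x, t) = v (x, 0)"
  shows "- ((d * ((M + B) * (1 + \<alpha>)) + \<eta> / dt * L) * measure lborel (cball (0::real \<times> real) (R + 1))
      + L * (LBINT x. (indicator {-R..R} x * \<bar>u0 x - v (x, 0)\<bar>)) + (M + B) * L * dt * (2 * R))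
    \<le> entropy_functional f u0 v k \<phi> \<phi>x \<phi>t"
proof -
  note [measurable] = test_function_continuous[OF \<phi>(1), THEN borel_measurable_continuous_onI]
  have der: "\<And>z. (\<phi> has_derivative (\<lambda>h. \<phi>x z * fst h + \<phi>t z * snd h)) (at z)" and \<phi>0: "\<And>z. 0 \<le> \<phi> z"
    using \<phi>(1) unfolding test_function_def by blast+
  have \<phi>L: "\<phi> z \<le> L" for z using \<phi>(2)[of z] by linarith
  have L0: "0 \<le> L" using \<phi>0 \<phi>L order_trans by blast
  have d0: "0 \<le> d" using modulus[of 0 0] grid by auto
  have bv: "bounded_fun v" using M(1) by (rule bounded_funI)
  define A where "A = measure lborel (cball (0::real \<times> real) (R + 1))"
  define C where "C = (indicator (cball 0 (R + 1)) :: real \<times> real \<Rightarrow> real)"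
  have Ci: "integrable lborel C" "(LBINT z. C z) = A"
    using emeasure_lborel_cball_finite[of "0::real\<times>real" "R+1"]
    by (auto simp: C_def A_def intro!: integrable_real_indicator)
  define c1 where "c1 = d * ((M + B) * (1 + \<alpha>)) + \<eta> / dt * L"
  define S where "S z = half z * (\<bar>v z - k\<bar> * \<phi>t z + kruzkov (v z) k * \<phi>x z)" for z
  have Si: "integrable lborel S"
  proof (rule integrable_bounded_fun_support[where R = R])
    show "S \<in> borel_measurable borel" unfolding S_def by measurable
    show "bounded_fun S" unfolding S_def by (intro bdd bv test_function_bounded_fun[OF \<phi>(1)])
  qed (simp add: S_def \<phi>(4))
  define T where "T z = half z * (\<bar>v z - k\<bar> * (\<phi> (z + (0, dt)) - \<phi> z)
        + dt / dx * \<bar>fp (v z) - fp k\<bar> * (\<phi> (z + (dx, dt)) - \<phi> (z + (0, dt)))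
        - dt / dx * \<bar>fm (v z) - fm k\<bar> * (\<phi> (z + (0, dt)) - \<phi> (z + (- dx, dt)))
        + \<eta> * \<phi> (z + (0, dt)))" for z
  have far: "\<phi> (z + c) = 0" if "norm z > R + 1" "norm c \<le> 1" for z c
    using norm_triangle_ineq4[of "z + c" c] that by (intro conjunct1[OF \<phi>(4)]) auto
  have nc: "norm (0::real, dt) \<le> 1" "norm (dx, dt) \<le> 1" "norm (- dx, dt) \<le> 1" "norm (0::real, 0::real) \<le> 1"
    using grid norm_Pair_le[of 0 dt] norm_Pair_le[of dx dt] norm_Pair_le[of "-dx" dt] by auto
  have T0: "T z = 0" if "norm z > R + 1" for z
    using far[OF that nc(1)] far[OF that nc(2)] far[OF that nc(3)] that \<phi>(4)[of z] by (simp add: T_def)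
  have TS: "T z \<le> dt * S z + dt * c1 * C z" for z
  proof (cases "norm z \<le> R + 1 \<and> half z = 1")
    case False
    have "0 \<le> c1"
      using d0 M(1)[of z] k pos \<eta> grid L0 by (simp add: c1_def)
    then have "0 \<le> dt * c1 * C z" using grid by (simp add: C_def)
    moreover have "T z = 0" "S z = 0"
      using False T0[of z] \<phi>(4)[of z] by (cases "half z = 0"; force simp: half_cases T_def S_def split: if_splits)+
    ultimately show ?thesis by simp
  next
    case True
    obtain x t where z: "z = (x, t)" by (cases z)
    define N P Q where "N = \<bar>v z - k\<bar>" and "P = \<bar>fp (v z) - fp k\<bar>" and "Q = \<bar>fm (v z) - fm k\<bar>"
    have NPQ: "0 \<le> N" "0 \<le> P" "0 \<le> Q" "P + Q \<le> \<alpha> * N" "N \<le> M + B"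
      using split_abs_bound[of "v z" k] M(1)[of z] k by (auto simp: N_def P_def Q_def)
    have near: "\<bar>\<phi>x (x + a, t + b) - \<phi>x z\<bar> \<le> d" "\<bar>\<phi>t (x + a, t + b) - \<phi>t z\<bar> \<le> d" if "\<bar>a\<bar> \<le> dx" "\<bar>b\<bar> \<le> dt" for a b
    proof -
      have "dist (x + a, t + b) z < r"
        using norm_Pair_le[of a b] that grid by (simp add: z dist_norm)
      then show "\<bar>\<phi>x (x + a, t + b) - \<phi>x z\<bar> \<le> d" "\<bar>\<phi>t (x + a, t + b) - \<phi>t z\<bar> \<le> d" using modulus by blast+
    qed
    obtain \<xi>1 where x1: "0 < \<xi>1" "\<xi>1 < dt" "\<phi> (x, t + dt) - \<phi> (x, t) = dt * \<phi>t (x, t + \<xi>1)"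
      using partial_mean_value(2)[OF der grid(3), of x t] by blast
    obtain \<xi>2 where x2: "0 < \<xi>2" "\<xi>2 < dx" "\<phi> (x + dx, t + dt) - \<phi> (x, t + dt) = dx * \<phi>x (x + \<xi>2, t + dt)"
      using partial_mean_value(1)[OF der grid(1), of x "t + dt"] by blast
    \<comment> \<open>The fm-part is differenced to the left of x, hence the intermediate point x +
      (\<xi>3 - dx).\<close>
    obtain \<xi>3 where x3: "0 < \<xi>3" "\<xi>3 < dx" "\<phi> (x, t + dt) - \<phi> (x - dx, t + dt) = dx * \<phi>x (x + (\<xi>3 - dx), t + dt)"
      using partial_mean_value(1)[OF der grid(1), of "x - dx" "t + dt"] by (auto simp: algebra_simps)
    have "N * (dt * \<phi>t (x, t + \<xi>1)) \<le> N * (dt * (\<phi>t z + d))"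
      using near(2)[of 0 \<xi>1] x1 grid NPQ by (intro mult_left_mono) auto
    moreover have "P * (dt * \<phi>x (x + \<xi>2, t + dt)) \<le> P * (dt * (\<phi>x z + d))"
      using near(1)[of \<xi>2 dt] x2 grid NPQ by (intro mult_left_mono) auto
    moreover have "Q * (dt * (\<phi>x z - d)) \<le> Q * (dt * \<phi>x (x + (\<xi>3 - dx), t + dt))"
      using near(1)[of "\<xi>3 - dx" dt] x3 grid NPQ by (intro mult_left_mono) auto
    moreover have "\<eta> * \<phi> (x, t + dt) \<le> \<eta> * L" using \<phi>L \<eta> by (intro mult_left_mono) auto
    moreover have "T z = N * (dt * \<phi>t (x, t + \<xi>1)) + P * (dt * \<phi>x (x + \<xi>2, t + dt))
        - Q * (dt * \<phi>x (x + (\<xi>3 - dx), t + dt)) + \<eta> * \<phi> (x, t + dt)"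
    proof -
      have "z + (0, dt) = (x, t + dt)" "z + (dx, dt) = (x + dx, t + dt)" "z + (- dx, dt) = (x - dx, t + dt)" by (simp_all add: z)
      then have "T z = N * (\<phi> (x, t + dt) - \<phi> (x, t)) + dt / dx * P * (\<phi> (x + dx, t + dt) - \<phi> (x, t + dt))
        - dt / dx * Q * (\<phi> (x, t + dt) - \<phi> (x - dx, t + dt)) + \<eta> * \<phi> (x, t + dt)"
        using True unfolding T_def N_def P_def Q_def by (simp add: z)
      then show ?thesis unfolding x1(3) x2(3) x3(3) using grid by simp
    qed
    ultimately have "T z \<le> N * (dt * (\<phi>t z + d)) + P * (dt * (\<phi>x z + d)) - Q * (dt * (\<phi>x z - d)) + \<eta> * L" by linarith
    \<comment> \<open>The difference P - Q is the Kruzkov flux by \<open>kruzkov_split\<close>,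
      while the errors add up to P + Q.\<close>
    also have "\<dots> = dt * S z + dt * d * (N + (P + Q)) + \<eta> * L"
      using True by (simp add: S_def kruzkov_split N_def[symmetric] P_def[symmetric] Q_def[symmetric] algebra_simps)
    also have "\<dots> \<le> dt * S z + dt * d * ((M + B) * (1 + \<alpha>)) + \<eta> * L"
    proof -
      have "N + (P + Q) \<le> N * (1 + \<alpha>)" using NPQ by (simp add: algebra_simps)
      also have "\<dots> \<le> (M + B) * (1 + \<alpha>)" using NPQ pos by (intro mult_right_mono) auto
      finally show ?thesis using grid d0 by (simp add: mult_left_mono)
    qed
    also have "\<dots> = dt * S z + dt * c1 * C z" using True grid by (simp add: c1_def C_def algebra_simps)
    finally show ?thesis .
  qed
  have Ti: "integrable lborel T"
  proof (rule integrable_bounded_fun_support[where R = "R + 1"])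
    show "T \<in> borel_measurable borel" unfolding T_def by measurable
    have b\<phi>: "bounded_fun \<phi>" using \<phi>(2) by (rule bounded_funI)
    have "\<bar>fp (v z) - fp k\<bar> \<le> \<alpha> * (M + B)" "\<bar>fm (v z) - fm k\<bar> \<le> \<alpha> * (M + B)" for z
    proof -
      have "\<alpha> * \<bar>v z - k\<bar> \<le> \<alpha> * (M + B)" using M(1)[of z] k pos by (intro mult_left_mono) auto
      then show "\<bar>fp (v z) - fp k\<bar> \<le> \<alpha> * (M + B)" "\<bar>fm (v z) - fm k\<bar> \<le> \<alpha> * (M + B)"
        using split_abs_bound[of "v z" k] by linarith+
    qed
    note near_k = this
    have "\<bar>fp (v z)\<bar> \<le> \<alpha> * (M + B) + \<bar>fp k\<bar>" "\<bar>fm (v z)\<bar> \<le> \<alpha> * (M + B) + \<bar>fm k\<bar>" for z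
      using near_k[of z] by linarith+
    then have "bounded_fun (\<lambda>z. fp (v z))" "bounded_fun (\<lambda>z. fm (v z))" by (blast intro: bounded_funI)+
    then show "bounded_fun T" unfolding T_def
      by (intro bdd bv bounded_fun_compose[OF b\<phi>])
  qed (rule T0)
  define I where "I = (LBINT z. (indicator (UNIV \<times> {0..<dt}) z * \<bar>v z - k\<bar> * \<phi> z))"
  define J where "J = (LBINT x. (\<bar>u0 x - k\<bar> * \<phi> (x, 0)))"
  define D where "D = L * (LBINT x. (indicator {-R..R} x * \<bar>u0 x - v (x, 0)\<bar>)) + (M + B) * L * dt * (2 * R)"
  have "0 \<le> (LBINT z. T z) + I" unfolding T_def I_def
    by (rule discrete_entropy_inequality[OF _ _ M(1) \<phi>0 \<phi>L _ grid(1-5) step]) (use \<phi>(4) in auto)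
  also have "(LBINT z. T z) \<le> (LBINT z. (dt * S z + dt * c1 * C z))"
    using Ti Si Ci TS by (intro Bochner_Integration.integral_mono Bochner_Integration.integrable_add integrable_mult_right)
  also have "\<dots> = dt * (LBINT z. S z) + dt * c1 * A" using Si Ci by simp
  also have "I \<le> dt * (J + D)"
  proof -
    have "I \<le> dt * (J + L * (LBINT x. (indicator {-R..R} x * \<bar>u0 x - v (x, 0)\<bar>)) + (M + B) * L * dt * (2 * R))"
      unfolding I_def J_def
    proof (rule initial_strip_estimate)
      show "\<phi> (x, t) - \<phi> (x, 0) \<le> L * t" if "0 \<le> t" for x t
      proof (cases "t = 0")
        case False
        then have "0 < t" using that by simp
        from partial_mean_value(2)[OF der this, of x 0] obtain \<xi> where "\<phi> (x, t) - \<phi> (x, 0) = t * \<phi>t (x, 0 + \<xi>)" by auto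
        also have "\<dots> \<le> t * L" using that \<phi>(3)[of "(x, 0 + \<xi>)"] by (intro mult_left_mono) (auto simp: abs_le_iff)
        finally show ?thesis by (simp add: mult.commute)
      qed simp
      show "v (x, t) = v (x, 0)" if "0 \<le> t" "t < dt" for x t using v0 that by blast
    qed (use M k \<phi>0 \<phi>L \<phi>(4) grid R in auto)
    then show ?thesis by (simp add: D_def add.assoc)
  qed
  finally have "0 \<le> dt * ((LBINT z. S z) + J + (c1 * A + D))" by (simp add: algebra_simps)
  then have "0 \<le> (LBINT z. S z) + J + (c1 * A + D)" using grid by (simp add: zero_le_mult_iff)
  then show ?thesis
    by (simp add: entropy_functional_alt S_def[symmetric] J_def[symmetric] c1_def A_def D_def)
qed

end

lemma quantised_flux_error:
  assumes "nearest_rounding rnd" "0 < \<delta>"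
  shows "\<bar>\<delta> * of_int (quantised_flux rnd g \<delta> dx dt q) - dt / dx * g (\<delta> * of_int q)\<bar> \<le> \<delta> / 2"
proof -
  define y where "y = g (\<delta> * of_int q) * (dt / dx) * inverse \<delta>"
  have "\<bar>of_int (rnd y) - y\<bar> \<le> 1 / 2" using assms(1) by (simp add: nearest_rounding_def)
  then have "\<delta> * \<bar>of_int (rnd y) - y\<bar> \<le> \<delta> * (1 / 2)" using assms(2) by (intro mult_left_mono) auto
  moreover have "\<delta> * \<bar>of_int (rnd y) - y\<bar> = \<bar>\<delta> * of_int (rnd y) - \<delta> * y\<bar>"
    using assms(2) by (simp add: abs_mult[symmetric] right_diff_distrib abs_mult_pos')
  moreover have "\<delta> * y = dt / dx * g (\<delta> * of_int q)" using assms(2) by (simp add: y_def field_simps)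
  moreover have "quantised_flux rnd g \<delta> dx dt q = rnd y" by (simp add: quantised_flux_def y_def)
  ultimately show ?thesis by simp
qed

text \<open>Four rounded fluxes enter one update, each off by at most \<delta> / 2 after
  multiplication by \<delta>.\<close>

lemma scheme_step_error:
  fixes fp fm :: "real \<Rightarrow> real" and \<delta> dx dt :: real and q0 :: "int \<Rightarrow> int"
  assumes "nearest_rounding rnd" "0 < \<delta>"
  defines "u \<equiv> \<lambda>n i. \<delta> * of_int (scheme (num_flux rnd fp fm \<delta> dx dt) q0 n i)"
  shows "\<bar>u (Suc n) i - (u n i - dt / dx * ((fp (u n i) + fm (u n (i + 1))) - (fp (u n (i - 1)) + fm (u n i))))\<bar> \<le> 2 * \<delta>"
proof -
  define q where "q = scheme (num_flux rnd fp fm \<delta> dx dt) q0 n"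
  define E where "E g j = \<delta> * of_int (quantised_flux rnd g \<delta> dx dt (q j)) - dt / dx * g (u n j)" for g j
  have E: "\<bar>E g j\<bar> \<le> \<delta> / 2" for g j
    using quantised_flux_error[OF assms(1,2)] unfolding E_def u_def q_def .
  have "u (Suc n) i - (u n i - dt / dx * ((fp (u n i) + fm (u n (i + 1))) - (fp (u n (i - 1)) + fm (u n i))))
    = - E fp i - E fm (i + 1) + E fp (i - 1) + E fm i"
    by (simp add: u_def E_def q_def[symmetric] num_flux_def algebra_simps)
  then show ?thesis using E[of fp i] E[of fm "i + 1"] E[of fp "i - 1"] E[of fm i] by linarith
qed

lemma monotone_num_flux:
  assumes "mono rnd" "mono fp" "antimono fm" "0 < \<delta>" "0 < dx" "0 < dt"
  shows "monotone_flux (num_flux rnd fp fm \<delta> dx dt)"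
proof -
  have "quantised_flux rnd fp \<delta> dx dt a \<le> quantised_flux rnd fp \<delta> dx dt b"
    "quantised_flux rnd fm \<delta> dx dt b \<le> quantised_flux rnd fm \<delta> dx dt a" if "a \<le> b" for a b
  proof -
    have "\<delta> * of_int a \<le> \<delta> * of_int b" using that assms by (intro mult_left_mono) auto
    then have "fp (\<delta> * of_int a) \<le> fp (\<delta> * of_int b)" "fm (\<delta> * of_int b) \<le> fm (\<delta> * of_int a)"
      using assms(2,3) by (auto dest: monoD antimonoD)
    then show "quantised_flux rnd fp \<delta> dx dt a \<le> quantised_flux rnd fp \<delta> dx dt b"
      "quantised_flux rnd fm \<delta> dx dt b \<le> quantised_flux rnd fm \<delta> dx dt a"
      unfolding quantised_flux_def using assms(4-6) by (intro monoD[OF assms(1)] mult_right_mono; simp)+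
  qed
  then show ?thesis by (auto simp: monotone_flux_def num_flux_def intro!: monoI antimonoI)
qed

lemma consistent_num_flux:
  assumes "nearest_rounding rnd" "\<And>u. f u = fp u + fm u" "0 < \<alpha>" "0 < \<nu>"
  shows "consistent_flux rnd f fp fm \<alpha> \<nu>"
  unfolding consistent_flux_def
proof (intro conjI allI)
  show "\<exists>C. \<forall>\<delta> dx dt q0 n i. admissible_grid \<alpha> \<nu> \<delta> dx dt \<longrightarrow>
        \<bar>residual fp fm dx dt (\<lambda>n i. \<delta> * of_int (scheme (num_flux rnd fp fm \<delta> dx dt) q0 n i)) n i\<bar> \<le> C * (\<delta> / dx)"
  \<comment> \<open>The error \<open>2 * \<delta>\<close> of one step is divided by dt, and dt =
    \<nu> dx / \<alpha>.\<close>
  proof (intro exI[of _ "2 * \<alpha> / \<nu>"] allI impI)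
    fix \<delta> dx dt :: real and q0 n i
    assume g: "admissible_grid \<alpha> \<nu> \<delta> dx dt"
    then have pos: "0 < \<delta>" "0 < dx" "0 < dt" and \<nu>: "\<alpha> * dt / dx = \<nu>" by (auto simp: admissible_grid_def)
    define u where "u = (\<lambda>n i. \<delta> * of_int (scheme (num_flux rnd fp fm \<delta> dx dt) q0 n i))"
    have "residual fp fm dx dt u n i
      = (u (Suc n) i - (u n i - dt / dx * ((fp (u n i) + fm (u n (i + 1))) - (fp (u n (i - 1)) + fm (u n i))))) / dt"
      using pos by (simp add: residual_def field_simps)
    also have "\<bar>\<dots>\<bar> \<le> 2 * \<delta> / dt"
      using scheme_step_error[OF assms(1) pos(1), of fp fm dx dt q0 n i] pos
      unfolding u_def abs_divide by (simp add: divide_right_mono)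
    also have "\<dots> = 2 * \<alpha> / \<nu> * (\<delta> / dx)" using pos assms(3) unfolding \<nu>[symmetric] by (simp add: field_simps)
    finally show "\<bar>residual fp fm dx dt (\<lambda>n i. \<delta> * of_int (scheme (num_flux rnd fp fm \<delta> dx dt) q0 n i)) n i\<bar> \<le> 2 * \<alpha> / \<nu> * (\<delta> / dx)"
      unfolding u_def .
  qed
qed (use assms in simp)

section \<open>Cell averages of the initial data\<close>

lemma mem_cell_iff: "0 < dx \<Longrightarrow> y \<in> cell dx i \<longleftrightarrow> \<lfloor>y / dx + 1 / 2\<rfloor> = i"
  by (auto simp: cell_def floor_eq_iff field_simps)

lemma cell_integral: "0 < dx \<Longrightarrow> (LBINT y. indicator (cell dx i) y / dx) = 1"
  by (simp add: cell_def left_diff_distrib[symmetric] algebra_simps)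

lemma abs_cell_average_le:
  assumes "\<And>x. \<bar>u0 x\<bar> \<le> M" "u0 \<in> borel_measurable borel" "0 < dx"
  shows "\<bar>cell_average dx u0 i\<bar> \<le> M"
proof -
  have i: "integrable lborel (indicator (cell dx i) :: real \<Rightarrow> real)"
    using assms(3) unfolding cell_def by (intro integrable_real_indicator) (auto simp: emeasure_lborel_Ico mult_right_mono)
  have "\<bar>(LBINT y. indicator (cell dx i) y * u0 y)\<bar> \<le> (LBINT y. M * indicator (cell dx i) y)"
  proof (rule integral_abs_bound_integral)
    show "integrable lborel (\<lambda>y. M * indicator (cell dx i) y)" using i by simp
    have [measurable]: "cell dx i \<in> sets borel" by (simp add: cell_def)
    show "integrable lborel (\<lambda>y. indicator (cell dx i) y * u0 y)"
      by (rule Bochner_Integration.integrable_bound[OF integrable_mult_right[OF i, of M]])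
        (use assms in \<open>auto simp: indicator_def intro: order_trans[OF _ abs_ge_self]\<close>)
    show "\<bar>indicator (cell dx i) y * u0 y\<bar> \<le> M * indicator (cell dx i) y" for y
      using assms(1)[of y] by (auto simp: indicator_def)
  qed
  also have "\<dots> = M * dx" using cell_integral[OF assms(3), of i] assms(3) by (simp add: field_simps)
  finally show ?thesis using assms(3) by (simp add: cell_average_def set_lebesgue_integral_def field_simps)
qed

text \<open>Averaging over the cell of x is integration against a kernel of mass 1, which brings the
  error into the form treated by \<open>L1_kernel_approx\<close>.\<close>

lemma cell_average_near:
  fixes u0 :: "real \<Rightarrow> real"
  assumes [measurable]: "u0 \<in> borel_measurable borel" and M: "\<And>x. \<bar>u0 x\<bar> \<le> M" and "0 < dx"
  defines "K \<equiv> \<lambda>p. (if \<lfloor>fst p / dx + 1 / 2\<rfloor> = \<lfloor>snd p / dx + 1 / 2\<rfloor> then 1 / dx else 0 :: real)"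
  shows "\<bar>u0 x - cell_average dx u0 \<lfloor>x / dx + 1 / 2\<rfloor>\<bar> \<le> (LBINT y. (\<bar>u0 y - u0 x\<bar> * K (x, y)))"
proof -
  define i where "i = \<lfloor>x / dx + 1 / 2\<rfloor>"
  have K: "K (x, y) = indicator (cell dx i) y / dx" for y
    using mem_cell_iff[OF \<open>0 < dx\<close>, of y i] by (auto simp: K_def i_def indicator_def)
  have [measurable]: "cell dx i \<in> sets borel" by (simp add: cell_def)
  have k1: "(LBINT y. indicator (cell dx i) y / dx) = 1" by (rule cell_integral[OF \<open>0 < dx\<close>])
  then have ik: "integrable lborel (\<lambda>y. indicator (cell dx i) y / dx)"
    by (metis not_integrable_integral_eq zero_neq_one)
  have int: "integrable lborel (\<lambda>y. h y * (indicator (cell dx i) y / dx))"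
    if [measurable]: "h \<in> borel_measurable borel" and h: "\<And>y. \<bar>h y\<bar> \<le> C" for h C
  proof (rule Bochner_Integration.integrable_bound[OF integrable_mult_right[OF ik, of C]])
    have "\<bar>h y\<bar> \<le> \<bar>C\<bar>" for y using h[of y] by linarith
    then show "AE y in lborel. norm (h y * (indicator (cell dx i) y / dx)) \<le> norm (C * (indicator (cell dx i) y / dx))"
      using \<open>0 < dx\<close> by (intro AE_I2) (simp add: indicator_def divide_right_mono)
  qed measurable
  have d2: "\<bar>\<bar>u0 y - u0 x\<bar>\<bar> \<le> 2 * M" "\<bar>u0 x - u0 y\<bar> \<le> 2 * M" for y using M[of x] M[of y] by linarith+
  have "u0 x - cell_average dx u0 i = (LBINT y. u0 x * (indicator (cell dx i) y / dx)) - (LBINT y. u0 y * (indicator (cell dx i) y / dx))"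
    using k1 by (simp add: cell_average_def set_lebesgue_integral_def mult.commute)
  also have "\<dots> = (LBINT y. (u0 x - u0 y) * (indicator (cell dx i) y / dx))"
    using int[of "\<lambda>_. u0 x" M] int[of u0 M] M
    by (subst Bochner_Integration.integral_diff[symmetric]) (auto simp: left_diff_distrib diff_divide_distrib)
  also have "\<bar>\<dots>\<bar> \<le> (LBINT y. (\<bar>u0 y - u0 x\<bar> * (indicator (cell dx i) y / dx)))"
  proof (rule integral_abs_bound_integral)
    show "integrable lborel (\<lambda>y. (u0 x - u0 y) * (indicator (cell dx i) y / dx))"
      by (rule int[where C = "2 * M"]) (use d2 in auto)
    show "integrable lborel (\<lambda>y. \<bar>u0 y - u0 x\<bar> * (indicator (cell dx i) y / dx))"
      by (rule int[where C = "2 * M"]) (use d2 in auto)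
    show "\<bar>(u0 x - u0 y) * (indicator (cell dx i) y / dx)\<bar> \<le> \<bar>u0 y - u0 x\<bar> * (indicator (cell dx i) y / dx)" for y
      using \<open>0 < dx\<close> by (simp add: abs_mult abs_minus_commute)
  qed
  finally show ?thesis by (simp add: K i_def)
qed

text \<open>The averaging kernel is symmetric with marginals 1 and vanishes for points at distance
  dx or more, so the kernel estimate applies as soon as dx \<le> r.\<close>

lemma cell_averages_converge:
  fixes u0 :: "real \<Rightarrow> real"
  assumes [measurable]: "u0 \<in> borel_measurable borel" and M: "\<And>x. \<bar>u0 x\<bar> \<le> M" and "0 < m" "0 \<le> R"
  shows "\<exists>r>0. \<forall>dx. 0 < dx \<longrightarrow> dx \<le> r \<longrightarrow>
    (LBINT x. (indicator {-R..R} x * \<bar>u0 x - cell_average dx u0 \<lfloor>x / dx + 1 / 2\<rfloor>\<bar>)) \<le> m"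
proof -
  obtain r where r: "0 < r" and kernel: "\<And>K. K \<in> borel_measurable borel \<Longrightarrow> bounded_fun K \<Longrightarrow> (\<And>z. 0 \<le> K z) \<Longrightarrow>
      (\<And>x y. r < \<bar>x - y\<bar> \<Longrightarrow> K (x, y) = 0) \<Longrightarrow> (\<And>x. (LBINT y. K (x, y)) \<le> 1) \<Longrightarrow> (\<And>y. (LBINT x. K (x, y)) \<le> 1)
      \<Longrightarrow> (LBINT x. indicator {-R..R} x * (LBINT y. (\<bar>u0 y - u0 x\<bar> * K (x, y)))) \<le> m"
    using L1_kernel_approx[OF assms(1) M assms(3,4)] by (smt (verit))
  show ?thesis
  proof (intro exI[of _ r] conjI allI impI r)
    fix dx :: real assume dx: "0 < dx" "dx \<le> r"
    define K where "K = (\<lambda>p. (if \<lfloor>fst p / dx + 1 / 2\<rfloor> = \<lfloor>snd p / dx + 1 / 2\<rfloor> then 1 / dx else 0 :: real))"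
    have [measurable]: "K \<in> borel_measurable borel" unfolding K_def by measurable
    have bK: "bounded_fun K" using dx by (intro bounded_funI[of _ "1 / dx"]) (auto simp: K_def)
    have K: "K (x, y) = indicator (cell dx \<lfloor>x / dx + 1 / 2\<rfloor>) y / dx" "K (y, x) = K (x, y)" for x y
      using mem_cell_iff[OF dx(1), of y "\<lfloor>x / dx + 1 / 2\<rfloor>"] by (auto simp: K_def indicator_def)
    have Kr: "K (x, y) = 0" if "r < \<bar>x - y\<bar>" for x y
    proof (rule ccontr)
      assume "K (x, y) \<noteq> 0"
      then have "\<lfloor>x / dx + 1 / 2\<rfloor> = \<lfloor>y / dx + 1 / 2\<rfloor>" by (auto simp: K_def split: if_splits)
      then have "\<bar>x / dx - y / dx\<bar> < 1" by linarith
      then have "\<bar>x - y\<bar> < dx" using dx(1) by (simp add: diff_divide_distrib[symmetric])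
      then show False using that dx by simp
    qed
    have Ky: "(LBINT y. K (x, y)) \<le> 1" for x unfolding K(1) using cell_integral[OF dx(1)] by simp
    have Kx: "(LBINT x. K (x, y)) \<le> 1" for y using Ky[of y] by (simp add: K(2)[of _ y])
    have bu: "bounded_fun u0" using M by (rule bounded_funI)
    define P where "P = (\<lambda>p. indicator {-R..R} (fst p) * (\<bar>u0 (snd p) - u0 (fst p)\<bar> * K p))"
    have mP: "P \<in> borel_measurable borel" unfolding P_def by measurable
    have bP: "bounded_fun P" unfolding P_def by (intro bdd bu[THEN bounded_fun_compose] bK)
    have sP: "P p = 0" if "norm p > 2 * R + r" for p
    proof -
      have "\<bar>fst p\<bar> + \<bar>snd p\<bar> > 2 * R + r" using that norm_Pair_le[of "fst p" "snd p"] by simp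
      then have "R < \<bar>fst p\<bar> \<or> r < \<bar>fst p - snd p\<bar>" by linarith
      then show ?thesis using Kr[of "fst p" "snd p"] by (auto simp: P_def indicator_def)
    qed
    have Px: "(LBINT y. P (x, y)) = indicator {-R..R} x * (LBINT y. (\<bar>u0 y - u0 x\<bar> * K (x, y)))" for x
      by (simp add: P_def)
    have avg: "\<bar>cell_average dx u0 i\<bar> \<le> M" for i by (rule abs_cell_average_le[OF M assms(1) dx(1)])
    have [measurable]: "(\<lambda>x. cell_average dx u0 \<lfloor>x / dx + 1 / 2\<rfloor>) \<in> borel_measurable borel" by measurable
    have "(LBINT x. (indicator {-R..R} x * \<bar>u0 x - cell_average dx u0 \<lfloor>x / dx + 1 / 2\<rfloor>\<bar>))
      \<le> (LBINT x. (LBINT y. P (x, y)))"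
    proof (rule Bochner_Integration.integral_mono[OF _ fubini_bounded_fun_support(3)[OF mP bP sP]])
      show "integrable lborel (\<lambda>x. indicator {-R..R} x * \<bar>u0 x - cell_average dx u0 \<lfloor>x / dx + 1 / 2\<rfloor>\<bar>)"
      proof (rule integrable_bounded_support[where C = "2 * M" and R = R])
        show "\<bar>indicator {- R..R} x * \<bar>u0 x - cell_average dx u0 \<lfloor>x / dx + 1 / 2\<rfloor>\<bar>\<bar> \<le> 2 * M" for x
          using M[of x] avg[of "\<lfloor>x / dx + 1 / 2\<rfloor>"] by (auto simp: indicator_def)
      qed (auto simp: indicator_def)
      fix x
      show "indicator {-R..R} x * \<bar>u0 x - cell_average dx u0 \<lfloor>x / dx + 1 / 2\<rfloor>\<bar> \<le> (LBINT y. P (x, y))"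
        unfolding Px using cell_average_near[OF assms(1) M dx(1), of x]
        by (intro mult_left_mono) (simp_all add: K_def)
    qed
    also have "\<dots> \<le> m" unfolding Px by (rule kernel[OF _ bK _ Kr Ky Kx]) (use dx in \<open>auto simp: K_def\<close>)
    finally show "(LBINT x. (indicator {-R..R} x * \<bar>u0 x - cell_average dx u0 \<lfloor>x / dx + 1 / 2\<rfloor>\<bar>)) \<le> m" .
  qed
qed

section \<open>The reconstruction as an asymptotic entropy sequence\<close>

lemma reconstruction_eq:
  "reconstruction rnd fp fm u0 \<delta> dx dt (x, t) =
     \<delta> * of_int (scheme (num_flux rnd fp fm \<delta> dx dt) (quantised_data rnd u0 \<delta> dx) (nat \<lfloor>t / dt\<rfloor>) \<lfloor>x / dx + 1 / 2\<rfloor>)"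
  by (simp add: reconstruction_def)

lemma reconstruction_measurable [measurable]:
  "reconstruction rnd fp fm u0 \<delta> dx dt \<in> borel_measurable borel"
proof -
  define S where "S n i = \<delta> * of_int (scheme (num_flux rnd fp fm \<delta> dx dt) (quantised_data rnd u0 \<delta> dx) n i)" for n i
  have "(\<lambda>z. S (nat \<lfloor>snd z / dt\<rfloor>) \<lfloor>fst z / dx + 1 / 2\<rfloor>) \<in> borel_measurable (borel :: (real \<times> real) measure)"
  proof (rule measurable_compose_countable[where f = "\<lambda>i z. S (nat \<lfloor>snd z / dt\<rfloor>) i"])
    show "(\<lambda>z :: real \<times> real. \<lfloor>fst z / dx + 1 / 2\<rfloor>) \<in> measurable borel (count_space UNIV)" by measurable
    show "(\<lambda>z :: real \<times> real. S (nat \<lfloor>snd z / dt\<rfloor>) i) \<in> borel_measurable borel" for i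
    proof (rule measurable_compose_countable[where f = "\<lambda>j z. S (nat j) i"])
      show "(\<lambda>z :: real \<times> real. \<lfloor>snd z / dt\<rfloor>) \<in> measurable borel (count_space UNIV)" by measurable
    qed simp
  qed
  then show ?thesis by (simp add: reconstruction_def S_def case_prod_beta)
qed

text \<open>Index shifts of the scheme become translations of (x, t), the form in which the discrete
  entropy inequality takes them.\<close>

lemma reconstruction_shift:
  assumes "0 < dx" "0 < dt" "0 \<le> t"
  shows "\<lfloor>(x + dx) / dx + 1 / 2\<rfloor> = \<lfloor>x / dx + 1 / 2\<rfloor> + 1" "\<lfloor>(x - dx) / dx + 1 / 2\<rfloor> = \<lfloor>x / dx + 1 / 2\<rfloor> - 1"
    "nat \<lfloor>(t + dt) / dt\<rfloor> = Suc (nat \<lfloor>t / dt\<rfloor>)"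
proof -
  have "(x + dx) / dx + 1 / 2 = (x / dx + 1 / 2) + of_int 1" "(x - dx) / dx + 1 / 2 = (x / dx + 1 / 2) - of_int 1"
    using assms by (simp_all add: field_simps)
  then show "\<lfloor>(x + dx) / dx + 1 / 2\<rfloor> = \<lfloor>x / dx + 1 / 2\<rfloor> + 1" "\<lfloor>(x - dx) / dx + 1 / 2\<rfloor> = \<lfloor>x / dx + 1 / 2\<rfloor> - 1"
    by (simp_all only: floor_add_int[symmetric] floor_diff_of_int)
  have "(t + dt) / dt = t / dt + of_int 1" using assms by (simp add: field_simps)
  moreover have "0 \<le> \<lfloor>t / dt\<rfloor>" using assms by simp
  ultimately show "nat \<lfloor>(t + dt) / dt\<rfloor> = Suc (nat \<lfloor>t / dt\<rfloor>)"
    unfolding floor_add_int[symmetric] by (simp add: nat_add_distrib)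
qed

lemma quantised_data_error:
  assumes "nearest_rounding rnd" "0 < \<delta>"
  shows "\<bar>\<delta> * of_int (quantised_data rnd u0 \<delta> dx i) - cell_average dx u0 i\<bar> \<le> \<delta> / 2"
proof -
  define y where "y = cell_average dx u0 i / \<delta>"
  have "\<bar>of_int (rnd y) - y\<bar> \<le> 1 / 2" using assms(1) by (simp add: nearest_rounding_def)
  then have "\<delta> * \<bar>of_int (rnd y) - y\<bar> \<le> \<delta> * (1 / 2)" using assms(2) by (intro mult_left_mono) auto
  moreover have "\<delta> * \<bar>of_int (rnd y) - y\<bar> = \<bar>\<delta> * of_int (rnd y) - \<delta> * y\<bar>"
    using assms(2) by (simp add: abs_mult[symmetric] right_diff_distrib abs_mult_pos')
  moreover have "\<delta> * y = cell_average dx u0 i" using assms(2) by (simp add: y_def)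
  moreover have "quantised_data rnd u0 \<delta> dx i = rnd y" by (simp add: quantised_data_def y_def)
  ultimately show ?thesis by simp
qed

context flux_splitting
begin

lemma reconstruction_step:
  fixes u0 :: "real \<Rightarrow> real"
  assumes "nearest_rounding rnd" "0 < \<delta>" "0 < dx" "0 < dt" "0 \<le> t"
  defines "V \<equiv> reconstruction rnd fp fm u0 \<delta> dx dt"
  shows "\<bar>V (x, t + dt) - upwind (dt / dx) (V (x - dx, t)) (V (x, t)) (V (x + dx, t))\<bar> \<le> 2 * \<delta>"
  using scheme_step_error[OF assms(1,2), of fp fm dx dt "quantised_data rnd u0 \<delta> dx" "nat \<lfloor>t / dt\<rfloor>" "\<lfloor>x / dx + 1 / 2\<rfloor>"]
  unfolding V_def reconstruction_eq reconstruction_shift[OF assms(3-5)] upwind_def by simp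

text \<open>The unquantised update obeys the maximum principle, and rounding adds at most
  \<open>2 * \<delta>\<close> per step.\<close>

lemma scheme_bound:
  assumes "nearest_rounding rnd" "0 < \<delta>" "0 < dx" "0 < dt" "\<alpha> * (dt / dx) \<le> 1"
    and q0: "\<And>i. \<bar>\<delta> * of_int (q0 i)\<bar> \<le> B"
  shows "\<bar>\<delta> * of_int (scheme (num_flux rnd fp fm \<delta> dx dt) q0 n i)\<bar> \<le> B + 2 * \<delta> * real n"
proof (induction n arbitrary: i)
  case 0
  then show ?case using q0 by simp
next
  case (Suc n)
  define u where "u = (\<lambda>n i. \<delta> * of_int (scheme (num_flux rnd fp fm \<delta> dx dt) q0 n i))"
  have IH: "\<bar>u n j\<bar> \<le> B + 2 * \<delta> * real n" for j using Suc.IH by (simp add: u_def)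
  have "\<bar>upwind (dt / dx) (u n (i - 1)) (u n i) (u n (i + 1))\<bar> \<le> B + 2 * \<delta> * real n"
    using assms(3-5) by (intro upwind_bound IH) (auto simp: mult.commute)
  moreover have "\<bar>u (Suc n) i - upwind (dt / dx) (u n (i - 1)) (u n i) (u n (i + 1))\<bar> \<le> 2 * \<delta>"
    using scheme_step_error[OF assms(1,2)] unfolding u_def upwind_def .
  ultimately have "\<bar>u (Suc n) i\<bar> \<le> B + 2 * \<delta> * real n + 2 * \<delta>" by linarith
  then show ?case by (simp add: u_def algebra_simps)
qed

text \<open>Up to time T there are at most T / dt steps, whose rounding adds at most 1/2; rounding
  the initial data adds \<delta> / 2 \<le> 1/2. Together they make up the 1 in M0 + 1.\<close>

lemma reconstruction_bound:
  assumes "nearest_rounding rnd" "0 < \<delta>" "0 < dx" "0 < dt" "\<alpha> * (dt / dx) \<le> 1"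
    and u0: "u0 \<in> borel_measurable borel" "\<And>x. \<bar>u0 x\<bar> \<le> M0" and t: "0 \<le> t" "t \<le> T"
    and small: "\<delta> \<le> 1" "2 * (\<delta> / dt) * T \<le> 1 / 2"
  shows "\<bar>reconstruction rnd fp fm u0 \<delta> dx dt (x, t)\<bar> \<le> M0 + 1"
proof -
  have "\<bar>\<delta> * of_int (quantised_data rnd u0 \<delta> dx i)\<bar> \<le> M0 + \<delta> / 2" for i
    using quantised_data_error[OF assms(1,2), of u0 dx i] abs_cell_average_le[OF u0(2,1) assms(3), of i] by linarith
  from scheme_bound[OF assms(1-5) this]
  have "\<bar>reconstruction rnd fp fm u0 \<delta> dx dt (x, t)\<bar> \<le> M0 + \<delta> / 2 + 2 * \<delta> * real (nat \<lfloor>t / dt\<rfloor>)"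
    by (simp add: reconstruction_eq)
  also have "2 * \<delta> * real (nat \<lfloor>t / dt\<rfloor>) \<le> 2 * \<delta> * (T / dt)"
  proof (intro mult_left_mono)
    have "real (nat \<lfloor>t / dt\<rfloor>) \<le> t / dt" using t assms(4) by (simp add: of_nat_floor)
    also have "\<dots> \<le> T / dt" using t assms(4) by (simp add: divide_right_mono)
    finally show "real (nat \<lfloor>t / dt\<rfloor>) \<le> T / dt" .
  qed (use assms(2) in simp)
  also have "2 * \<delta> * (T / dt) \<le> 1 / 2" using small(2) by (simp add: mult_ac)
  finally show ?thesis using small(1) by linarith
qed

text \<open>m accounts for the averaging over cells, and R \<delta> for rounding errors of at most
  \<delta> / 2 on an interval of length 2 R.\<close>

lemma initial_reconstruction_converges:
  assumes "nearest_rounding rnd" and u0 [measurable]: "u0 \<in> borel_measurable borel" and M0: "\<And>x. \<bar>u0 x\<bar> \<le> M0"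
    and "0 < m" "0 \<le> R"
  shows "\<exists>r>0. \<forall>\<delta> dx dt. 0 < \<delta> \<longrightarrow> 0 < dx \<longrightarrow> dx \<le> r \<longrightarrow>
    (LBINT x. (indicator {-R..R} x * \<bar>u0 x - reconstruction rnd fp fm u0 \<delta> dx dt (x, 0)\<bar>)) \<le> m + R * \<delta>"
proof -
  obtain r where r: "0 < r" and avg: "\<And>dx. 0 < dx \<Longrightarrow> dx \<le> r \<Longrightarrow>
    (LBINT x. (indicator {-R..R} x * \<bar>u0 x - cell_average dx u0 \<lfloor>x / dx + 1 / 2\<rfloor>\<bar>)) \<le> m"
    using cell_averages_converge[OF u0 M0 assms(4,5)] by blast
  show ?thesis
  proof (intro exI[of _ r] conjI allI impI r)
    fix \<delta> dx dt :: real assume g: "0 < \<delta>" "0 < dx" "dx \<le> r"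
    define V where "V x = reconstruction rnd fp fm u0 \<delta> dx dt (x, 0)" for x
    define a where "a x = cell_average dx u0 \<lfloor>x / dx + 1 / 2\<rfloor>" for x
    have mV [measurable]: "V \<in> borel_measurable borel" unfolding V_def by measurable
    have ma [measurable]: "a \<in> borel_measurable borel" unfolding a_def by measurable
    have Va: "\<bar>V x - a x\<bar> \<le> \<delta> / 2" for x
      using quantised_data_error[OF assms(1) g(1), of u0 dx "\<lfloor>x / dx + 1 / 2\<rfloor>"] by (simp add: V_def a_def reconstruction_eq)
    have aM: "\<bar>a x\<bar> \<le> M0" for x unfolding a_def by (rule abs_cell_average_le[OF M0 u0 g(2)])
    have i1: "integrable lborel (\<lambda>x. indicator {-R..R} x * \<bar>u0 x - a x\<bar>)"
    proof (rule integrable_bounded_support[where C = "2 * M0" and R = R])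
      show "\<bar>indicator {-R..R} x * \<bar>u0 x - a x\<bar>\<bar> \<le> 2 * M0" for x using M0[of x] aM[of x] by (auto simp: indicator_def)
    qed (auto simp: indicator_def)
    have i2: "integrable lborel (\<lambda>x. indicator {-R..R} x * (\<delta> / 2))"
      by (intro integrable_mult_left integrable_real_indicator) (auto simp: emeasure_lborel_Icc_eq)
    have "(LBINT x. (indicator {-R..R} x * \<bar>u0 x - V x\<bar>))
      \<le> (LBINT x. (indicator {-R..R} x * \<bar>u0 x - a x\<bar> + indicator {-R..R} x * (\<delta> / 2)))"
    proof (rule Bochner_Integration.integral_mono)
      show "integrable lborel (\<lambda>x. indicator {-R..R} x * \<bar>u0 x - V x\<bar>)"
      proof (rule integrable_bounded_support[where C = "2 * M0 + \<delta> / 2" and R = R])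
        show "\<bar>indicator {-R..R} x * \<bar>u0 x - V x\<bar>\<bar> \<le> 2 * M0 + \<delta> / 2" for x
        proof -
          have "\<bar>u0 x - V x\<bar> \<le> 2 * M0 + \<delta> / 2" using M0[of x] aM[of x] Va[of x] by linarith
          moreover have "0 \<le> 2 * M0 + \<delta> / 2" using M0[of x] g(1) by linarith
          ultimately show ?thesis by (simp add: indicator_def)
        qed
      qed (auto simp: indicator_def)
      show "integrable lborel (\<lambda>x. indicator {-R..R} x * \<bar>u0 x - a x\<bar> + indicator {-R..R} x * (\<delta> / 2))"
        using i1 i2 by (rule Bochner_Integration.integrable_add)
      show "indicator {-R..R} x * \<bar>u0 x - V x\<bar> \<le> indicator {-R..R} x * \<bar>u0 x - a x\<bar> + indicator {-R..R} x * (\<delta> / 2)" for x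
      proof -
        have "\<bar>u0 x - V x\<bar> \<le> \<bar>u0 x - a x\<bar> + \<delta> / 2" using Va[of x] by linarith
        then show ?thesis by (simp add: indicator_def)
      qed
    qed
    also have "\<dots> = (LBINT x. (indicator {-R..R} x * \<bar>u0 x - a x\<bar>)) + R * \<delta>"
      using i1 i2 \<open>0 \<le> R\<close> by simp
    also have "\<dots> \<le> m + R * \<delta>" using avg[OF g(2,3)] by (simp add: a_def)
    finally show "(LBINT x. (indicator {-R..R} x * \<bar>u0 x - reconstruction rnd fp fm u0 \<delta> dx dt (x, 0)\<bar>)) \<le> m + R * \<delta>"
      by (simp add: V_def)
  qed
qed

lemma reconstruction_eventually_bounded:
  fixes \<delta> dx dt :: "nat \<Rightarrow> real"
  assumes "nearest_rounding rnd" and u0: "u0 \<in> borel_measurable borel" "\<And>x. \<bar>u0 x\<bar> \<le> M0"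
    and grid: "\<And>n. 0 < \<delta> n" "\<And>n. 0 < dx n" "\<And>n. 0 < dt n" "\<And>n. \<alpha> * (dt n / dx n) \<le> 1"
    and lim: "\<delta> \<longlonglongrightarrow> 0" "(\<lambda>n. \<delta> n / dt n) \<longlonglongrightarrow> 0"
  shows "\<forall>\<^sub>F n in sequentially. \<forall>x t. 0 \<le> t \<longrightarrow> t \<le> T \<longrightarrow>
    \<bar>reconstruction rnd fp fm u0 (\<delta> n) (dx n) (dt n) (x, t)\<bar> \<le> M0 + 1"
proof -
  have "(\<lambda>n. 2 * (\<delta> n / dt n) * T) \<longlonglongrightarrow> 2 * 0 * T" by (intro tendsto_intros lim)
  then have "\<forall>\<^sub>F n in sequentially. 2 * (\<delta> n / dt n) * T < 1 / 2" by (intro order_tendstoD(2)) auto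
  moreover have "\<forall>\<^sub>F n in sequentially. \<delta> n < 1" using lim(1) by (intro order_tendstoD(2)) auto
  ultimately show ?thesis
  proof eventually_elim
    case (elim n)
    then show ?case using reconstruction_bound[OF assms(1) grid u0] by force
  qed
qed

text \<open>The defect has four sources: the modulus of continuity of the test functions, the
  accumulated rounding errors of order \<delta> / dt, the approximation of the initial data, and the
  initial strip. Each is allotted e/4.\<close>

lemma reconstruction_asymptotic_entropy:
  fixes \<delta> dx dt :: "nat \<Rightarrow> real"
  assumes rnd: "nearest_rounding rnd" and u0 [measurable]: "u0 \<in> borel_measurable borel" and M0: "\<And>x. \<bar>u0 x\<bar> \<le> M0"
    and grid: "\<And>n. 0 < \<delta> n" "\<And>n. 0 < dx n" "\<And>n. 0 < dt n" "\<And>n. \<alpha> * (dt n / dx n) \<le> 1"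
    and lim: "\<delta> \<longlonglongrightarrow> 0" "dx \<longlonglongrightarrow> 0" "dt \<longlonglongrightarrow> 0" "(\<lambda>n. \<delta> n / dt n) \<longlonglongrightarrow> 0"
  shows "asymptotic_entropy u0 (M0 + 1) (\<lambda>n z. clamp_to (M0 + 1) (reconstruction rnd fp fm u0 (\<delta> n) (dx n) (dt n) z))"
  unfolding asymptotic_entropy_def
proof (intro conjI allI impI)
  define M where "M = M0 + 1"
  have M: "0 \<le> M" "\<bar>u0 x\<bar> \<le> M" for x using M0[of 0] M0[of x] by (auto simp: M_def)
  define V where "V n = reconstruction rnd fp fm u0 (\<delta> n) (dx n) (dt n)" for n
  define v where "v n z = clamp_to M (V n z)" for n z
  have mV [measurable]: "V n \<in> borel_measurable borel" for n unfolding V_def by measurable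
  have mv: "v n \<in> borel_measurable borel" for n unfolding v_def by measurable
  have vM: "\<bar>v n z\<bar> \<le> M" for n z unfolding v_def using M(1) by (rule abs_clamp_to)
  show "(\<lambda>z. clamp_to (M0 + 1) (reconstruction rnd fp fm u0 (\<delta> n) (dx n) (dt n) z)) \<in> borel_measurable borel" for n
    by measurable
  show "\<bar>clamp_to (M0 + 1) (reconstruction rnd fp fm u0 (\<delta> n) (dx n) (dt n) z)\<bar> \<le> M0 + 1" for n z
    using M(1) unfolding M_def by (rule abs_clamp_to)
  fix B e :: real and \<Phi> assume \<Phi>: "tame_family \<Phi>" and e: "0 < e"
  obtain R1 L1 where RL: "\<forall>(\<phi>, \<phi>x, \<phi>t) \<in> \<Phi>. \<forall>z.
        0 \<le> \<phi> z \<and> \<bar>\<phi> z\<bar> \<le> L1 \<and> \<bar>\<phi>x z\<bar> \<le> L1 \<and> \<bar>\<phi>t z\<bar> \<le> L1 \<and>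
        (\<phi> has_derivative (\<lambda>h. \<phi>x z * fst h + \<phi>t z * snd h)) (at z) \<and>
        (norm z > R1 \<longrightarrow> \<phi> z = 0 \<and> \<phi>x z = 0 \<and> \<phi>t z = 0)"
    and U: "\<forall>d>0. \<exists>r>0. \<forall>(\<phi>, \<phi>x, \<phi>t) \<in> \<Phi>. \<forall>z z'. dist z z' < r \<longrightarrow>
          \<bar>\<phi>x z - \<phi>x z'\<bar> \<le> d \<and> \<bar>\<phi>t z - \<phi>t z'\<bar> \<le> d"
    using \<Phi> unfolding tame_family_def by blast
  \<comment> \<open>The maxima with 0 supply signs: R1 and B may be negative, and so may L1 if the
    family is empty.\<close>
  define R where "R = max R1 0"
  define L where "L = max L1 0"
  define B' where "B' = max B 0"
  have nn: "0 \<le> R" "0 \<le> L" "0 \<le> B'" by (auto simp: R_def L_def B'_def)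
  define A where "A = measure lborel (cball (0::real \<times> real) (R + 1))"
  have A: "0 \<le> A" by (simp add: A_def)
  define c where "c = (M + B') * (1 + \<alpha>) * A"
  have "0 \<le> c" using M(1) nn A pos by (simp add: c_def)
  then obtain d where d: "0 < d" "c * d \<le> e / 4" using exists_small_factor[of "e / 4" c] e by auto
  from U[THEN spec, THEN mp, OF d(1)]
  obtain r where r: "0 < r" and modulus: "\<forall>(\<phi>, \<phi>x, \<phi>t) \<in> \<Phi>. \<forall>z z'. dist z z' < r \<longrightarrow>
          \<bar>\<phi>x z - \<phi>x z'\<bar> \<le> d \<and> \<bar>\<phi>t z - \<phi>t z'\<bar> \<le> d" by blast
  obtain m where m: "0 < m" "L * m \<le> e / 8" using exists_small_factor[of "e / 8" L] e nn by auto
  obtain r0 where r0: "0 < r0" and init: "\<And>\<delta> dx dt. 0 < \<delta> \<Longrightarrow> 0 < dx \<Longrightarrow> dx \<le> r0 \<Longrightarrow>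
    (LBINT x. (indicator {-R..R} x * \<bar>u0 x - reconstruction rnd fp fm u0 \<delta> dx dt (x, 0)\<bar>)) \<le> m + R * \<delta>"
    using initial_reconstruction_converges[OF rnd u0 M0 m(1) nn(1)] by blast
  have "(\<lambda>n. dx n + dt n) \<longlonglongrightarrow> 0 + 0" by (intro tendsto_intros lim)
  then have E1: "\<forall>\<^sub>F n in sequentially. dx n + dt n < r" using r by (intro order_tendstoD(2)) auto
  have E2: "\<forall>\<^sub>F n in sequentially. dx n < min (1 / 2) r0" using lim(2) r0 by (intro order_tendstoD(2)) auto
  have E3: "\<forall>\<^sub>F n in sequentially. dt n < 1 / 2" using lim(3) by (intro order_tendstoD(2)) auto
  have "(\<lambda>n. 2 * (\<delta> n / dt n) * L * A) \<longlonglongrightarrow> 2 * 0 * L * A" by (intro tendsto_intros lim)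
  then have E4: "\<forall>\<^sub>F n in sequentially. 2 * (\<delta> n / dt n) * L * A < e / 4" using e by (intro order_tendstoD(2)) auto
  have "(\<lambda>n. L * (R * \<delta> n)) \<longlonglongrightarrow> L * (R * 0)" by (intro tendsto_intros lim)
  then have E5: "\<forall>\<^sub>F n in sequentially. L * (R * \<delta> n) < e / 8" using e by (intro order_tendstoD(2)) auto
  have "(\<lambda>n. (M + B') * L * dt n * (2 * R)) \<longlonglongrightarrow> (M + B') * L * 0 * (2 * R)" by (intro tendsto_intros lim)
  then have E6: "\<forall>\<^sub>F n in sequentially. (M + B') * L * dt n * (2 * R) < e / 4" using e by (intro order_tendstoD(2)) auto
  note E7 = reconstruction_eventually_bounded[OF rnd u0 M0 grid lim(1,4), of R]
  show "\<forall>\<^sub>F n in sequentially. \<forall>k. \<bar>k\<bar> \<le> B \<longrightarrow> (\<forall>(\<phi>, \<phi>x, \<phi>t) \<in> \<Phi>. - e \<le> entropy_functional f u0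
    (\<lambda>z. clamp_to (M0 + 1) (reconstruction rnd fp fm u0 (\<delta> n) (dx n) (dt n) z)) k \<phi> \<phi>x \<phi>t)"
    using E1 E2 E3 E4 E5 E6 E7
  proof eventually_elim
    case (elim n)
    \<comment> \<open>Up to time R clamping changes nothing, so \<open>v n\<close> inherits the
      scheme relation there; beyond R all test functions of the family vanish.\<close>
    have vV: "v n (x, t) = V n (x, t)" if "0 \<le> t" "t \<le> R" for x t
      using elim(7) that by (simp add: v_def V_def M_def clamp_to_id)
    have main: "- e \<le> entropy_functional f u0 (v n) k \<phi> \<phi>x \<phi>t" if k: "\<bar>k\<bar> \<le> B" and \<phi>: "(\<phi>, \<phi>x, \<phi>t) \<in> \<Phi>" for k \<phi> \<phi>x \<phi>t
    proof -
      have \<phi>L: "\<And>z. \<bar>\<phi> z\<bar> \<le> L1" "\<And>z. \<bar>\<phi>t z\<bar> \<le> L1" "\<And>z. norm z > R1 \<Longrightarrow> \<phi> z = 0 \<and> \<phi>x z = 0 \<and> \<phi>t z = 0"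
        using RL \<phi> by fast+
      have mod': "\<And>z z'. dist z z' < r \<Longrightarrow> \<bar>\<phi>x z - \<phi>x z'\<bar> \<le> d \<and> \<bar>\<phi>t z - \<phi>t z'\<bar> \<le> d"
        using modulus \<phi> by fast
      define D where "D = (LBINT x. (indicator {-R..R} x * \<bar>u0 x - v n (x, 0)\<bar>))"
      have "- ((d * ((M + B') * (1 + \<alpha>)) + 2 * \<delta> n / dt n * L) * A + L * D + (M + B') * L * dt n * (2 * R))
        \<le> entropy_functional f u0 (v n) k \<phi> \<phi>x \<phi>t"
        unfolding A_def D_def
      proof (rule entropy_functional_lower_bound[OF mv u0 vM M(2) _ tame_family_imp_test_function[OF \<Phi> \<phi>]])
        show "\<bar>k\<bar> \<le> B'" using k by (simp add: B'_def)
        show "\<bar>\<phi> z\<bar> \<le> L" "\<bar>\<phi>t z\<bar> \<le> L" for z using \<phi>L(1,2)[of z] by (auto simp: L_def le_max_iff_disj)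
        show "\<phi> z = 0 \<and> \<phi>x z = 0 \<and> \<phi>t z = 0" if "R < norm z" for z using \<phi>L(3)[of z] that by (simp add: R_def)
        show "\<bar>\<phi>x z - \<phi>x z'\<bar> \<le> d \<and> \<bar>\<phi>t z - \<phi>t z'\<bar> \<le> d" if "dist z z' < r" for z z' using mod' that by blast
        show "\<bar>v n (x, t + dt n) - upwind (dt n / dx n) (v n (x - dx n, t)) (v n (x, t)) (v n (x + dx n, t))\<bar> \<le> 2 * \<delta> n"
          if "0 \<le> t" "t + dt n \<le> R" for x t
        proof -
          have t: "t \<le> R" "0 \<le> t + dt n" using that grid(3)[of n] by linarith+
          show ?thesis
            unfolding vV[OF t(2) that(2)] vV[OF that(1) t(1)] V_def
            by (rule reconstruction_step[OF rnd grid(1-3) that(1)])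
        qed
        show "v n (x, t) = v n (x, 0)" if "0 \<le> t" "t < dt n" for x t
        proof -
          have "\<lfloor>t / dt n\<rfloor> = 0" using that by (simp add: floor_eq_iff)
          then show ?thesis by (simp add: v_def V_def reconstruction_eq)
        qed
      qed (use grid[of n] elim nn in auto)
      moreover have "D \<le> m + R * \<delta> n"
        unfolding D_def vV[OF order_refl nn(1)] V_def using elim(2) by (intro init grid) auto
      then have "L * D \<le> L * m + L * (R * \<delta> n)" using mult_left_mono[OF _ nn(2)] by (metis distrib_left)
      moreover have "(d * ((M + B') * (1 + \<alpha>)) + 2 * \<delta> n / dt n * L) * A = c * d + 2 * (\<delta> n / dt n) * L * A"
        by (simp add: c_def algebra_simps)
      ultimately show ?thesis using d(2) m(2) elim(4,5,6) by linarith
    qed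
    then show ?case unfolding v_def V_def M_def by blast
  qed
qed

end

section \<open>Change of representative of the initial data, and the theorem\<close>

text \<open>Data in L infinity are bounded only almost everywhere, whereas the estimates above ask
  for a bound at every point. This and the next lemma permit passing to a bounded
  representative.\<close>

lemma (in lipschitz_flux) entropy_solution_cong_initial:
  assumes "u0 \<in> borel_measurable borel" "u0' \<in> borel_measurable borel" "AE x in lborel. u0 x = u0' x"
  shows "entropy_solution f u0 u \<longleftrightarrow> entropy_solution f u0' u"
proof (cases "L_infinity_on half_plane u")
  case True
  then have "u \<in> borel_measurable borel" by (simp add: L_infinity_on_def)
  then have "entropy_functional f u0 u k \<phi> \<phi>x \<phi>t = entropy_functional f u0' u k \<phi> \<phi>x \<phi>t"
    if "test_function \<phi> \<phi>x \<phi>t" for k \<phi> \<phi>x \<phi>t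
    by (intro entropy_functional_cong_AE assms that) auto
  then show ?thesis by (auto simp: entropy_solution_iff)
qed (simp add: entropy_solution_iff)

lemma quantised_data_cong_AE:
  assumes [measurable]: "u0 \<in> borel_measurable borel" "u0' \<in> borel_measurable borel"
    and "AE x in lborel. u0 x = u0' x"
  shows "quantised_data rnd u0 \<delta> dx = quantised_data rnd u0' \<delta> dx"
proof -
  have [measurable]: "cell dx i \<in> sets borel" for i by (simp add: cell_def)
  have "(LBINT x. indicator (cell dx i) x *\<^sub>R u0 x) = (LBINT x. indicator (cell dx i) x *\<^sub>R u0' x)" for i
    using assms(3) by (intro integral_cong_AE) (auto elim!: eventually_mono)
  then have "cell_average dx u0 i = cell_average dx u0' i" for i
    by (simp add: cell_average_def set_lebesgue_integral_def)
  then show ?thesis by (auto simp: quantised_data_def)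
qed

lemma (in flux_splitting) scheme_convergence:
  assumes rnd: "nearest_rounding rnd" and \<nu>: "0 < \<nu>" "\<nu> \<le> 1"
    and u0: "u0 \<in> borel_measurable borel" "\<And>x. \<bar>u0 x\<bar> \<le> M0"
  shows "\<exists>u. entropy_solution f u0 u
    \<and> (\<forall>v. entropy_solution f u0 v \<longrightarrow> (AE z in lborel. z \<in> half_plane \<longrightarrow> v z = u z))
    \<and> (\<forall>\<delta> dx dt. (\<forall>k. admissible_grid \<alpha> \<nu> (\<delta> k) (dx k) (dt k)) \<longrightarrow> \<delta> \<longlonglongrightarrow> 0 \<longrightarrow> dx \<longlonglongrightarrow> 0 \<longrightarrow> dt \<longlonglongrightarrow> 0 \<longrightarrow>
         (\<lambda>k. \<delta> k / dx k) \<longlonglongrightarrow> 0 \<longrightarrow>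
         tendsto_L1_loc (\<lambda>k. reconstruction rnd fp fm u0 (\<delta> k) (dx k) (dt k)) u)"
proof -
  have M: "\<bar>u0 x\<bar> \<le> M0 + 1" for x using u0(2)[of x] by linarith
  have grid: "0 < \<delta> k" "0 < dx k" "0 < dt k" "\<alpha> * (dt k / dx k) \<le> 1" "\<delta> k / dt k = \<alpha> / \<nu> * (\<delta> k / dx k)"
    if "\<And>k. admissible_grid \<alpha> \<nu> (\<delta> k) (dx k) (dt k)" for \<delta> dx dt :: "nat \<Rightarrow> real" and k
  proof -
    show p: "0 < \<delta> k" "0 < dx k" "0 < dt k" using that[of k] by (auto simp: admissible_grid_def)
    have e: "\<alpha> * dt k / dx k = \<nu>" using that[of k] by (simp add: admissible_grid_def)
    then show "\<alpha> * (dt k / dx k) \<le> 1" using \<nu> by simp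
    show "\<delta> k / dt k = \<alpha> / \<nu> * (\<delta> k / dx k)" using p pos unfolding e[symmetric] by (simp add: field_simps)
  qed
  have lim: "(\<lambda>k. \<delta> k / dt k) \<longlonglongrightarrow> 0"
    if "\<And>k. admissible_grid \<alpha> \<nu> (\<delta> k) (dx k) (dt k)" "(\<lambda>k. \<delta> k / dx k) \<longlonglongrightarrow> 0" for \<delta> dx dt :: "nat \<Rightarrow> real"
  proof -
    have e: "(\<lambda>k. \<delta> k / dt k) = (\<lambda>k. \<alpha> / \<nu> * (\<delta> k / dx k))" using grid(5)[where \<delta> = \<delta> and dx = dx and dt = dt, OF that(1)] by (intro ext)
    show ?thesis unfolding e by (rule tendsto_mult_right_zero[OF that(2)])
  qed
  have AE: "asymptotic_entropy u0 (M0 + 1) (\<lambda>n z. clamp_to (M0 + 1) (reconstruction rnd fp fm u0 (\<delta> n) (dx n) (dt n) z))"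
    if g: "\<And>k. admissible_grid \<alpha> \<nu> (\<delta> k) (dx k) (dt k)"
      and l: "\<delta> \<longlonglongrightarrow> 0" "dx \<longlonglongrightarrow> 0" "dt \<longlonglongrightarrow> 0" "(\<lambda>k. \<delta> k / dx k) \<longlonglongrightarrow> 0" for \<delta> dx dt
    by (rule reconstruction_asymptotic_entropy[OF rnd u0 grid(1-4)[where \<delta> = \<delta> and dx = dx and dt = dt, OF g] l(1-3) lim[where \<delta> = \<delta> and dx = dx and dt = dt, OF g l(4)]])
  \<comment> \<open>One concrete admissible sequence, \<delta> = h^2, dx = h and dt = \<nu> h /
    \<alpha>, serves to construct u; every other admissible sequence is then shown to converge to
    this same u.\<close>
  define h :: "nat \<Rightarrow> real" where "h n = inverse (real (Suc n))" for n
  have h: "h \<longlonglongrightarrow> 0" unfolding h_def by (rule LIMSEQ_inverse_real_of_nat)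
  have hg: "admissible_grid \<alpha> \<nu> (h n * h n) (h n) (\<nu> / \<alpha> * h n)" for n
    using \<nu> pos by (simp add: admissible_grid_def h_def)
  have "(\<lambda>n. h n * h n) \<longlonglongrightarrow> 0 * 0" "(\<lambda>n. \<nu> / \<alpha> * h n) \<longlonglongrightarrow> \<nu> / \<alpha> * 0" by (intro tendsto_intros h)+
  moreover have "(\<lambda>n. h n * h n / h n) = h" by (auto simp: h_def)
  ultimately have "asymptotic_entropy u0 (M0 + 1)
      (\<lambda>n z. clamp_to (M0 + 1) (reconstruction rnd fp fm u0 (h n * h n) (h n) (\<nu> / \<alpha> * h n) z))"
    using h hg by (intro AE) auto
  from asymptotic_entropy_limit[OF u0(1) M this]
  obtain u where u: "entropy_solution f u0 u" "\<And>z. \<bar>u z\<bar> \<le> M0 + 1" by blast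
  show ?thesis
  proof (intro exI[of _ u] conjI allI impI)
    show "entropy_solution f u0 u" by (rule u(1))
    show "AE z in lborel. z \<in> half_plane \<longrightarrow> v z = u z" if "entropy_solution f u0 v" for v
      by (rule entropy_solution_unique[OF u0 u(1) that])
    fix \<delta> dx dt :: "nat \<Rightarrow> real"
    assume "\<forall>k. admissible_grid \<alpha> \<nu> (\<delta> k) (dx k) (dt k)" and l: "\<delta> \<longlonglongrightarrow> 0" "dx \<longlonglongrightarrow> 0" "dt \<longlonglongrightarrow> 0" "(\<lambda>k. \<delta> k / dx k) \<longlonglongrightarrow> 0"
    then have g: "\<And>k. admissible_grid \<alpha> \<nu> (\<delta> k) (dx k) (dt k)" by blast
    show "tendsto_L1_loc (\<lambda>k. reconstruction rnd fp fm u0 (\<delta> k) (dx k) (dt k)) u"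
    proof (rule asymptotic_entropy_tendsto[OF u0(1) M AE[where \<delta> = \<delta> and dx = dx and dt = dt, OF g l] u])
      fix \<rho> :: real
      show "\<forall>\<^sub>F k in sequentially. \<forall>z\<in>window \<rho>. reconstruction rnd fp fm u0 (\<delta> k) (dx k) (dt k) z
        = clamp_to (M0 + 1) (reconstruction rnd fp fm u0 (\<delta> k) (dx k) (dt k) z)"
        using reconstruction_eventually_bounded[OF rnd u0 grid(1-4)[where \<delta> = \<delta> and dx = dx and dt = dt, OF g] l(1) lim[where \<delta> = \<delta> and dx = dx and dt = dt, OF g l(4)], of \<rho>]
        by eventually_elim (auto simp: clamp_to_id)
    qed
  qed
qed

lemma nondecreasing_of_nonneg_derivative:
  fixes g g' :: "real \<Rightarrow> real"
  assumes "\<And>u. (g has_real_derivative g' u) (at u)" "\<And>u. 0 \<le> g' u" "a \<le> b"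
  shows "g a \<le> g b"
  using assms by (intro DERIV_nonneg_imp_nondecreasing[of a b g]) auto

theorem theorem2p7:
  fixes f f' fp fp' fm fm' :: "real \<Rightarrow> real"
    and rnd :: "real \<Rightarrow> int" and \<alpha> \<nu> :: real
  assumes "nearest_rounding rnd"
    and "\<And>u. (f has_real_derivative f' u) (at u)"
    and "continuous_on UNIV f'"
    and "bounded (range f')"
    and "\<And>u. f u = fp u + fm u"
    and "\<And>u. (fp has_real_derivative fp' u) (at u)"
    and "\<And>u. (fm has_real_derivative fm' u) (at u)"
    and "\<And>u. 0 \<le> fp' u"
    and "\<And>u. fm' u \<le> 0"
    and "0 < \<alpha>"
    and "\<And>u. \<bar>f' u\<bar> \<le> \<alpha>"
    and "0 < \<nu>" and "\<nu> \<le> 1"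
  shows "(\<forall>\<delta> dx dt. admissible_grid \<alpha> \<nu> \<delta> dx dt \<longrightarrow> monotone_flux (num_flux rnd fp fm \<delta> dx dt))
    \<and> consistent_flux rnd f fp fm \<alpha> \<nu>
    \<and> ((\<forall>u. fp' u - fm' u \<le> \<alpha>) \<longrightarrow>
        (\<forall>u0. L_infinity_on UNIV u0 \<longrightarrow>
          (\<exists>u. entropy_solution f u0 u
             \<and> (\<forall>v. entropy_solution f u0 v \<longrightarrow> (AE z in lborel. z \<in> half_plane \<longrightarrow> v z = u z))
             \<and> (\<forall>\<delta> dx dt :: nat \<Rightarrow> real.
                  (\<forall>k. admissible_grid \<alpha> \<nu> (\<delta> k) (dx k) (dt k))
                  \<and> \<delta> \<longlonglongrightarrow> 0 \<and> dx \<longlonglongrightarrow> 0 \<and> dt \<longlonglongrightarrow> 0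
                  \<and> (\<lambda>k. \<delta> k / dx k) \<longlonglongrightarrow> 0 \<longrightarrow>
                  (\<exists>r. strict_mono r
                     \<and> tendsto_L1_loc
                         (\<lambda>k. reconstruction rnd fp fm u0 (\<delta> (r k)) (dx (r k)) (dt (r k))) u)))))"
proof (intro conjI)
  have fp_mono: "fp a \<le> fp b" if "a \<le> b" for a b
    using nondecreasing_of_nonneg_derivative[OF assms(6,8) that] .
  have fm_anti: "fm b \<le> fm a" if "a \<le> b" for a b
    using nondecreasing_of_nonneg_derivative[of "\<lambda>u. - fm u" "\<lambda>u. - fm' u", OF DERIV_minus[OF assms(7)] _ that] assms(9) by simp
  show "\<forall>\<delta> dx dt. admissible_grid \<alpha> \<nu> \<delta> dx dt \<longrightarrow> monotone_flux (num_flux rnd fp fm \<delta> dx dt)"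
    using assms(1) fp_mono fm_anti
    by (auto simp: admissible_grid_def nearest_rounding_def intro!: monotone_num_flux monoI antimonoI)
  show "consistent_flux rnd f fp fm \<alpha> \<nu>"
    by (rule consistent_num_flux[OF assms(1) assms(5) assms(10) assms(12)])
  show "(\<forall>u. fp' u - fm' u \<le> \<alpha>) \<longrightarrow>
        (\<forall>u0. L_infinity_on UNIV u0 \<longrightarrow>
          (\<exists>u. entropy_solution f u0 u
             \<and> (\<forall>v. entropy_solution f u0 v \<longrightarrow> (AE z in lborel. z \<in> half_plane \<longrightarrow> v z = u z))
             \<and> (\<forall>\<delta> dx dt :: nat \<Rightarrow> real.
                  (\<forall>k. admissible_grid \<alpha> \<nu> (\<delta> k) (dx k) (dt k))
                  \<and> \<delta> \<longlonglongrightarrow> 0 \<and> dx \<longlonglongrightarrow> 0 \<and> dt \<longlonglongrightarrow> 0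
                  \<and> (\<lambda>k. \<delta> k / dx k) \<longlonglongrightarrow> 0 \<longrightarrow>
                  (\<exists>r. strict_mono r
                     \<and> tendsto_L1_loc
                         (\<lambda>k. reconstruction rnd fp fm u0 (\<delta> (r k)) (dx (r k)) (dt (r k))) u))))"
  proof (intro impI allI)
    fix u0 :: "real \<Rightarrow> real"
    assume CFL: "\<forall>u. fp' u - fm' u \<le> \<alpha>" and u0: "L_infinity_on UNIV u0"
    interpret flux_splitting f fp fm \<alpha>
    proof
      fix a b :: real assume "a \<le> b"
      \<comment> \<open>The hypothesis on fp' - fm' is integrated by noting that this function is
        nondecreasing.\<close>
      have "((\<lambda>u. \<alpha> * u - fp u + fm u) has_real_derivative (\<alpha> - fp' u + fm' u)) (at u)" for u
        using assms(6,7) by (auto intro!: derivative_eq_intros)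
      from nondecreasing_of_nonneg_derivative[OF this _ \<open>a \<le> b\<close>]
      have "\<alpha> * a - fp a + fm a \<le> \<alpha> * b - fp b + fm b" using CFL by (simp add: algebra_simps)
      then show "fp b - fp a + (fm a - fm b) \<le> \<alpha> * (b - a)" by (simp add: algebra_simps)
    qed (use assms(5,10) fp_mono fm_anti in auto)
    have mu [measurable]: "u0 \<in> borel_measurable borel" using u0 by (simp add: L_infinity_on_def)
    obtain M1 where M1: "AE x in lborel. \<bar>u0 x\<bar> \<le> M1" using u0 by (auto simp: L_infinity_on_def)
    define M0 where "M0 = max M1 0"
    \<comment> \<open>The bounded representative: it has the same cell averages and the same entropy
      solutions as u0.\<close>
    define w where "w x = clamp_to M0 (u0 x)" for x
    have mw: "w \<in> borel_measurable borel" unfolding w_def by measurable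
    have wM: "\<bar>w x\<bar> \<le> M0" for x unfolding w_def by (rule abs_clamp_to) (simp add: M0_def)
    have ae: "AE x in lborel. u0 x = w x"
      using M1 by eventually_elim (simp add: w_def M0_def clamp_to_id le_max_iff_disj)
    have es: "entropy_solution f u0 = entropy_solution f w"
      using entropy_solution_cong_initial[OF mu mw ae] by auto
    have rec: "reconstruction rnd fp fm u0 = reconstruction rnd fp fm w"
      by (intro ext) (simp add: reconstruction_def quantised_data_cong_AE[OF mu mw ae])
    obtain u where u: "entropy_solution f u0 u"
      and unique: "\<And>v. entropy_solution f u0 v \<Longrightarrow> AE z in lborel. z \<in> half_plane \<longrightarrow> v z = u z"
      and conv: "\<And>\<delta> dx dt. (\<And>k. admissible_grid \<alpha> \<nu> (\<delta> k) (dx k) (dt k)) \<Longrightarrow> \<delta> \<longlonglongrightarrow> 0 \<Longrightarrow> dx \<longlonglongrightarrow> 0 \<Longrightarrow> dt \<longlonglongrightarrow> 0 \<Longrightarrow>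
         (\<lambda>k. \<delta> k / dx k) \<longlonglongrightarrow> 0 \<Longrightarrow> tendsto_L1_loc (\<lambda>k. reconstruction rnd fp fm u0 (\<delta> k) (dx k) (dt k)) u"
      using scheme_convergence[OF assms(1) assms(12) assms(13) mw wM] unfolding es rec by blast
    show "\<exists>u. entropy_solution f u0 u
             \<and> (\<forall>v. entropy_solution f u0 v \<longrightarrow> (AE z in lborel. z \<in> half_plane \<longrightarrow> v z = u z))
             \<and> (\<forall>\<delta> dx dt :: nat \<Rightarrow> real.
                  (\<forall>k. admissible_grid \<alpha> \<nu> (\<delta> k) (dx k) (dt k))
                  \<and> \<delta> \<longlonglongrightarrow> 0 \<and> dx \<longlonglongrightarrow> 0 \<and> dt \<longlonglongrightarrow> 0
                  \<and> (\<lambda>k. \<delta> k / dx k) \<longlonglongrightarrow> 0 \<longrightarrow>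
                  (\<exists>r. strict_mono r
                     \<and> tendsto_L1_loc
                         (\<lambda>k. reconstruction rnd fp fm u0 (\<delta> (r k)) (dx (r k)) (dt (r k))) u))"
    proof (intro exI[of _ u] conjI allI impI)
      fix \<delta> dx dt :: "nat \<Rightarrow> real"
      assume "(\<forall>k. admissible_grid \<alpha> \<nu> (\<delta> k) (dx k) (dt k))
                  \<and> \<delta> \<longlonglongrightarrow> 0 \<and> dx \<longlonglongrightarrow> 0 \<and> dt \<longlonglongrightarrow> 0 \<and> (\<lambda>k. \<delta> k / dx k) \<longlonglongrightarrow> 0"
      then have "tendsto_L1_loc (\<lambda>k. reconstruction rnd fp fm u0 (\<delta> k) (dx k) (dt k)) u"
        by (intro conv) auto
      then show "\<exists>r. strict_mono r \<and> tendsto_L1_loc (\<lambda>k. reconstruction rnd fp fm u0 (\<delta> (r k)) (dx (r k)) (dt (r k))) u"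
        \<comment> \<open>The whole sequence converges, so the identity serves as the
          subsequence.\<close>
        by (intro exI[of _ "\<lambda>k. k"]) (simp add: strict_mono_def)
    qed (use u unique in auto)
  qed
qed

end
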